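(* Let $d\ge 2$, $k\ge 1$, let $T\subset\mathbb R^d$ be a $d$-simplex with barycentric refinement $T^{\rm R}$, and let $\Sigma_{k,\phi}^{\operatorname{div}}(T^{\rm R};\mathbb S)$ be the space defined in the context. For each $f\in\Delta_\ell(T)$ use the face normals $\{\boldsymbol n_{F_i}: i\in f^*\}$ as basis of $\mathscr N^f$; for each $f\in\Delta_\ell(\mathring T^{\rm R})$ fix a basis $\boldsymbol n^f_1,\dots,\boldsymbol n^f_{d-\ell}$ of $\mathscr N^f$; and for every $f\in\Delta_\ell(T^{\rm R})$ with $\ell\ge1$ that lies in an interior face fix a basis $\boldsymbol t^f_1,\dots,\boldsymbol t^f_\ell$ of $\mathscr T^f$. Then the degrees of freedom (a) $\int_f (\boldsymbol\tau\boldsymbol n_F)|_F\cdot\boldsymbol q\,\mathrm ds$ for $f\in\Delta_\ell(T)$, $F\in\Delta_{d-1}(T)$ with $f\subseteq F$, $\boldsymbol q\in\mathbb P_{k-(\ell+1)}(f;\mathbb R^d)$, $\ell=0,\dots,d-1$; (b) $\int_f\big((\boldsymbol n^f_i)^{\intercal}\boldsymbol\tau\boldsymbol n^f_j\big)q\,\mathrm ds$ for $f\in\Delta_\ell(\mathring T^{\rm R})$, $q\in\mathbb P_{k-(\ell+1)}(f)$, $1\le i\le j\le d-\ell$, $\ell=0,\dots,d-1$; (c) $\int_f\big((\boldsymbol t^f_i)^{\intercal}\boldsymbol\tau\boldsymbol n_F\big)|_F\,q\,\mathrm ds$ for $F\in\Delta_{d-1}(\mathring T^{\rm R})$, $f\in\Delta_\ell(F)$,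 $q\in\mathbb P_{k-(\ell+1)}(f)$, $i=1,\dots,\ell$, $\ell=1,\dots,d-1$; (d) $\int_{T_i}\boldsymbol\tau:\boldsymbol q\,\mathrm dx$ for $i=0,\dots,d$, $\boldsymbol q\in\mathbb B_k(\operatorname{div},T_i;\mathbb S)$ (with test functions ranging over bases of the indicated spaces) are unisolvent for $\Sigma_{k,\phi}^{\operatorname{div}}(T^{\rm R};\mathbb S)$, i.e. every $\boldsymbol\tau$ in this space is uniquely determined by them and their values can be prescribed arbitrarily.
   Context: $\mathbb S$: real symmetric $d\times d$ matrices; $\operatorname{sym}\boldsymbol\tau=(\boldsymbol\tau+\boldsymbol\tau^{\intercal})/2$; $\mathbb S(V)=\operatorname{sym}(V\otimes V)$ for a subspace $V\subseteq\mathbb R^d$. $H(\operatorname{div},D;\mathbb S)=\{\boldsymbol\tau\in L^2(D;\mathbb S):\operatorname{div}\boldsymbol\tau\in L^2(D;\mathbb R^d)\}$ (row-wise divergence), $H_0(\operatorname{div},D;\mathbb S)$ is its subspace with $\boldsymbol\tau\boldsymbol n|_{\partial D}=0$. Split. $T$ has vertices $\texttt v_0,\dots,\texttt v_d$ and barycenter $\texttt v_c$; $T_i$ is the simplex obtained from $T$ by replacing $\texttt v_i$ by $\texttt v_c$; $T^{\rm R}=\{T_0,\dots,T_d\}$. $\Delta_\ell(\cdot)$ denotes the set of $\ell$-dimensional subsimplices; $\Delta_\ell(\mathring T^{\rm R})=\Delta_\ell(T^{\rm R})\setminus\Delta_\ell(T)$ are those containing $\texttt v_c$. Subsimplices are identified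 with subsets of $\{0,\dots,d,c\}$. For $f\in\Delta_\ell(T)$, $f^*=\{0,\dots,d\}\setminus f$, and $f(0)$ is a fixed (say the first) vertex of $f$. $F_i$ is the face of $T$ opposite $\texttt v_i$; $\boldsymbol n_F$ is a fixed unit normal of a $(d-1)$-face $F$. $\boldsymbol t_{i,j}=\texttt v_j-\texttt v_i$ for $i,j\in\{0,\dots,d,c\}$. $\mathscr T^f$ is the tangent space of $f$, $\mathscr N^f$ its orthogonal complement, $\mathscr N^f(\mathbb S)=\mathbb S(\mathscr N^f)\oplus\operatorname{sym}(\mathscr T^f\otimes\mathscr N^f)$. The interior $(d-1)$-faces are $F_{ij}=T_i\cap T_j$, $0\le i<j\le d$. Bubbles. $\lambda_i^{\rm R}$ ($i\in\{0,\dots,d,c\}$) is the continuous piecewise linear function on $T^{\rm R}$ with $\lambda_i^{\rm R}(\texttt v_j)=\delta_{ij}$; $b_f^{\rm R}=\prod_{i\in f}\lambda_i^{\rm R}$. $\mathbb P_r(f)$ is the space of polynomials of degree $\le r$ on $f$, $\{0\}$ if $r<0$, and $\mathbb R$ if $f$ is a vertex and $r\ge 0$ (then $\int_f u\,\mathrm ds=u(f)$); its elements are extended to $T$ as homogeneous polynomials of degree $r$ in $\lambda_i^{\rm R}$, $i\in f$. For $f\in\Delta_\ell(T^{\rm R})$ and a space $V^f$ of tensors (constant or piecewise constant), $\mathbb B_kV^f=b_f^{\rm R}\,\mathbb P_{k-\ell-1}(f)\otimes V^f$. Enrichment. For $f\in\Delta_\ell(T)$ and $i,j\in f^*$, $\boldsymbol\phi^f_{ij}=\chi_{T_i}\operatorname{sym}(\boldsymbol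 t_{f(0),c}\otimes\boldsymbol t_{f(0),j})-\chi_{T_j}\operatorname{sym}(\boldsymbol t_{f(0),c}\otimes\boldsymbol t_{f(0),i})$ ($\chi$: characteristic function), and $\Phi^f(\mathbb S)=\operatorname{span}\{\boldsymbol\phi^f_{ij}:i,j\in f^*,i<j\}$ (so $\Phi^F(\mathbb S)=\{0\}$ for $F\in\Delta_{d-1}(T)$). Interior tangential-normal functions. For an interior face $F=T_i\cap T_j$ and $f\in\Delta_\ell(F)$, $\mathbb B_k\operatorname{sym}(\mathscr T^f\otimes\mathscr N^F)$ is the span of the functions supported on $T_i\cup T_j$ and equal on $T_m$, $m\in\{i,j\}$, to $b_f^{\rm R}\,p\,\operatorname{sym}(\boldsymbol t\otimes\hat{\boldsymbol n}^m)$, with $p\in\mathbb P_{k-\ell-1}(f)$, $\boldsymbol t\in\mathscr T^f$, where $\hat{\boldsymbol n}^m\in\mathscr N^f$ is determined by $\hat{\boldsymbol n}^m\cdot\boldsymbol n_F=1$ and $\hat{\boldsymbol n}^m\cdot\boldsymbol n_{F'}=0$ for all other $(d-1)$-faces $F'\supseteq f$ of $T_m$. Element bubbles. $\mathbb B_k(\operatorname{div},T_i;\mathbb S)=H_0(\operatorname{div},T_i;\mathbb S)\cap\mathbb P_k(T_i;\mathbb S)$, extended by zero to $T$. Space. $$\Sigma_{k,\phi}^{\operatorname{div}}(T^{\rm R};\mathbb S)=\sum_{\ell=0}^{d-1}\Big[\sum_{f\in\Delta_\ell(T)}\big(\mathbb B_k\mathscr N^f(\mathbb S)+\mathbb B_k\Phi^f(\mathbb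 S)\big)+\sum_{f\in\Delta_\ell(\mathring T^{\rm R})}\mathbb B_k\mathbb S(\mathscr N^f)\Big]+\sum_{F\in\Delta_{d-1}(\mathring T^{\rm R})}\sum_{\ell=0}^{d-1}\sum_{f\in\Delta_\ell(F)}\mathbb B_k\operatorname{sym}(\mathscr T^f\otimes\mathscr N^F)+\sum_{i=0}^d\mathbb B_k(\operatorname{div},T_i;\mathbb S).$$ In (b) and (c) the integrands are single-valued on $f$ (resp. $F$) for elements of this space, so they may be evaluated from any adjacent subsimplex. *)

theory Defs
  imports "HOL-Analysis.Analysis" "HOL-Library.Function_Algebras"
begin

text \<open>Pointwise vector space structure on functions, so that \<^const>\<open>span\<close> and
  \<^term>\<open>independent\<close> apply to spaces of (piecewise) polynomial fields.\<close>

instantiation "fun" :: (type, real_vector) real_vector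
begin

definition scaleR_fun :: "real \<Rightarrow> ('a \<Rightarrow> 'b) \<Rightarrow> 'a \<Rightarrow> 'b"
  where "scaleR_fun r f = (\<lambda>x. r *\<^sub>R f x)"

instance
  by standard (auto simp: scaleR_fun_def fun_eq_iff algebra_simps)

end

definition basis_of :: "'a::real_vector set \<Rightarrow> 'a set \<Rightarrow> bool"
  where "basis_of B V \<longleftrightarrow> independent B \<and> span B = V"

definition indexed_basis_of :: "(nat \<Rightarrow> 'a::real_vector) \<Rightarrow> nat set \<Rightarrow> 'a set \<Rightarrow> bool"
  where "indexed_basis_of b I V \<longleftrightarrow> inj_on b I \<and> basis_of (b ` I) V"

text \<open>
  The simplex \<open>T\<close> in \<open>\<real>\<^sup>d\<close>, \<open>d = CARD('n)\<close>, is given by its vertices \<open>v 0, \<dots>, v d\<close>.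
  The index \<open>c\<close> of the barycenter is \<^term>\<open>Suc d\<close>, and subsimplices are identified with
  sets of indices.
\<close>

definition node :: "(nat \<Rightarrow> real^'n) \<Rightarrow> nat \<Rightarrow> real^'n"
  where "node v i =
    (if i \<le> CARD('n) then v i else (1 / real (CARD('n) + 1)) *\<^sub>R (\<Sum>j\<le>CARD('n). v j))"

definition simplex_of :: "(nat \<Rightarrow> real^'n) \<Rightarrow> nat set \<Rightarrow> (real^'n) set"
  where "simplex_of v f = convex hull (node v ` f)"

definition cell :: "nat \<Rightarrow> nat \<Rightarrow> nat set"
  where "cell d m = insert (Suc d) ({..d} - {m})"

definition subsimplices :: "nat \<Rightarrow> nat set \<Rightarrow> nat set set"
  where "subsimplices l A = {f. f \<subseteq> A \<and> card f = l + 1}"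

definition T_simplices :: "nat \<Rightarrow> nat \<Rightarrow> nat set set"
  where "T_simplices d l = subsimplices l {..d}"

definition R_simplices :: "nat \<Rightarrow> nat \<Rightarrow> nat set set"
  where "R_simplices d l = (\<Union>m\<le>d. subsimplices l (cell d m))"

definition interior_simplices :: "nat \<Rightarrow> nat \<Rightarrow> nat set set"
  where "interior_simplices d l = R_simplices d l - T_simplices d l"

definition tangent :: "(nat \<Rightarrow> real^'n) \<Rightarrow> nat set \<Rightarrow> (real^'n) set"
  where "tangent v f = span {node v j - node v i | i j. i \<in> f \<and> j \<in> f}"

definition normal_vectors :: "(nat \<Rightarrow> real^'n) \<Rightarrow> nat set \<Rightarrow> (real^'n) set"
  where "normal_vectors v f = orthogonal_comp (tangent v f)"

definition outer :: "real^'n \<Rightarrow> real^'n \<Rightarrow> real^'n^'n"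
  where "outer a b = (\<chi> i j. a $ i * b $ j)"

definition symt :: "real^'n^'n \<Rightarrow> real^'n^'n"
  where "symt A = (1/2) *\<^sub>R (A + transpose A)"

definition sym_tensor :: "(real^'n) set \<Rightarrow> (real^'n) set \<Rightarrow> (real^'n^'n) set"
  where "sym_tensor V W = span {symt (outer a b) | a b. a \<in> V \<and> b \<in> W}"

definition normal_sym :: "(nat \<Rightarrow> real^'n) \<Rightarrow> nat set \<Rightarrow> (real^'n^'n) set"
  where "normal_sym v f = {A + B | A B.
    A \<in> sym_tensor (normal_vectors v f) (normal_vectors v f) \<and>
    B \<in> sym_tensor (tangent v f) (normal_vectors v f)}"

text \<open>The functions \<open>\<lambda>\<^sub>i\<^sup>R\<close>, with the value 0 outside \<open>T\<close>.\<close>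

definition hat :: "(nat \<Rightarrow> real^'n) \<Rightarrow> nat \<Rightarrow> real^'n \<Rightarrow> real"
  where "hat v i = (THE g.
    continuous_on (simplex_of v {..CARD('n)}) g \<and>
    (\<forall>m\<le>CARD('n). \<exists>a b. \<forall>x \<in> simplex_of v (cell CARD('n) m). g x = a \<bullet> x + b) \<and>
    (\<forall>j\<le>Suc CARD('n). g (node v j) = (if j = i then 1 else 0)) \<and>
    (\<forall>x. x \<notin> simplex_of v {..CARD('n)} \<longrightarrow> g x = 0))"

definition bubble :: "(nat \<Rightarrow> real^'n) \<Rightarrow> nat set \<Rightarrow> real^'n \<Rightarrow> real"
  where "bubble v f x = (\<Prod>i\<in>f. hat v i x)"

text \<open>The degrees are integers, so that the polynomial spaces are \<open>{0}\<close> in negative degree.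
  Functions on a set \<open>S\<close> are represented by functions that vanish outside \<open>S\<close>.\<close>

definition polys :: "int \<Rightarrow> (real^'n \<Rightarrow> real) set"
  where "polys r = span {(\<lambda>x. \<Prod>i\<in>UNIV. x $ i ^ \<alpha> i) | \<alpha>. int (\<Sum>i\<in>UNIV. \<alpha> i) \<le> r}"

definition restrict_zero :: "'a set \<Rightarrow> ('a \<Rightarrow> 'b::zero) \<Rightarrow> 'a \<Rightarrow> 'b"
  where "restrict_zero S p x = (if x \<in> S then p x else 0)"

definition face_polys :: "(nat \<Rightarrow> real^'n) \<Rightarrow> int \<Rightarrow> nat set \<Rightarrow> (real^'n \<Rightarrow> real) set"
  where "face_polys v r f = restrict_zero (simplex_of v f) ` polys r"

definition face_vec_polys :: "(nat \<Rightarrow> real^'n) \<Rightarrow> int \<Rightarrow> nat set \<Rightarrow> (real^'n \<Rightarrow> real^'n) set"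
  where "face_vec_polys v r f = {q. \<forall>i. (\<lambda>x. q x $ i) \<in> face_polys v r f}"

definition cell_sym_polys :: "(nat \<Rightarrow> real^'n) \<Rightarrow> nat \<Rightarrow> nat \<Rightarrow> (real^'n \<Rightarrow> real^'n^'n) set"
  where "cell_sym_polys v k m = {\<tau>.
    (\<forall>i j. (\<lambda>x. \<tau> x $ i $ j) \<in> face_polys v (int k) (cell CARD('n) m)) \<and>
    (\<forall>x. transpose (\<tau> x) = \<tau> x)}"

text \<open>The extensions to \<open>T\<close> of the elements of \<open>\<P>\<^sub>r(f)\<close>.\<close>

definition extended_polys :: "(nat \<Rightarrow> real^'n) \<Rightarrow> int \<Rightarrow> nat set \<Rightarrow> (real^'n \<Rightarrow> real) set"
  where "extended_polys v r f =
    span {(\<lambda>x. \<Prod>i\<in>f. hat v i x ^ \<alpha> i) | \<alpha>. int (\<Sum>i\<in>f. \<alpha> i) = r}"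

text \<open>
  A piecewise smooth tensor field on \<open>T\<^sup>R\<close> is the family of its restrictions to the closed cells
  \<open>T\<^sub>0, \<dots>, T\<^sub>d\<close>: the first argument is the number of the cell, and the value is 0 off that cell.
  So a field has a trace from each adjacent cell on every subsimplex.  In the same way, a
  piecewise constant tensor is a function of the number of the cell.
\<close>

type_synonym 'n pw_field = "nat \<Rightarrow> real^'n \<Rightarrow> real^'n^'n"

definition bubble_space ::
    "(nat \<Rightarrow> real^'n) \<Rightarrow> nat \<Rightarrow> nat set \<Rightarrow> (nat \<Rightarrow> real^'n^'n) set \<Rightarrow> 'n pw_field set"
  where "bubble_space v k f V = span
    {(\<lambda>m x. if m \<le> CARD('n) \<and> x \<in> simplex_of v (cell CARD('n) m)
             then (bubble v f x * p x) *\<^sub>R A m else 0) | p A.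
      p \<in> extended_polys v (int k - int (card f)) f \<and> A \<in> V}"

definition constant_tensors :: "(real^'n^'n) set \<Rightarrow> (nat \<Rightarrow> real^'n^'n) set"
  where "constant_tensors V = (\<lambda>A m. A) ` V"

text \<open>The index \<open>z\<close> is the chosen vertex \<open>f(0)\<close> of \<open>f\<close>.\<close>

definition enrichment :: "(nat \<Rightarrow> real^'n) \<Rightarrow> nat \<Rightarrow> nat \<Rightarrow> nat \<Rightarrow> nat \<Rightarrow> real^'n^'n"
  where "enrichment v z i j m =
    (let t = (\<lambda>l. node v l - node v z); c = Suc CARD('n) in
      (if m = i then symt (outer (t c) (t j)) else 0) -
      (if m = j then symt (outer (t c) (t i)) else 0))"

definition enrichment_space ::
    "(nat \<Rightarrow> real^'n) \<Rightarrow> nat \<Rightarrow> nat set \<Rightarrow> (nat \<Rightarrow> real^'n^'n) set"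
  where "enrichment_space v z f = span {enrichment v z i j | i j.
    i \<in> {..CARD('n)} - f \<and> j \<in> {..CARD('n)} - f \<and> i < j}"

text \<open>The map \<open>nrm\<close> gives the fixed unit normals of the \<open>(d-1)\<close>-faces of \<open>T\<^sup>R\<close>.\<close>

definition dual_normal ::
    "(nat \<Rightarrow> real^'n) \<Rightarrow> (nat set \<Rightarrow> real^'n) \<Rightarrow> nat set \<Rightarrow> nat set \<Rightarrow> nat \<Rightarrow> real^'n"
  where "dual_normal v nrm F f m = (THE w.
    w \<in> normal_vectors v f \<and> w \<bullet> nrm F = 1 \<and>
    (\<forall>G \<in> subsimplices (CARD('n) - 1) (cell CARD('n) m).
      f \<subseteq> G \<and> G \<noteq> F \<longrightarrow> w \<bullet> nrm G = 0))"

text \<open>The cells containing an interior face \<open>F = T\<^sub>i \<inter> T\<^sub>j\<close> are \<open>T\<^sub>i\<close> and \<open>T\<^sub>j\<close>.\<close>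

definition tangential_normal_space ::
    "(nat \<Rightarrow> real^'n) \<Rightarrow> (nat set \<Rightarrow> real^'n) \<Rightarrow> nat \<Rightarrow> nat set \<Rightarrow> nat set \<Rightarrow> 'n pw_field set"
  where "tangential_normal_space v nrm k F f = span
    {(\<lambda>m x. if m \<le> CARD('n) \<and> F \<subseteq> cell CARD('n) m \<and> x \<in> simplex_of v (cell CARD('n) m)
             then (bubble v f x * p x) *\<^sub>R symt (outer t (dual_normal v nrm F f m)) else 0) | p t.
      p \<in> extended_polys v (int k - int (card f)) f \<and> t \<in> tangent v f}"

definition L2_on :: "'a::euclidean_space set \<Rightarrow> ('a \<Rightarrow> 'b::euclidean_space) set"
  where "L2_on D = {u. u \<in> borel_measurable (lebesgue_on D) \<and>
    integrable (lebesgue_on D) (\<lambda>x. (norm (u x))\<^sup>2)}"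

text \<open>The row-wise divergence is taken in the weak sense: \<open>(\<tau> \<nabla>\<psi>)\<^sub>i = \<Sum>\<^sub>j \<tau>\<^sub>i\<^sub>j \<partial>\<^sub>j\<psi>\<close> for scalar
  test functions \<open>\<psi>\<close> of class \<open>C\<^sup>1\<close> with compact support in the interior of \<open>D\<close>.\<close>

definition has_weak_div ::
    "(real^'n \<Rightarrow> real^'n^'n) \<Rightarrow> (real^'n \<Rightarrow> real^'n) \<Rightarrow> (real^'n) set \<Rightarrow> bool"
  where "has_weak_div \<tau> g D \<longleftrightarrow> (\<forall>\<psi> grad.
    (\<forall>x. (\<psi> has_derivative (\<lambda>h. grad x \<bullet> h)) (at x)) \<and> continuous_on UNIV grad \<and>
    (\<exists>C. compact C \<and> C \<subseteq> interior D \<and> (\<forall>x. x \<notin> C \<longrightarrow> \<psi> x = 0)) \<longrightarrow>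
    (LINT x|lebesgue_on D. \<tau> x *v grad x) = - (LINT x|lebesgue_on D. \<psi> x *\<^sub>R g x))"

definition H_div :: "(real^'n) set \<Rightarrow> (real^'n \<Rightarrow> real^'n^'n) set"
  where "H_div D = {\<tau> \<in> L2_on D. (\<forall>x\<in>D. transpose (\<tau> x) = \<tau> x) \<and>
    (\<exists>g \<in> L2_on D. has_weak_div \<tau> g D)}"

text \<open>\<open>H\<^sub>0(div, T\<^sub>m; S) \<inter> \<P>\<^sub>k(T\<^sub>m; S)\<close>: the trace \<open>\<tau> n\<close> of a polynomial field on the boundary is the
  pointwise one, on each face of the cell.\<close>

definition cell_bubbles ::
    "(nat \<Rightarrow> real^'n) \<Rightarrow> (nat set \<Rightarrow> real^'n) \<Rightarrow> nat \<Rightarrow> nat \<Rightarrow> (real^'n \<Rightarrow> real^'n^'n) set"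
  where "cell_bubbles v nrm k m =
    {\<tau> \<in> H_div (simplex_of v (cell CARD('n) m)) \<inter> cell_sym_polys v k m.
      \<forall>F \<in> subsimplices (CARD('n) - 1) (cell CARD('n) m).
        \<forall>x \<in> simplex_of v F. \<tau> x *v nrm F = 0}"

definition extend_from_cell :: "nat \<Rightarrow> (real^'n \<Rightarrow> real^'n^'n) \<Rightarrow> 'n pw_field"
  where "extend_from_cell m \<tau> m' = (if m' = m then \<tau> else 0)"

text \<open>The sum of the spaces is the span of their union.  The map \<open>base\<close> gives the vertices
  \<open>f(0)\<close>.\<close>

definition Sigma_div ::
    "(nat \<Rightarrow> real^'n) \<Rightarrow> (nat set \<Rightarrow> real^'n) \<Rightarrow> (nat set \<Rightarrow> nat) \<Rightarrow> nat \<Rightarrow> 'n pw_field set"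
  where "Sigma_div v nrm base k = (let d = CARD('n) in span
    ((\<Union>l<d.
        (\<Union>f \<in> T_simplices d l.
          bubble_space v k f (constant_tensors (normal_sym v f)) \<union>
          bubble_space v k f (enrichment_space v (base f) f)) \<union>
        (\<Union>f \<in> interior_simplices d l.
          bubble_space v k f
            (constant_tensors (sym_tensor (normal_vectors v f) (normal_vectors v f))))) \<union>
     (\<Union>F \<in> interior_simplices d (d - 1). \<Union>l<d. \<Union>f \<in> subsimplices l F.
        tangential_normal_space v nrm k F f) \<union>
     (\<Union>m\<le>d. extend_from_cell m ` cell_bubbles v nrm k m)))"

text \<open>
  The integral over a subsimplex \<open>f\<close> of dimension \<open>l\<close> with respect to the \<open>l\<close>-dimensional
  surface measure: Lebesgue measure in Cartesian coordinates on the affine hull of \<open>f\<close>, with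
  respect to any orthonormal basis of the tangent space.  For a vertex this is the value there,
  since the empty product measure is a point mass.
\<close>

definition face_integral ::
    "(nat \<Rightarrow> real^'n) \<Rightarrow> nat set \<Rightarrow> (real^'n \<Rightarrow> real) \<Rightarrow> real"
  where "face_integral v f u = (let
      l = card f - 1;
      e = (SOME e :: nat \<Rightarrow> real^'n.
            (\<forall>i<l. e i \<in> tangent v f) \<and>
            (\<forall>i<l. \<forall>j<l. e i \<bullet> e j = (if i = j then 1 else 0)))
    in LINT y|(Pi\<^sub>M {..<l} (\<lambda>_. lborel)).
         restrict_zero (simplex_of v f) u (node v (Min f) + (\<Sum>i<l. y i *\<^sub>R e i)))"

end

theory Submission
  imports Defs
begin

text \<open>
  The spaces are arranged in blocks: for every face \<open>f\<close> the bubbles \<open>b\<^sub>f p\<close> times the normal (and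
  enrichment) tensors, for every pair of an interior facet \<open>F\<close> and a face \<open>f\<close> of \<open>F\<close> the
  tangential-normal bubbles, and for every cell its bubbles. Since \<open>b\<^sub>g\<close> vanishes on \<open>f\<close> unless
  \<open>g \<subseteq> f\<close>, the degrees of freedom are block triangular with respect to the dimension of the
  face, where at a fixed \<open>f\<close> the first kind of block precedes the second. In a diagonal block the
  tensor factor is determined by components that separate the tensors, and the polynomial factor by
  its moments, because \<open>\<integral>\<^sub>f b\<^sub>f p q\<close> is an inner product on the polynomials on \<open>f\<close> and
  the homogeneous extension of a polynomial on \<open>f\<close> is unique.
\<close>

section \<open>Linear algebra\<close>

text \<open>The obstacle sits on the faces of T itself. There the functionals prescribe the whole
  vector tau n_i, taken from T_i, for every facet F_i containing f, so that the numbers n_j . tau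
  n_i and n_i . tau n_j are unrelated data, whereas a constant symmetric tensor makes them equal. As
  F_i and F_j lie in different cells, a tensor that jumps between the cells can break this symmetry,
  and the enrichment supplies exactly the antisymmetric part. Existence and uniqueness are carried
  together as unique existence, block by block, and no dimension of a function space is counted: in
  a diagonal block it is enough that the chosen components separate the tensors and take arbitrary
  values. Blocks that meet at the same f are decoupled by their tensors. A tangential-normal tensor
  has no normal-normal component, and its dual normal hides it from every facet but its own; a cell
  bubble has no normal trace at all. Bubbles on f are compared through their traces on f alone,
  since homogeneity then fixes them on all of T.\<close>

lemma linear_zero_on_span:
  fixes g :: "'a::real_vector \<Rightarrow> real"
  assumes add: "\<And>x y. x \<in> span Q \<Longrightarrow> y \<in> span Q \<Longrightarrow> g (x + y) = g x + g y"
    and scale: "\<And>c x. x \<in> span Q \<Longrightarrow> g (c *\<^sub>R x) = c * g x"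
    and zero: "\<And>q. q \<in> Q \<Longrightarrow> g q = 0"
    and "x \<in> span Q"
  shows "g x = 0"
proof -
  have "x \<in> span Q \<and> g x = 0"
    using \<open>x \<in> span Q\<close>
  proof (induction rule: span_induct_alt)
    case base
    show ?case using scale[of 0 0] by (simp add: span_zero)
  next
    case (step c x y)
    then have "x \<in> span Q" by (simp add: span_base)
    then show ?case
      using step add[of "c *\<^sub>R x" y] scale[of x c] zero by (simp add: span_add span_scale)
  qed
  then show ?thesis by simp
qed

text \<open>Gram-Schmidt, one basis vector at a time. The conditions on \<open>B\<close> are
  confined to \<open>span Q\<close>: the forms used later are integrals, which are additive on
  integrable functions only, so that \<open>B\<close> is not linear on the whole type.\<close>

lemma gram_solve_exists:
  fixes B :: "'a::real_vector \<Rightarrow> 'a \<Rightarrow> real"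
  assumes "finite Q" and "independent Q"
    and add: "\<And>x y z. x \<in> span Q \<Longrightarrow> y \<in> span Q \<Longrightarrow> z \<in> span Q \<Longrightarrow> B (x + y) z = B x z + B y z"
    and scale: "\<And>c x z. x \<in> span Q \<Longrightarrow> z \<in> span Q \<Longrightarrow> B (c *\<^sub>R x) z = c * B x z"
    and sym: "\<And>x y. x \<in> span Q \<Longrightarrow> y \<in> span Q \<Longrightarrow> B x y = B y x"
    and def: "\<And>x. x \<in> span Q \<Longrightarrow> B x x = 0 \<Longrightarrow> x = 0"
  shows "\<exists>w \<in> span Q. \<forall>q\<in>Q. B w q = a q"
  using assms
proof (induction Q arbitrary: a rule: finite_induct)
  case empty
  show ?case by (rule bexI[of _ 0]) simp_all
next
  case (insert q0 Q)
  have sub: "x \<in> span Q \<Longrightarrow> x \<in> span (insert q0 Q)" for x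
    by (meson span_mono subsetD subset_insertI)
  have ind: "independent Q" "q0 \<notin> span Q"
    using insert.prems(1) insert.hyps by (auto simp: independent_insert)
  have IH: "\<exists>w \<in> span Q. \<forall>q\<in>Q. B w q = a q" for a
  proof (rule insert.IH[OF ind(1)])
    show "B (x + y) z = B x z + B y z" if "x \<in> span Q" "y \<in> span Q" "z \<in> span Q" for x y z
      using insert.prems(2)[OF that[THEN sub]] .
    show "B (c *\<^sub>R x) z = c * B x z" if "x \<in> span Q" "z \<in> span Q" for c x z
      using insert.prems(3)[OF that[THEN sub]] .
    show "B x y = B y x" if "x \<in> span Q" "y \<in> span Q" for x y
      using insert.prems(4)[OF that[THEN sub]] .
    show "x = 0" if "x \<in> span Q" "B x x = 0" for x
      using insert.prems(5)[OF sub] that by blast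
  qed
  have q0: "q0 \<in> span (insert q0 Q)" by (simp add: span_base)
  have qs: "q \<in> Q \<Longrightarrow> q \<in> span (insert q0 Q)" for q by (simp add: span_base)
  obtain p where p: "p \<in> span Q" "\<forall>q\<in>Q. B p q = B q0 q" using IH[of "B q0"] by blast
  obtain w where w: "w \<in> span Q" "\<forall>q\<in>Q. B w q = a q" using IH[of a] by blast
  \<comment> \<open>The vector \<open>p\<close> has the same products with \<open>Q\<close> as
    \<open>q0\<close>, so \<open>u\<close> is the part of \<open>q0\<close> that is
    \<open>B\<close>-orthogonal to \<open>span Q\<close>.\<close>
  define u where "u = q0 + (-1) *\<^sub>R p"
  have u: "u \<in> span (insert q0 Q)" unfolding u_def using sub[OF p(1)] q0
    by (intro span_add span_scale)
  have Bu: "B u z = B q0 z - B p z" if "z \<in> span (insert q0 Q)" for z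
    unfolding u_def using insert.prems(2)[OF q0 span_scale[OF sub[OF p(1)], of "-1"] that]
      insert.prems(3)[OF sub[OF p(1)] that, of "-1"] by linarith
  have uq: "B u q = 0" if "q \<in> Q" for q
    using Bu[OF qs[OF that]] p(2) that by simp
  have "B p u = 0"
  proof (rule linear_zero_on_span[OF _ _ _ p(1)])
    show "B (x + y) u = B x u + B y u" if "x \<in> span Q" "y \<in> span Q" for x y
      using insert.prems(2)[OF that[THEN sub] u] .
    show "B (c *\<^sub>R x) u = c * B x u" if "x \<in> span Q" for c x
      using insert.prems(3)[OF sub[OF that] u] .
    show "B q u = 0" if "q \<in> Q" for q
      using insert.prems(4)[OF u qs[OF that]] uq[OF that] by simp
  qed
  then have up: "B u p = 0" using insert.prems(4)[OF u sub[OF p(1)]] by simp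
  have "u \<noteq> 0" using ind(2) p(1) unfolding u_def by auto
  then have "B u u \<noteq> 0" using insert.prems(5)[OF u] by blast
  moreover have "B u u = B u q0"
  proof -
    have "B u u = B q0 u - B p u" using Bu[OF u] .
    then show ?thesis using up insert.prems(4)[OF u q0] insert.prems(4)[OF u sub[OF p(1)]] by simp
  qed
  ultimately have nz: "B u q0 \<noteq> 0" by simp
  \<comment> \<open>Adding a multiple of \<open>u\<close> leaves the products with \<open>Q\<close>
    unchanged; this multiple corrects the product with \<open>q0\<close>.\<close>
  define t where "t = (a q0 - B w q0) / B u q0"
  have eq: "B (w + t *\<^sub>R u) z = B w z + t * B u z" if "z \<in> span (insert q0 Q)" for z
    using insert.prems(2)[OF sub[OF w(1)] span_scale[OF u] that] insert.prems(3)[OF u that] by simp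
  show ?case
  proof (intro bexI ballI)
    show "w + t *\<^sub>R u \<in> span (insert q0 Q)" using u sub[OF w(1)] by (simp add: span_add span_scale)
    fix q assume "q \<in> insert q0 Q"
    then show "B (w + t *\<^sub>R u) q = a q"
      using eq[of q] uq w(2) nz q0 qs by (auto simp: t_def)
  qed
qed

text \<open>Uniqueness: the difference of two solutions is \<open>B\<close>-orthogonal to the basis,
  hence to itself.\<close>

lemma gram_solve:
  fixes B :: "'a::real_vector \<Rightarrow> 'a \<Rightarrow> real"
  assumes "finite Q" and "basis_of Q W"
    and add: "\<And>x y z. x \<in> W \<Longrightarrow> y \<in> W \<Longrightarrow> z \<in> W \<Longrightarrow> B (x + y) z = B x z + B y z"
    and scale: "\<And>c x z. x \<in> W \<Longrightarrow> z \<in> W \<Longrightarrow> B (c *\<^sub>R x) z = c * B x z"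
    and sym: "\<And>x y. x \<in> W \<Longrightarrow> y \<in> W \<Longrightarrow> B x y = B y x"
    and def: "\<And>x. x \<in> W \<Longrightarrow> B x x = 0 \<Longrightarrow> x = 0"
  shows "\<exists>!w. w \<in> W \<and> (\<forall>q\<in>Q. B w q = a q)"
proof -
  have W: "independent Q" "W = span Q" using assms(2) by (auto simp: basis_of_def)
  have QW: "q \<in> Q \<Longrightarrow> q \<in> W" for q by (simp add: W span_base)
  have sW: "subspace W" by (simp add: W)
  have "\<exists>w \<in> W. \<forall>q\<in>Q. B w q = a q"
    unfolding W(2) by (rule gram_solve_exists[OF assms(1) W(1) add scale sym def]) (simp_all add: W)
  moreover have "w = w'" if w: "w \<in> W" "w' \<in> W" "\<forall>q\<in>Q. B w q = a q" "\<forall>q\<in>Q. B w' q = a q" for w w'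
  proof -
    define u where "u = w + (-1) *\<^sub>R w'"
    have u: "u \<in> W" unfolding u_def using w(1,2) sW by (simp add: subspace_diff)
    have uq: "B u q = 0" if "q \<in> Q" for q
    proof -
      have "B u q = B w q - B w' q"
        unfolding u_def using add[OF w(1) subspace_scale[OF sW w(2), of "-1"] QW[OF that]]
          scale[OF w(2) QW[OF that], of "-1"] by linarith
      then show ?thesis using w(3,4) that by simp
    qed
    have "B u u = 0"
    proof (rule linear_zero_on_span[of Q "\<lambda>x. B x u"])
      show "B q u = 0" if "q \<in> Q" for q
        using sym[OF u QW[OF that]] uq[OF that] by simp
    qed (use add scale u W in auto)
    then have "u = 0" using def u by blast
    then show ?thesis by (simp add: u_def)
  qed
  ultimately show ?thesis by blast
qed

text \<open>Back substitution. The induction adds the blocks by increasing rank, so the new block is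
  invisible to the functionals of all earlier ones: solve for those first, then correct inside the
  new block without disturbing them. Blocks of equal rank ignore each other in both
  directions.\<close>

lemma triangular_unisolvence:
  fixes S :: "'i \<Rightarrow> 'a::real_vector set" and L :: "'b \<Rightarrow> 'a \<Rightarrow> real" and r :: "'i \<Rightarrow> nat"
  assumes "finite I" and "\<And>i. i \<in> I \<Longrightarrow> subspace (S i)"
    and "\<And>i b x y. i \<in> I \<Longrightarrow> b \<in> J i \<Longrightarrow> x \<in> span (\<Union>(S ` I)) \<Longrightarrow> y \<in> span (\<Union>(S ` I)) \<Longrightarrow>
           L b (x + y) = L b x + L b y"
    and "\<And>i j b s. i \<in> I \<Longrightarrow> j \<in> I \<Longrightarrow> i \<noteq> j \<Longrightarrow> r j \<le> r i \<Longrightarrow> s \<in> S i \<Longrightarrow> b \<in> J j \<Longrightarrow> L b s = 0"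
    and "\<And>i a. i \<in> I \<Longrightarrow> \<exists>!s. s \<in> S i \<and> (\<forall>b\<in>J i. L b s = a b)"
  shows "\<exists>!s. s \<in> span (\<Union>(S ` I)) \<and> (\<forall>i\<in>I. \<forall>b\<in>J i. L b s = a b)"
  using assms
proof (induction I arbitrary: a rule: finite_ranking_induct[where f = r])
  case empty
  then show ?case by auto
next
  case (insert i I)
  show ?case
  proof (cases "i \<in> I")
    case True
    then show ?thesis using insert.IH insert.prems by (simp add: insert_absorb)
  next
    case False
    let ?X = "span (\<Union>(S ` I))" and ?Y = "span (\<Union>(S ` insert i I))"
    have XY: "x \<in> ?X \<Longrightarrow> x \<in> ?Y" for x
      by (rule subsetD[OF span_mono]) auto
    have SY: "x \<in> S i \<Longrightarrow> x \<in> ?Y" for x by (auto intro: span_base)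
    have add: "L b (x + y) = L b x + L b y" if "j \<in> insert i I" "b \<in> J j" "x \<in> ?Y" "y \<in> ?Y" for j b x y
      using insert.prems(2)[OF that] .
    have L0: "L b 0 = 0" if "j \<in> insert i I" "b \<in> J j" for j b
      using add[OF that span_zero span_zero] by simp
    have tri: "L b s = 0" if "j \<in> I" "s \<in> S i" "b \<in> J j" for j s b
      using insert.prems(3)[of i j s b] insert.hyps that False by auto
    have IH: "\<exists>!s. s \<in> ?X \<and> (\<forall>i\<in>I. \<forall>b\<in>J i. L b s = a b)" for a
    proof (rule insert.IH)
      show "L b (x + y) = L b x + L b y" if "i \<in> I" "b \<in> J i" "x \<in> ?X" "y \<in> ?X" for i b x y
        using add[of i b x y] that XY by blast
      show "L b s = 0" if "i \<in> I" "j \<in> I" "i \<noteq> j" "r j \<le> r i" "s \<in> S i" "b \<in> J j" for i j s b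
        using insert.prems(3)[of i j s b] that by blast
    qed (use insert.prems in auto)
    have split: "\<exists>x\<in>S i. \<exists>y\<in>?X. s = x + y" if "s \<in> ?Y" for s
    proof -
      have "span (S i) = S i" using insert.prems(1) by (simp add: span_eq_iff)
      then show ?thesis using that unfolding image_insert Union_insert span_Un by blast
    qed
    obtain y where y: "y \<in> ?X" "\<forall>i\<in>I. \<forall>b\<in>J i. L b y = a b" using IH by blast
    obtain x where x: "x \<in> S i" "\<forall>b\<in>J i. L b x = a b - L b y"
      using insert.prems(4)[of i "\<lambda>b. a b - L b y"] by auto
    show ?thesis
    proof (rule ex1I[of _ "x + y"])
      show "x + y \<in> ?Y \<and> (\<forall>j\<in>insert i I. \<forall>b\<in>J j. L b (x + y) = a b)"
      proof (intro conjI ballI)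
        show "x + y \<in> ?Y" using SY[OF x(1)] XY[OF y(1)] by (rule span_add)
        fix j b assume j: "j \<in> insert i I" "b \<in> J j"
        then show "L b (x + y) = a b"
          using add[OF j SY[OF x(1)] XY[OF y(1)]] x y tri[of j x b] by auto
      qed
    next
      fix s assume s: "s \<in> ?Y \<and> (\<forall>j\<in>insert i I. \<forall>b\<in>J j. L b s = a b)"
      define u where "u = s - (x + y)"
      have u: "u \<in> ?Y" unfolding u_def using s SY[OF x(1)] XY[OF y(1)] by (simp add: span_diff span_add)
      have Lu: "L b u = 0" if "j \<in> insert i I" "b \<in> J j" for j b
      proof -
        have "L b s = L b (u + (x + y))" by (simp add: u_def)
        also have "\<dots> = L b u + (L b x + L b y)"
          using add[OF that u span_add[OF SY[OF x(1)] XY[OF y(1)]]]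
            add[OF that SY[OF x(1)] XY[OF y(1)]] by simp
        also have "L b x + L b y = a b"
          using that x y tri[of j x b] by auto
        finally show ?thesis using s that by auto
      qed
      obtain x' y' where xy': "x' \<in> S i" "y' \<in> ?X" "u = x' + y'" using split[OF u] by blast
      \<comment> \<open>The functionals of the earlier blocks do not see \<open>x'\<close>, so they
        decide about \<open>y'\<close> alone; after that the new block can be tested.\<close>
      have "L b y' = 0" if "j \<in> I" "b \<in> J j" for j b
        using add[of j b x' y'] that Lu[of j b] tri[of j x' b] xy' SY XY by auto
      then have y0: "y' = 0"
        using IH[of "\<lambda>_. 0"] xy'(2) L0 span_zero[of "\<Union>(S ` I)"] by blast
      then have "L b x' = 0" if "b \<in> J i" for b using Lu[of i b] that xy' by simp
      then have "x' = 0"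
        using insert.prems(4)[of i "\<lambda>_. 0"] xy'(1) L0[of i] insert.prems(1)[of i, THEN subspace_0]
        by blast
      then show "s = x + y" using y0 xy'(3) by (simp add: u_def)
    qed
  qed
qed

lemma linear_mult_vec: "linear (\<lambda>A :: real^'n^'n. A *v w)"
  by (auto simp: matrix_vector_mult_add_rdistrib scaleR_matrix_vector_assoc[symmetric] intro!: linearI)

lemma linear_form: "linear (\<lambda>A :: real^'n^'n. u \<bullet> (A *v w))"
  by (auto simp: matrix_vector_mult_add_rdistrib inner_add_right
      scaleR_matrix_vector_assoc[symmetric] intro!: linearI)

section \<open>Affine geometry of the split simplex\<close>

lemma simplex_of_iff:
  assumes "finite f"
  shows "x \<in> simplex_of v f \<longleftrightarrow>
    (\<exists>a. (\<forall>i\<in>f. 0 \<le> a i) \<and> sum a f = 1 \<and> x = (\<Sum>i\<in>f. a i *\<^sub>R node v i))" (is "_ \<longleftrightarrow> ?R x")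
proof
  assume "?R x"
  then obtain a where a: "\<forall>i\<in>f. 0 \<le> a i" "sum a f = 1" "x = (\<Sum>i\<in>f. a i *\<^sub>R node v i)" by blast
  show "x \<in> simplex_of v f"
    unfolding simplex_of_def a(3)
    by (rule convex_sum[OF assms convex_convex_hull]) (use a in \<open>auto intro: hull_inc\<close>)
next
  have "simplex_of v f \<subseteq> {x. ?R x}"
    unfolding simplex_of_def
  proof (rule hull_minimal)
    show "node v ` f \<subseteq> {x. ?R x}"
    proof (rule image_subsetI, rule CollectI)
      fix j assume j: "j \<in> f"
      show "?R (node v j)"
        using j assms by (intro exI[of _ "\<lambda>i. if i = j then 1 else 0"]) (auto simp: if_distrib[of "\<lambda>t. t *\<^sub>R _"] cong: if_cong)
    qed
    show "convex {x. ?R x}"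
      unfolding convex_def
    proof (intro ballI allI impI, elim CollectE exE conjE, rule CollectI)
      fix x y and s t :: real and a b
      assume st: "0 \<le> s" "0 \<le> t" "s + t = 1"
        and a: "\<forall>i\<in>f. 0 \<le> a i" "sum a f = 1" "x = (\<Sum>i\<in>f. a i *\<^sub>R node v i)"
        and b: "\<forall>i\<in>f. 0 \<le> b i" "sum b f = 1" "y = (\<Sum>i\<in>f. b i *\<^sub>R node v i)"
      show "?R (s *\<^sub>R x + t *\<^sub>R y)"
        using st a b
        by (intro exI[of _ "\<lambda>i. s * a i + t * b i"])
          (auto simp: sum.distrib scaleR_left_distrib scaleR_sum_right simp flip: sum_distrib_left)
    qed
  qed
  then show "x \<in> simplex_of v f \<Longrightarrow> ?R x" by blast
qed

lemma simplex_of_mono: "f \<subseteq> g \<Longrightarrow> simplex_of v f \<subseteq> simplex_of v g"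
  unfolding simplex_of_def by (intro hull_mono image_mono)

lemma compact_simplex_of: "finite f \<Longrightarrow> compact (simplex_of v f)"
  unfolding simplex_of_def by (intro finite_imp_compact_convex_hull) auto

lemma tangent_comb:
  assumes "finite f" and "e \<in> tangent v f"
  shows "\<exists>a. sum a f = 0 \<and> e = (\<Sum>i\<in>f. a i *\<^sub>R node v i)"
  using assms(2) unfolding tangent_def
proof (induction rule: span_induct_alt)
  case base
  show ?case by (rule exI[of _ "\<lambda>_. 0"]) simp
next
  case (step c x y)
  then obtain i j a where ij: "x = node v j - node v i" "i \<in> f" "j \<in> f"
    and a: "sum a f = 0" "y = (\<Sum>i\<in>f. a i *\<^sub>R node v i)" by blast
  show ?case
    unfolding ij(1) using ij(2,3) a assms(1)
    by (intro exI[of _ "\<lambda>l. c * ((if l = j then 1 else 0) - (if l = i then 1 else 0)) + a l"])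
      (simp add: sum.distrib sum_subtractf algebra_simps if_distrib[of "\<lambda>t. t *\<^sub>R _"] if_distrib[of "\<lambda>t. c * t"] cong: if_cong)
qed

lemma diff_node_in_tangent: "i \<in> f \<Longrightarrow> j \<in> f \<Longrightarrow> node v j - node v i \<in> tangent v f"
  unfolding tangent_def by (rule span_base) blast

lemma tangent_mono: "f \<subseteq> g \<Longrightarrow> tangent v f \<subseteq> tangent v g"
  unfolding tangent_def by (rule span_mono) blast

text \<open>Every edge of \<open>f\<close> is a difference of two edges that start at
  \<open>z\<close>.\<close>

lemma normal_vectors_iff:
  assumes "z \<in> f"
  shows "u \<in> normal_vectors v f \<longleftrightarrow> (\<forall>i\<in>f. u \<bullet> (node v i - node v z) = 0)"
proof
  assume u: "u \<in> normal_vectors v f"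
  show "\<forall>i\<in>f. u \<bullet> (node v i - node v z) = 0"
  proof
    fix i assume "i \<in> f"
    then have "node v i - node v z \<in> tangent v f" using assms by (intro diff_node_in_tangent)
    then have "(node v i - node v z) \<bullet> u = 0"
      using u by (simp add: normal_vectors_def orthogonal_comp_def orthogonal_def)
    then show "u \<bullet> (node v i - node v z) = 0" by (subst inner_commute)
  qed
next
  assume u: "\<forall>i\<in>f. u \<bullet> (node v i - node v z) = 0"
  have "orthogonal u x" if "x \<in> tangent v f" for x
    using that unfolding tangent_def
  proof (rule orthogonal_to_span)
    fix y assume "y \<in> {node v j - node v i |i j. i \<in> f \<and> j \<in> f}"
    then obtain i j where "y = node v j - node v i" "i \<in> f" "j \<in> f" by blast
    then show "orthogonal u y" using u by (simp add: orthogonal_def inner_diff_right)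
  qed
  then show "u \<in> normal_vectors v f"
    by (auto simp: normal_vectors_def orthogonal_comp_def orthogonal_commute)
qed

lemma normal_vectors_orth: "u \<in> normal_vectors v f \<Longrightarrow> t \<in> tangent v f \<Longrightarrow> u \<bullet> t = 0 \<and> t \<bullet> u = 0"
  by (auto simp: normal_vectors_def orthogonal_comp_def orthogonal_def inner_commute)

lemma subspace_normal_vectors: "subspace (normal_vectors v f)"
  by (simp add: normal_vectors_def subspace_orthogonal_comp)

lemma subspace_tangent: "subspace (tangent v f)"
  by (simp add: tangent_def)

lemma normal_vectors_mono: "f \<subseteq> g \<Longrightarrow> normal_vectors v g \<subseteq> normal_vectors v f"
  using tangent_mono[of f g v] by (auto simp: normal_vectors_def orthogonal_comp_def)

lemma tangent_normal_decomp: "\<exists>a\<in>tangent v f. \<exists>b\<in>normal_vectors v f. w = a + b"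
proof -
  obtain y z where yz: "y \<in> span (tangent v f)" "\<And>x. x \<in> span (tangent v f) \<Longrightarrow> orthogonal z x" "w = y + z"
    using orthogonal_subspace_decomp_exists[of "tangent v f" w] by blast
  moreover have sp: "span (tangent v f) = tangent v f" by (simp add: tangent_def)
  moreover have "z \<in> normal_vectors v f"
    using yz(2) sp by (auto simp: normal_vectors_def orthogonal_comp_def orthogonal_commute)
  ultimately show ?thesis by blast
qed

locale simplex_split =
  fixes v :: "nat \<Rightarrow> real^'n" and d :: nat
  assumes dim: "d = CARD('n)" and inj: "inj_on v {..d}"
    and indep: "\<not> affine_dependent (v ` {..d})"
begin

lemma d_pos: "1 \<le> d"
  using dim by (simp add: Suc_leI)

lemma node_le: "i \<le> d \<Longrightarrow> node v i = v i"
  by (simp add: node_def dim)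

lemma node_center: "node v (Suc d) = (1 / real (d + 1)) *\<^sub>R (\<Sum>j\<le>d. v j)"
  by (simp add: node_def dim)

text \<open>For \<open>m \<le> d\<close> this is the cell \<open>T\<^sub>m\<close>, and for \<open>m = Suc d\<close> it is \<open>T\<close> itself: any \<open>d + 1\<close> of
  the \<open>d + 2\<close> nodes are affinely independent, so both cases can be treated alike.\<close>

definition opp :: "nat \<Rightarrow> nat set" where "opp m = {..Suc d} - {m}"

lemma finite_opp [simp]: "finite (opp m)"
  by (simp add: opp_def)

lemma cell_eq_opp: "m \<le> d \<Longrightarrow> cell d m = opp m"
  by (auto simp: cell_def opp_def)

lemma vertices_eq_opp: "{..d} = opp (Suc d)"
  by (auto simp: opp_def)

lemma card_opp: "m \<le> Suc d \<Longrightarrow> card (opp m) = Suc d"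
  by (simp add: opp_def)

lemma opp_nonempty: "opp m \<noteq> {}"
proof -
  have "(if m = 0 then 1 else 0) \<in> opp m" by (auto simp: opp_def)
  then show ?thesis by blast
qed

lemma vertices_affine_indep:
  assumes "(\<Sum>i\<le>d. a i *\<^sub>R v i) = 0" and "(\<Sum>i\<le>d. a i) = 0" and "i \<le> d"
  shows "a i = 0"
proof (rule ccontr)
  assume "a i \<noteq> 0"
  define U where "U = a \<circ> inv_into {..d} v"
  have U: "j \<le> d \<Longrightarrow> U (v j) = a j" for j by (simp add: U_def inj inv_into_f_f)
  have "sum U (v ` {..d}) = 0" "(\<Sum>x\<in>v ` {..d}. U x *\<^sub>R x) = 0"
    using assms(1,2) by (simp_all add: sum.reindex[OF inj] U)
  moreover have "\<exists>x\<in>v ` {..d}. U x \<noteq> 0" using \<open>a i \<noteq> 0\<close> U assms(3) by auto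
  ultimately have "affine_dependent (v ` {..d})"
    by (subst affine_dependent_explicit_finite) auto
  then show False using indep by blast
qed

text \<open>Spread the coefficient of the barycenter equally over the vertices. Affine independence
  of the vertices then gives \<open>a j = - c\<close> for each of them, and the omitted node forces
  \<open>c = 0\<close>: through \<open>a m = 0\<close> if it is a vertex, through the definition of
  \<open>c\<close> if it is the barycenter.\<close>

lemma nodes_affine_indep:
  assumes "(\<Sum>i\<le>Suc d. a i *\<^sub>R node v i) = 0" and "(\<Sum>i\<le>Suc d. a i) = 0"
    and m: "m \<le> Suc d" "a m = 0" and "i \<le> Suc d"
  shows "a i = 0"
proof -
  define c where "c = a (Suc d) / real (d + 1)"
  have "(\<Sum>i\<le>d. (a i + c) *\<^sub>R v i) = (\<Sum>i\<le>Suc d. a i *\<^sub>R node v i)"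
    by (simp add: node_le node_center scaleR_left_distrib sum.distrib c_def scaleR_sum_right)
  moreover have "(\<Sum>i\<le>d. (a i + c)) = (\<Sum>i\<le>Suc d. a i)"
  proof -
    have "(\<Sum>i\<le>d. (a i + c)) = (\<Sum>i\<le>d. a i) + real (d + 1) * c" by (simp add: sum.distrib)
    also have "real (d + 1) * c = a (Suc d)" unfolding c_def by simp
    finally show ?thesis by simp
  qed
  ultimately have ac: "a j = - c" if "j \<le> d" for j
    using vertices_affine_indep[of "\<lambda>i. a i + c" j] that assms(1,2) by simp
  have "c = 0" using ac[of m] m by (cases "m = Suc d") (auto simp: c_def)
  then show ?thesis using ac[of i] assms(5) by (cases "i = Suc d") (auto simp: c_def)
qed

lemma node_inj: "inj_on (node v) {..Suc d}"
proof (rule inj_onI, rule ccontr)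
  fix i j assume ij: "i \<in> {..Suc d}" "j \<in> {..Suc d}" "node v i = node v j" "i \<noteq> j"
  \<comment> \<open>There are \<open>d + 2\<close> nodes, so a third one exists; it plays the
    omitted node in the relation between the two equal ones.\<close>
  have "card ({..Suc d} - {i, j}) = d" using ij by (simp add: card_Diff_subset)
  then have "{..Suc d} - {i, j} \<noteq> {}" using d_pos by (intro notI) simp
  then obtain m where m: "m \<in> {..Suc d} - {i, j}" by blast
  define a :: "nat \<Rightarrow> real" where "a l = (if l = i then 1 else 0) - (if l = j then 1 else 0)" for l
  have "a i = 0"
  proof (rule nodes_affine_indep[where m = m])
    show "(\<Sum>i\<le>Suc d. a i *\<^sub>R node v i) = 0"
      using ij by (simp only: a_def scaleR_left_diff_distrib sum_subtractf if_distrib[of "\<lambda>t. t *\<^sub>R _"])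
        (simp del: sum.atMost_Suc cong: if_cong)
    show "(\<Sum>i\<le>Suc d. a i) = 0"
      using ij by (simp add: a_def sum_subtractf del: sum.atMost_Suc)
  qed (use m ij in \<open>auto simp: a_def\<close>)
  then show False using ij by (simp add: a_def)
qed

lemma edges_independent:
  assumes m: "m \<le> Suc d" and f: "f \<subseteq> opp m" "z \<in> f"
  shows "independent ((\<lambda>i. node v i - node v z) ` (f - {z}))"
    and "inj_on (\<lambda>i. node v i - node v z) f"
proof -
  show inj': "inj_on (\<lambda>i. node v i - node v z) f"
    using node_inj f by (auto simp: inj_on_def opp_def subset_eq)
  have fin: "finite f" using f finite_opp finite_subset by blast
  show "independent ((\<lambda>i. node v i - node v z) ` (f - {z}))" (is "independent (?e ` _)")
  proof (rule independent_if_scalars_zero)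
    fix F x assume F: "(\<Sum>x\<in>?e ` (f - {z}). F x *\<^sub>R x) = 0" and x: "x \<in> ?e ` (f - {z})"
    then obtain i where i: "i \<in> f - {z}" "x = ?e i" by blast
    \<comment> \<open>A linear relation between edges is an affine relation between nodes in which
      \<open>z\<close> receives minus the sum of all coefficients.\<close>
    define a where "a l = (if l \<in> f - {z} then F (?e l) else 0) -
      (if l = z then \<Sum>l\<in>f - {z}. F (?e l) else 0)" for l
    have zf: "z \<le> Suc d" "f - {z} \<subseteq> {..Suc d}" using f by (auto simp: opp_def)
    have s: "(\<Sum>l\<le>Suc d. if l \<in> f - {z} then g l else 0) = (\<Sum>l\<in>f - {z}. g l)" for g :: "nat \<Rightarrow> 'x::comm_monoid_add"
      using zf(2) by (subst sum.inter_restrict[symmetric]) (simp_all add: Int_absorb1 del: sum.atMost_Suc)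
    have "a i = 0"
    proof (rule nodes_affine_indep)
      have "(\<Sum>i\<le>Suc d. a i *\<^sub>R node v i) = (\<Sum>l\<in>f - {z}. F (?e l) *\<^sub>R node v l) -
          (\<Sum>l\<in>f - {z}. F (?e l)) *\<^sub>R node v z"
        using zf(1) by (simp only: a_def scaleR_left_diff_distrib sum_subtractf
            if_distrib[of "\<lambda>t. t *\<^sub>R _"] scaleR_zero_left s sum.delta finite_atMost atMost_iff if_True)
      also have "\<dots> = (\<Sum>x\<in>?e ` (f - {z}). F x *\<^sub>R x)"
        by (subst sum.reindex[OF inj_on_subset[OF inj']])
          (auto simp: scaleR_sum_left sum_subtractf algebra_simps)
      finally show "(\<Sum>i\<le>Suc d. a i *\<^sub>R node v i) = 0" using F by simp
      show "(\<Sum>i\<le>Suc d. a i) = 0"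
        using zf(1) by (simp only: a_def sum_subtractf s sum.delta finite_atMost atMost_iff if_True)
      show "a m = 0" using f by (auto simp: a_def opp_def)
    qed (use m i zf in auto)
    then show "F x = 0" using i by (simp add: a_def)
  qed (use fin in auto)
qed

lemma tangent_eq_span_edges:
  assumes "z \<in> f"
  shows "tangent v f = span ((\<lambda>i. node v i - node v z) ` (f - {z}))" (is "_ = span ?E")
proof
  show "span ?E \<subseteq> tangent v f"
    by (rule span_minimal) (use assms diff_node_in_tangent subspace_tangent in auto)
  have E: "node v i - node v z \<in> span ?E" if "i \<in> f" for i
    by (cases "i = z") (use that in \<open>auto intro: span_base span_zero\<close>)
  have "node v j - node v i \<in> span ?E" if "i \<in> f" "j \<in> f" for i j
    using span_diff[OF E[OF that(2)] E[OF that(1)]] by simp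
  then show "tangent v f \<subseteq> span ?E"
    unfolding tangent_def by (intro span_minimal) auto
qed

lemma dim_tangent:
  assumes "m \<le> Suc d" and "f \<subseteq> opp m" "f \<noteq> {}"
  shows "Real_Vector_Spaces.dim (tangent v f) = card f - 1"
proof -
  obtain z where z: "z \<in> f" using assms by blast
  have "finite f" using assms finite_opp finite_subset by blast
  then have "card ((\<lambda>i. node v i - node v z) ` (f - {z})) = card f - 1"
    using card_image[OF inj_on_subset[OF edges_independent(2)[OF assms(1,2) z]], of "f - {z}"] z by simp
  then show ?thesis
    using tangent_eq_span_edges[OF z] dim_span_eq_card_independent[OF edges_independent(1)[OF assms(1,2) z]] by simp
qed

lemma tangent_opp: "m \<le> Suc d \<Longrightarrow> tangent v (opp m) = UNIV"
proof -
  assume m: "m \<le> Suc d"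
  have "Real_Vector_Spaces.dim (tangent v (opp m)) = DIM(real^'n)"
    using dim_tangent[OF m order_refl opp_nonempty] card_opp[OF m] dim by simp
  then show ?thesis
    using dim_eq_full[of "tangent v (opp m)"] span_eq_iff[of "tangent v (opp m)"] subspace_tangent by blast
qed

text \<open>The edges from one node of a nondegenerate simplex span the space; this is the test by
  which vectors are shown to vanish.\<close>

lemma eq_zero_if_orth_edges:
  assumes "m \<le> Suc d" "z \<in> opp m" "\<And>i. i \<in> opp m \<Longrightarrow> u \<bullet> (node v i - node v z) = 0"
  shows "u = 0"
proof -
  have "u \<in> normal_vectors v (opp m)" using normal_vectors_iff[OF assms(2)] assms(3) by blast
  then show ?thesis
    using normal_vectors_orth[of u v "opp m" u] tangent_opp[OF assms(1)] by simp
qed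

text \<open>The gradient solves the Gram system against the \<open>d\<close> independent edges from
  one node; the constant adjusts the value at that node.\<close>

lemma affine_interp:
  assumes m: "m \<le> Suc d"
  shows "\<exists>g b. \<forall>i\<in>opp m. g \<bullet> node v i + b = y i"
proof -
  obtain z where z: "z \<in> opp m" using opp_nonempty by blast
  let ?e = "\<lambda>i. node v i - node v z"
  let ?h = "\<lambda>i. y i - y z"
  have "inj_on ?e (opp m)" using edges_independent(2)[OF m order_refl z] .
  then have inv: "inv_into (opp m) ?e (?e i) = i" if "i \<in> opp m" for i using that by (rule inv_into_f_f)
  have "\<exists>g\<in>span (?e ` (opp m - {z})). \<forall>q\<in>?e ` (opp m - {z}). g \<bullet> q = ?h (inv_into (opp m) ?e q)"
    by (rule gram_solve_exists[where B = inner, OF _ _ inner_add_left inner_scaleR_left inner_commute])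
      (use edges_independent(1)[OF m order_refl z] in auto)
  then obtain g where g: "\<forall>q\<in>?e ` (opp m - {z}). g \<bullet> q = ?h (inv_into (opp m) ?e q)" by blast
  have "g \<bullet> ?e i = ?h i" if "i \<in> opp m" for i
    using g inv[OF that] that by (cases "i = z") auto
  then show ?thesis
    by (intro exI[of _ g] exI[of _ "y z - g \<bullet> node v z"]) (auto simp: inner_diff_right algebra_simps)
qed

lemma affine_comb_eq:
  fixes g :: "real^'n"
  assumes "sum a f = (1::real)"
  shows "g \<bullet> (\<Sum>i\<in>f. a i *\<^sub>R node v i) + b = (\<Sum>i\<in>f. a i * (g \<bullet> node v i + b))"
  using assms by (simp add: inner_sum_right sum.distrib algebra_simps flip: sum_distrib_right sum_distrib_left)

text \<open>Barycentric coordinate of node \<open>i\<close> in the simplex on \<open>opp m\<close>.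
  Since gradient and constant are chosen, it is an affine function on the whole space and not only
  on the simplex.\<close>

definition bary :: "nat \<Rightarrow> nat \<Rightarrow> real^'n \<Rightarrow> real"
  where "bary m i = (let (g, b) = (SOME (g, b). \<forall>j\<in>opp m. g \<bullet> node v j + b = (if j = i then 1 else 0))
    in (\<lambda>x. g \<bullet> x + b))"

lemma bary_affine:
  assumes "m \<le> Suc d"
  obtains g b where "bary m i = (\<lambda>x. g \<bullet> x + b)"
    "\<And>j. j \<in> opp m \<Longrightarrow> g \<bullet> node v j + b = (if j = i then 1 else 0)"
proof -
  obtain g b where gb: "(SOME (g, b). \<forall>j\<in>opp m. g \<bullet> node v j + b = (if j = i then 1 else 0)) = (g, b)"
    by (meson surj_pair)
  have "\<exists>p. case p of (g, b) \<Rightarrow> \<forall>j\<in>opp m. g \<bullet> node v j + b = (if j = i then 1 else 0)"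
    using affine_interp[OF assms, of "\<lambda>j. if j = i then 1 else 0"] by auto
  from someI_ex[OF this] have "\<forall>j\<in>opp m. g \<bullet> node v j + b = (if j = i then 1 else 0)"
    unfolding gb by simp
  moreover have "bary m i = (\<lambda>x. g \<bullet> x + b)" unfolding bary_def gb by simp
  ultimately show ?thesis using that by blast
qed

lemma bary_comb:
  assumes "m \<le> Suc d" "sum a (opp m) = 1" "x = (\<Sum>i\<in>opp m. a i *\<^sub>R node v i)" "j \<in> opp m"
  shows "bary m j x = a j"
proof -
  obtain g b where gb: "bary m j = (\<lambda>x. g \<bullet> x + b)"
    "\<And>i. i \<in> opp m \<Longrightarrow> g \<bullet> node v i + b = (if i = j then 1 else 0)"
    using bary_affine[OF assms(1)] by blast
  have "bary m j x = (\<Sum>i\<in>opp m. a i * (g \<bullet> node v i + b))"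
    unfolding gb(1) assms(3) by (rule affine_comb_eq[OF assms(2)])
  also have "\<dots> = (\<Sum>i\<in>opp m. if i = j then a i else 0)"
    by (rule sum.cong) (auto simp: gb(2))
  finally show ?thesis using assms(4) by simp
qed

lemma bary_repr:
  assumes m: "m \<le> Suc d"
  shows "(\<Sum>i\<in>opp m. bary m i x) = 1" and "(\<Sum>i\<in>opp m. bary m i x *\<^sub>R node v i) = x"
proof -
  obtain z where z: "z \<in> opp m" using opp_nonempty by blast
  have "x - node v z \<in> tangent v (opp m)" using tangent_opp[OF m] by simp
  then obtain a where a: "sum a (opp m) = 0" "x - node v z = (\<Sum>i\<in>opp m. a i *\<^sub>R node v i)"
    using tangent_comb[OF finite_opp] by blast
  let ?a = "\<lambda>i. a i + (if i = z then 1 else 0)"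
  have s: "sum ?a (opp m) = 1" using a z by (simp add: sum.distrib)
  have x: "x = (\<Sum>i\<in>opp m. ?a i *\<^sub>R node v i)"
  proof -
    have "(\<Sum>i\<in>opp m. ?a i *\<^sub>R node v i) = (\<Sum>i\<in>opp m. a i *\<^sub>R node v i) + node v z"
      using z by (simp add: scaleR_left_distrib sum.distrib if_distrib[of "\<lambda>t. t *\<^sub>R _"] cong: if_cong)
    then show ?thesis by (simp flip: a(2))
  qed
  have "bary m j x = ?a j" if "j \<in> opp m" for j using bary_comb[OF m s x that] .
  then show "(\<Sum>i\<in>opp m. bary m i x) = 1" "(\<Sum>i\<in>opp m. bary m i x *\<^sub>R node v i) = x"
    using s x by (auto cong: sum.cong)
qed

lemma simplex_opp_iff:
  assumes m: "m \<le> Suc d"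
  shows "x \<in> simplex_of v (opp m) \<longleftrightarrow> (\<forall>i\<in>opp m. 0 \<le> bary m i x)"
proof
  assume "x \<in> simplex_of v (opp m)"
  then obtain a where "\<forall>i\<in>opp m. 0 \<le> a i" "sum a (opp m) = 1" "x = (\<Sum>i\<in>opp m. a i *\<^sub>R node v i)"
    using simplex_of_iff[OF finite_opp] by blast
  then show "\<forall>i\<in>opp m. 0 \<le> bary m i x" using bary_comb[OF m] by auto
next
  assume "\<forall>i\<in>opp m. 0 \<le> bary m i x"
  then show "x \<in> simplex_of v (opp m)"
    using bary_repr[OF m, of x] simplex_of_iff[OF finite_opp] by metis
qed

end

section \<open>The piecewise linear hat functions\<close>

lemma continuous_on_Min_image:
  fixes g :: "'i \<Rightarrow> 'a::topological_space \<Rightarrow> real"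
  assumes "finite A" "A \<noteq> {}" "\<And>i. i \<in> A \<Longrightarrow> continuous_on S (g i)"
  shows "continuous_on S (\<lambda>x. Min ((\<lambda>i. g i x) ` A))"
  using assms
proof (induction A rule: finite_ne_induct)
  case (insert i A)
  then have "continuous_on S (\<lambda>x. min (g i x) (Min ((\<lambda>i. g i x) ` A)))"
    by (intro continuous_on_min) auto
  then show ?case using insert.hyps by simp
qed simp

context simplex_split
begin

text \<open>Barycentric coordinates of a point of the cell T_m, padded by zeros to all
  \<open>d + 2\<close> nodes. On a common face of two cells the same \<open>a\<close> serves for
  both.\<close>

definition coords :: "nat \<Rightarrow> (nat \<Rightarrow> real) \<Rightarrow> real^'n \<Rightarrow> bool" where
  "coords m a x \<longleftrightarrow> m \<le> d \<and> a m = 0 \<and> (\<forall>i\<le>Suc d. 0 \<le> a i) \<and> (\<Sum>i\<le>Suc d. a i) = 1 \<and>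
     x = (\<Sum>i\<le>Suc d. a i *\<^sub>R node v i)"

lemma sum_supported:
  fixes g :: "nat \<Rightarrow> 'b::comm_monoid_add"
  assumes "f \<subseteq> {..Suc d}" "\<And>i. i \<le> Suc d \<Longrightarrow> i \<notin> f \<Longrightarrow> g i = 0"
  shows "(\<Sum>i\<le>Suc d. g i) = (\<Sum>i\<in>f. g i)"
  by (rule sum.mono_neutral_right) (use assms in auto)

lemma coords_of_face:
  assumes "m \<le> d" "f \<subseteq> opp m" "\<forall>i\<in>f. 0 \<le> a i" "sum a f = 1" "x = (\<Sum>i\<in>f. a i *\<^sub>R node v i)"
  shows "coords m (\<lambda>i. if i \<in> f then a i else 0) x"
proof -
  let ?a = "\<lambda>i. if i \<in> f then a i else 0"
  have f: "f \<subseteq> {..Suc d}" using assms(2) by (auto simp: opp_def)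
  have "(\<Sum>i\<le>Suc d. ?a i) = (\<Sum>i\<in>f. ?a i)" by (rule sum_supported[OF f]) auto
  moreover have "(\<Sum>i\<le>Suc d. ?a i *\<^sub>R node v i) = (\<Sum>i\<in>f. ?a i *\<^sub>R node v i)"
    by (rule sum_supported[OF f]) auto
  ultimately show ?thesis using assms by (auto simp: coords_def opp_def simp del: sum.atMost_Suc)
qed

lemma coords_opp:
  assumes "coords m a x"
  shows "sum a (opp m) = 1" "x = (\<Sum>i\<in>opp m. a i *\<^sub>R node v i)"
proof -
  have "i \<notin> opp m \<Longrightarrow> i \<le> Suc d \<Longrightarrow> a i = 0" for i using assms by (auto simp: coords_def opp_def)
  then show "sum a (opp m) = 1" "x = (\<Sum>i\<in>opp m. a i *\<^sub>R node v i)"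
    using assms sum_supported[of "opp m" a] sum_supported[of "opp m" "\<lambda>i. a i *\<^sub>R node v i"]
    by (auto simp: coords_def opp_def simp del: sum.atMost_Suc)
qed

lemma simplex_cell_iff: "m \<le> d \<Longrightarrow> x \<in> simplex_of v (cell d m) \<longleftrightarrow> (\<exists>a. coords m a x)"
proof
  assume m: "m \<le> d" "x \<in> simplex_of v (cell d m)"
  then obtain a where "\<forall>i\<in>opp m. 0 \<le> a i" "sum a (opp m) = 1" "x = (\<Sum>i\<in>opp m. a i *\<^sub>R node v i)"
    using simplex_of_iff[OF finite_opp, of x v m] cell_eq_opp[OF m(1)] by auto
  then show "\<exists>a. coords m a x" using coords_of_face[OF m(1) order_refl] by blast
next
  assume m: "m \<le> d" "\<exists>a. coords m a x"
  then obtain a where a: "coords m a x" by blast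
  have "\<forall>i\<in>opp m. 0 \<le> a i" using a by (auto simp: coords_def opp_def)
  then show "x \<in> simplex_of v (cell d m)"
    using coords_opp[OF a] simplex_of_iff[OF finite_opp, of x v m] unfolding cell_eq_opp[OF m(1)] by blast
qed

text \<open>The barycenter is the mean of the vertices, so its weight is shared equally among
  them.\<close>

lemma bary_of_coords:
  assumes "coords m a x" "j \<le> d"
  shows "bary (Suc d) j x = a j + a (Suc d) / real (d + 1)"
proof -
  let ?c = "a (Suc d) / real (d + 1)"
  have "(\<Sum>i\<in>opp (Suc d). (a i + ?c) *\<^sub>R node v i) = (\<Sum>i\<le>d. (a i + ?c) *\<^sub>R v i)"
    by (simp add: vertices_eq_opp[symmetric] node_le)
  also have "\<dots> = (\<Sum>i\<le>Suc d. a i *\<^sub>R node v i)"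
    by (simp add: node_le node_center scaleR_left_distrib sum.distrib scaleR_sum_right)
  finally have x: "x = (\<Sum>i\<in>opp (Suc d). (a i + ?c) *\<^sub>R node v i)" using assms(1) by (simp add: coords_def)
  have "(\<Sum>i\<in>opp (Suc d). a i + ?c) = (\<Sum>i\<le>d. a i) + real (d + 1) * ?c"
    by (simp add: vertices_eq_opp[symmetric] sum.distrib)
  also have "real (d + 1) * ?c = a (Suc d)" by simp
  finally have "(\<Sum>i\<in>opp (Suc d). a i + ?c) = 1" using assms(1) by (simp add: coords_def)
  from bary_comb[OF _ this x] show ?thesis using assms(2) by (simp add: opp_def)
qed

text \<open>A point of \<open>T\<close> lies in the cell \<open>T\<^sub>m\<close> if its \<open>m\<close>-th barycentric coordinate is the smallest one.
  The coordinate of the barycenter on \<open>T\<^sub>m\<close> is then \<open>d + 1\<close> times this minimum.\<close>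

definition low :: "real^'n \<Rightarrow> real" where
  "low x = Min ((\<lambda>j. bary (Suc d) j x) ` {..d})"

definition hat_candidate :: "nat \<Rightarrow> real^'n \<Rightarrow> real" where
  "hat_candidate i x = (if x \<in> simplex_of v {..d}
     then (if i = Suc d then real (d + 1) * low x else bary (Suc d) i x - low x) else 0)"

lemma in_T_of_coords:
  assumes "coords m a x"
  shows "x \<in> simplex_of v {..d}"
  unfolding vertices_eq_opp simplex_opp_iff[OF order_refl]
  using bary_of_coords[OF assms] assms by (auto simp: coords_def opp_def)

text \<open>On T_m the coefficient \<open>a m\<close> is zero, so the minimum over the vertices is
  attained at \<open>m\<close> and equals the share that comes from the barycenter.\<close>

lemma hat_candidate_coords:
  assumes "coords m a x" "i \<le> Suc d"
  shows "hat_candidate i x = a i"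
proof -
  have "low x = a (Suc d) / real (d + 1)"
    unfolding low_def
  proof (rule Min_eqI)
    show "a (Suc d) / real (d + 1) \<in> (\<lambda>j. bary (Suc d) j x) ` {..d}"
      using bary_of_coords[OF assms(1), of m] assms(1) by (auto simp: coords_def intro!: image_eqI[of _ _ m])
    show "a (Suc d) / real (d + 1) \<le> y" if "y \<in> (\<lambda>j. bary (Suc d) j x) ` {..d}" for y
      using that bary_of_coords[OF assms(1)] assms(1) by (auto simp: coords_def)
  qed simp
  then show ?thesis
    using in_T_of_coords[OF assms(1)] bary_of_coords[OF assms(1), of i] assms(2)
    by (auto simp: hat_candidate_def)
qed

text \<open>The cells cover T: let \<open>m\<close> be a vertex with the smallest coordinate,
  subtract this minimum from all vertex coordinates and give the total to the barycenter.\<close>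

lemma coords_exist:
  assumes "x \<in> simplex_of v {..d}"
  shows "\<exists>m a. coords m a x"
proof -
  have "low x \<in> (\<lambda>j. bary (Suc d) j x) ` {..d}" unfolding low_def by (rule Min_in) auto
  then obtain m where m: "m \<le> d" "low x = bary (Suc d) m x" by auto
  have low: "low x \<le> bary (Suc d) j x" if "j \<le> d" for j
    unfolding low_def by (rule Min_le) (use that in auto)
  have low0: "0 \<le> low x" unfolding m(2) using assms m(1) simplex_opp_iff[OF order_refl, of x]
    by (auto simp: vertices_eq_opp opp_def)
  define a where "a i = (if i = Suc d then real (d + 1) * low x else bary (Suc d) i x - low x)" for i
  have r: "(\<Sum>i\<le>d. bary (Suc d) i x) = 1" "(\<Sum>i\<le>d. bary (Suc d) i x *\<^sub>R v i) = x"
    using bary_repr[OF order_refl, of x] by (simp_all add: vertices_eq_opp[symmetric] node_le)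
  have "(\<Sum>i\<le>Suc d. a i) = 1" using r(1) by (simp add: a_def sum_subtractf)
  moreover have "(\<Sum>i\<le>Suc d. a i *\<^sub>R node v i) = x"
  proof -
    have "(\<Sum>i\<le>Suc d. a i *\<^sub>R node v i) =
        (\<Sum>i\<le>d. (bary (Suc d) i x - low x) *\<^sub>R v i) + (real (d+1) * low x) *\<^sub>R node v (Suc d)"
      by (simp add: a_def node_le)
    also have "(real (d+1) * low x) *\<^sub>R node v (Suc d) = (\<Sum>i\<le>d. low x *\<^sub>R v i)"
    proof -
      have "real (d+1) * low x * (1 / real (d+1)) = low x" by (simp add: field_simps)
      then show ?thesis by (simp only: node_center scaleR_scaleR scaleR_sum_right)
    qed
    finally show ?thesis using r(2) by (simp add: scaleR_left_diff_distrib sum_subtractf)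
  qed
  ultimately have "coords m a x"
    using m low low0 by (auto simp: coords_def a_def simp del: sum.atMost_Suc)
  then show ?thesis by blast
qed

lemma coords_node:
  assumes "j \<le> Suc d"
  obtains m where "coords m (\<lambda>i. if i = j then 1 else 0) (node v j)"
proof -
  \<comment> \<open>The cell T_0 contains every node but \<open>0\<close>, and node \<open>0\<close>
    lies in T_1.\<close>
  define m :: nat where "m = (if j = 0 then 1 else 0)"
  have "m \<le> d" "j \<in> opp m" using assms d_pos by (auto simp: m_def opp_def)
  then have "coords m (\<lambda>i. if i \<in> {j} then 1 else 0) (node v j)"
    by (intro coords_of_face) auto
  then show ?thesis using that[of m] by simp
qed

text \<open>The description under \<open>THE\<close> in the definition of \<open>hat\<close>, kept
  literally, with \<open>CARD('n)\<close> in place of \<open>d\<close>, so that it can be folded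
  there; \<open>hat_specD\<close> translates it.\<close>

definition hat_spec :: "nat \<Rightarrow> (real^'n \<Rightarrow> real) \<Rightarrow> bool" where
  "hat_spec i g \<longleftrightarrow> continuous_on (simplex_of v {..CARD('n)}) g \<and>
    (\<forall>m\<le>CARD('n). \<exists>a b. \<forall>x \<in> simplex_of v (cell CARD('n) m). g x = a \<bullet> x + b) \<and>
    (\<forall>j\<le>Suc CARD('n). g (node v j) = (if j = i then 1 else 0)) \<and>
    (\<forall>x. x \<notin> simplex_of v {..CARD('n)} \<longrightarrow> g x = 0)"

lemma hat_specD:
  assumes "hat_spec i g"
  shows "continuous_on (simplex_of v {..d}) g"
    and "m \<le> d \<Longrightarrow> \<exists>a b. \<forall>x \<in> simplex_of v (cell d m). g x = a \<bullet> x + b"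
    and "j \<le> Suc d \<Longrightarrow> g (node v j) = (if j = i then 1 else 0)"
    and "x \<notin> simplex_of v {..d} \<Longrightarrow> g x = 0"
  using assms unfolding hat_spec_def dim[symmetric] by simp_all

lemma continuous_on_bary: "m \<le> Suc d \<Longrightarrow> continuous_on S (bary m i)"
  by (rule bary_affine[of m i]) (auto intro!: continuous_intros)

lemma hat_spec_candidate:
  assumes "i \<le> Suc d"
  shows "hat_spec i (hat_candidate i)"
  unfolding hat_spec_def dim[symmetric]
proof (intro conjI allI impI)
  have "continuous_on S low" for S
    unfolding low_def using continuous_on_bary by (intro continuous_on_Min_image) auto
  then have low: "continuous_on S low" for S .
  have "continuous_on S (\<lambda>x. if i = Suc d then real (d + 1) * low x else bary (Suc d) i x - low x)" for S
  proof (cases "i = Suc d")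
    case True
    then show ?thesis using continuous_on_mult_left[OF low, of S "real (d + 1)"] by (simp only: if_True simp_thms)
  next
    case False
    then show ?thesis
      using continuous_on_diff[OF continuous_on_bary[OF order_refl] low, of S i] by (simp only: if_False)
  qed
  then show "continuous_on (simplex_of v {..d}) (hat_candidate i)"
    by (rule continuous_on_eq) (simp add: hat_candidate_def)
next
  fix m assume m: "m \<le> d"
  obtain g b where gb: "\<forall>j\<in>opp m. g \<bullet> node v j + b = (if j = i then 1 else 0)"
    using affine_interp[OF le_SucI[OF m], of "\<lambda>j. if j = i then 1 else 0"] by blast
  have "hat_candidate i x = g \<bullet> x + b" if x: "x \<in> simplex_of v (cell d m)" for x
  proof -
    obtain a where a: "coords m a x" using x unfolding simplex_cell_iff[OF m] by blast
    have "g \<bullet> x + b = (\<Sum>j\<in>opp m. a j * (g \<bullet> node v j + b))"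
      unfolding coords_opp(2)[OF a] by (rule affine_comb_eq[OF coords_opp(1)[OF a]])
    also have "\<dots> = (\<Sum>j\<in>opp m. if j = i then a j else 0)" using gb by (intro sum.cong) auto
    also have "\<dots> = a i" using a assms by (auto simp: coords_def opp_def)
    finally show ?thesis using hat_candidate_coords[OF a assms] by simp
  qed
  then show "\<exists>a b. \<forall>x\<in>simplex_of v (cell d m). hat_candidate i x = a \<bullet> x + b" by blast
next
  fix j assume "j \<le> Suc d"
  then obtain m where "coords m (\<lambda>i. if i = j then 1 else 0) (node v j)" by (rule coords_node)
  from hat_candidate_coords[OF this assms] show "hat_candidate i (node v j) = (if j = i then 1 else 0)"
    by auto
next
  fix x assume "x \<notin> simplex_of v {..d}"
  then show "hat_candidate i x = 0" by (simp add: hat_candidate_def)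
qed

text \<open>An affine function on a cell is determined by its values at the nodes of the cell. This
  yields both the uniqueness of the hat function and its values.\<close>

lemma hat_spec_coords:
  assumes "hat_spec i g" "i \<le> Suc d" "coords m a x"
  shows "g x = a i"
proof -
  have m: "m \<le> d" using assms(3) by (simp add: coords_def)
  obtain h b where hb: "\<forall>x \<in> simplex_of v (cell d m). g x = h \<bullet> x + b"
    using hat_specD(2)[OF assms(1) m] by (elim exE)
  have nd: "h \<bullet> node v j + b = (if j = i then 1 else 0)" if "j \<in> opp m" for j
  proof -
    have "node v j \<in> simplex_of v (cell d m)"
      using that cell_eq_opp[OF m] unfolding simplex_of_def by (auto intro: hull_inc)
    then have "g (node v j) = h \<bullet> node v j + b" using hb by blast
    moreover have "j \<le> Suc d" using that by (auto simp: opp_def)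
    ultimately show ?thesis using hat_specD(3)[OF assms(1)] by simp
  qed
  have "x \<in> simplex_of v (cell d m)" unfolding simplex_cell_iff[OF m] using assms(3) by blast
  then have "g x = h \<bullet> x + b" by (rule hb[rule_format])
  also have "\<dots> = (\<Sum>j\<in>opp m. a j * (h \<bullet> node v j + b))"
    by (subst coords_opp(2)[OF assms(3)]) (rule affine_comb_eq[OF coords_opp(1)[OF assms(3)]])
  also have "\<dots> = (\<Sum>j\<in>opp m. if j = i then a j else 0)" using nd by (intro sum.cong) auto
  also have "\<dots> = a i" using assms(2,3) by (auto simp: coords_def opp_def)
  finally show ?thesis .
qed

lemma hat_spec_hat:
  assumes "i \<le> Suc d"
  shows "hat_spec i (hat v i)"
proof -
  have u: "g = hat_candidate i" if "hat_spec i g" for g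
  proof
    fix x
    show "g x = hat_candidate i x"
    proof (cases "x \<in> simplex_of v {..d}")
      case True
      then obtain m a where "coords m a x" using coords_exist by blast
      then show ?thesis using hat_spec_coords[OF that assms] hat_candidate_coords[OF _ assms] by simp
    next
      case False
      then show ?thesis using hat_specD(4)[OF that False] by (simp add: hat_candidate_def)
    qed
  qed
  have "hat v i = (THE g. hat_spec i g)" unfolding hat_def hat_spec_def ..
  also have "\<dots> = hat_candidate i"
    by (rule the_equality[where P = "hat_spec i", OF hat_spec_candidate[OF assms] u])
  finally show ?thesis using hat_spec_candidate[OF assms] by simp
qed

lemma hat_coords: "coords m a x \<Longrightarrow> i \<le> Suc d \<Longrightarrow> hat v i x = a i"
  by (rule hat_spec_coords[OF hat_spec_hat])

lemma hat_outside: "i \<le> Suc d \<Longrightarrow> x \<notin> simplex_of v {..d} \<Longrightarrow> hat v i x = 0"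
  by (rule hat_specD(4)[OF hat_spec_hat])

lemma continuous_on_hat: "i \<le> Suc d \<Longrightarrow> continuous_on (simplex_of v {..d}) (hat v i)"
  by (rule hat_specD(1)[OF hat_spec_hat])

lemma hat_nonneg: "i \<le> Suc d \<Longrightarrow> 0 \<le> hat v i x"
proof (cases "x \<in> simplex_of v {..d}")
  case True
  assume i: "i \<le> Suc d"
  obtain m a where a: "coords m a x" using coords_exist[OF True] by blast
  then have "0 \<le> a i" using i by (auto simp: coords_def)
  then show ?thesis using hat_coords[OF a i] by simp
qed (simp add: hat_outside)

text \<open>The cells themselves count as faces here, so that interior points of cells are covered
  too. T does not count, as it lies in no cell.\<close>

definition is_face :: "nat set \<Rightarrow> bool" where
  "is_face f \<longleftrightarrow> f \<noteq> {} \<and> (\<exists>m\<le>d. f \<subseteq> opp m)"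

lemma is_face_le: "is_face f \<Longrightarrow> i \<in> f \<Longrightarrow> i \<le> Suc d"
  by (auto simp: is_face_def opp_def)

lemma is_face_finite: "is_face f \<Longrightarrow> finite f"
  using finite_subset[OF _ finite_opp] by (auto simp: is_face_def)

lemma face_point:
  assumes "is_face f" "\<forall>i\<in>f. 0 \<le> a i" "sum a f = 1" "x = (\<Sum>i\<in>f. a i *\<^sub>R node v i)"
  shows "x \<in> simplex_of v f" "i \<le> Suc d \<Longrightarrow> hat v i x = (if i \<in> f then a i else 0)"
proof -
  show "x \<in> simplex_of v f" using assms is_face_finite by (subst simplex_of_iff) auto
  obtain m where m: "m \<le> d" "f \<subseteq> opp m" using assms(1) by (auto simp: is_face_def)
  from hat_coords[OF coords_of_face[OF m assms(2-4)]]
  show "i \<le> Suc d \<Longrightarrow> hat v i x = (if i \<in> f then a i else 0)" by simp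
qed

lemma hat_on_face:
  assumes "is_face f" "x \<in> simplex_of v f"
  shows "i \<le> Suc d \<Longrightarrow> i \<notin> f \<Longrightarrow> hat v i x = 0"
    and "(\<Sum>i\<in>f. hat v i x) = 1" and "(\<Sum>i\<in>f. hat v i x *\<^sub>R node v i) = x"
proof -
  obtain a where a: "\<forall>i\<in>f. 0 \<le> a i" "sum a f = 1" "x = (\<Sum>i\<in>f. a i *\<^sub>R node v i)"
    using assms(2) simplex_of_iff[OF is_face_finite[OF assms(1)]] by blast
  note h = face_point(2)[OF assms(1) a]
  show "i \<le> Suc d \<Longrightarrow> i \<notin> f \<Longrightarrow> hat v i x = 0" using h by simp
  have "hat v i x = a i" if "i \<in> f" for i using h[of i] is_face_le[OF assms(1) that] that by simp
  then show "(\<Sum>i\<in>f. hat v i x) = 1" "(\<Sum>i\<in>f. hat v i x *\<^sub>R node v i) = x"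
    using a by (auto cong: sum.cong)
qed

lemma simplex_cell_subset_T: "m \<le> d \<Longrightarrow> simplex_of v (cell d m) \<subseteq> simplex_of v {..d}"
  using in_T_of_coords by (auto simp: simplex_cell_iff)

lemma simplex_subset_cell: "m \<le> d \<Longrightarrow> f \<subseteq> opp m \<Longrightarrow> simplex_of v f \<subseteq> simplex_of v (cell d m)"
  by (simp add: simplex_of_mono cell_eq_opp)

lemma simplex_subset_T:
  assumes "is_face f"
  shows "simplex_of v f \<subseteq> simplex_of v {..d}"
proof -
  obtain m where m: "m \<le> d" "f \<subseteq> opp m" using assms by (auto simp: is_face_def)
  show ?thesis by (rule subset_trans[OF simplex_subset_cell[OF m] simplex_cell_subset_T[OF m(1)]])
qed

lemma hat_affine_on_face:
  assumes "is_face f" "i \<le> Suc d"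
  shows "\<exists>g b. \<forall>x\<in>simplex_of v f. hat v i x = g \<bullet> x + b"
proof -
  obtain m where m: "m \<le> d" "f \<subseteq> opp m" using assms by (auto simp: is_face_def)
  then have "\<exists>g b. \<forall>x\<in>simplex_of v (cell d m). hat v i x = g \<bullet> x + b"
    by (intro hat_specD(2)[OF hat_spec_hat[OF assms(2)]])
  moreover have "simplex_of v f \<subseteq> simplex_of v (cell d m)"
    using simplex_subset_cell[OF m] .
  ultimately show ?thesis by blast
qed

end

section \<open>Polynomials on faces\<close>

lemma sum_fun_eval: "(\<Sum>a\<in>A. g a) x = (\<Sum>a\<in>A. g a x)"
  by (induction A rule: infinite_finite_induct) auto

lemma scaleR_fun_eval [simp]: "(c *\<^sub>R g) x = c *\<^sub>R g x"
  by (simp add: scaleR_fun_def)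

lemma span_mult_closed:
  fixes A B C :: "('a \<Rightarrow> real) set"
  assumes "p \<in> span A" and "q \<in> span B"
    and mult: "\<And>a b. a \<in> A \<Longrightarrow> b \<in> B \<Longrightarrow> (\<lambda>x. a x * b x) \<in> span C"
  shows "(\<lambda>x. p x * q x) \<in> span C"
proof -
  have *: "(\<lambda>x. a x * q x) \<in> span C" if "a \<in> A" for a
    using assms(2)
  proof (induction rule: span_induct_alt)
    case base
    have "(\<lambda>x. a x * 0 x) = 0" by (simp add: fun_eq_iff)
    then show ?case using span_zero by metis
  next
    case (step c x y)
    have "(\<lambda>u. a u * (c *\<^sub>R x + y) u) = c *\<^sub>R (\<lambda>u. a u * x u) + (\<lambda>u. a u * y u)"
      by (simp add: fun_eq_iff algebra_simps)
    then show ?case using step mult[OF that] by (metis span_add span_scale)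
  qed
  show ?thesis
    using assms(1)
  proof (induction rule: span_induct_alt)
    case base
    have "(\<lambda>x. 0 x * q x) = 0" by (simp add: fun_eq_iff)
    then show ?case using span_zero by metis
  next
    case (step c x y)
    have "(\<lambda>u. (c *\<^sub>R x + y) u * q u) = c *\<^sub>R (\<lambda>u. x u * q u) + (\<lambda>u. y u * q u)"
      by (simp add: fun_eq_iff algebra_simps)
    then show ?case using step * by (metis span_add span_scale)
  qed
qed

lemma subspace_polys: "subspace (polys r)"
  by (simp add: polys_def)

lemma polys_mono: "r \<le> s \<Longrightarrow> polys r \<subseteq> polys s"
  unfolding polys_def by (rule span_mono) auto

lemma polys_mult:
  fixes p q :: "real^'n \<Rightarrow> real"
  assumes "p \<in> polys r" "q \<in> polys s"
  shows "(\<lambda>x. p x * q x) \<in> polys (r + s)"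
  using assms unfolding polys_def
proof (rule span_mult_closed)
  fix a b :: "real^'n \<Rightarrow> real"
  assume "a \<in> {(\<lambda>x. \<Prod>i\<in>UNIV. x $ i ^ \<alpha> i) | \<alpha>. int (\<Sum>i\<in>UNIV. \<alpha> i) \<le> r}"
    "b \<in> {(\<lambda>x. \<Prod>i\<in>UNIV. x $ i ^ \<alpha> i) | \<alpha>. int (\<Sum>i\<in>UNIV. \<alpha> i) \<le> s}"
  then obtain \<alpha> \<beta> where \<alpha>: "a = (\<lambda>x. \<Prod>i\<in>UNIV. x $ i ^ \<alpha> i)" "int (\<Sum>i\<in>UNIV. \<alpha> i) \<le> r"
    and \<beta>: "b = (\<lambda>x. \<Prod>i\<in>UNIV. x $ i ^ \<beta> i)" "int (\<Sum>i\<in>UNIV. \<beta> i) \<le> s"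
    by blast
  have "(\<lambda>x. a x * b x) = (\<lambda>x. \<Prod>i\<in>UNIV. x $ i ^ (\<alpha> i + \<beta> i))"
    by (simp add: \<alpha> \<beta> power_add prod.distrib)
  moreover have "int (\<Sum>i\<in>UNIV. \<alpha> i + \<beta> i) \<le> r + s" using \<alpha>(2) \<beta>(2) by (simp add: sum.distrib)
  ultimately show "(\<lambda>x. a x * b x) \<in> span {(\<lambda>x. \<Prod>i\<in>UNIV. x $ i ^ \<alpha> i) | \<alpha>. int (\<Sum>i\<in>UNIV. \<alpha> i) \<le> r + s}"
    by (intro span_base CollectI exI[of _ "\<lambda>i. \<alpha> i + \<beta> i"] conjI)
qed

lemma polys_const: "(\<lambda>x. c) \<in> polys 0"
proof -
  have "(\<lambda>x. 1) \<in> (polys 0 :: (real^'n \<Rightarrow> real) set)"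
    unfolding polys_def by (rule span_base, rule CollectI, rule exI[of _ "\<lambda>_. 0"]) simp
  from subspace_scale[OF subspace_polys this, of c] show ?thesis by (simp add: scaleR_fun_def)
qed

lemma polys_coordinate:
  fixes j :: "'n::finite"
  shows "(\<lambda>x :: real^'n. x $ j) \<in> polys 1"
  unfolding polys_def
proof (rule span_base, rule CollectI, rule exI[of _ "\<lambda>i. if i = j then 1 else 0"])
  have "(\<Prod>i\<in>UNIV. x $ i ^ (if i = j then 1 else 0)) = x $ j" for x :: "real^'n"
    by (simp add: if_distrib[of "\<lambda>t. _ ^ t"] cong: if_cong)
  then show "(\<lambda>x :: real^'n. x $ j) = (\<lambda>x. \<Prod>i\<in>UNIV. x $ i ^ (if i = j then 1 else 0)) \<and>
    int (\<Sum>i\<in>UNIV. if i = j then 1 else 0) \<le> 1"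
    by simp
qed

lemma polys_sum: "(\<And>i. i \<in> A \<Longrightarrow> g i \<in> polys r) \<Longrightarrow> (\<lambda>x. \<Sum>i\<in>A. g i x) \<in> polys r"
  using subspace_sum[OF subspace_polys, of A g] by (simp add: sum_fun_eval[abs_def] fun_eq_iff[symmetric])

lemma polys_add: "p \<in> polys r \<Longrightarrow> q \<in> polys r \<Longrightarrow> (\<lambda>x. p x + q x) \<in> polys r"
  using subspace_add[OF subspace_polys] by (simp add: plus_fun_def)

lemma polys_affine: "(\<lambda>x. g \<bullet> x + b) \<in> polys 1"
proof -
  have "(\<lambda>x. g $ i * x $ i) \<in> polys 1" for i
    using subspace_scale[OF subspace_polys polys_coordinate[of i], of "g $ i"] by (simp add: scaleR_fun_def)
  then show ?thesis
    using polys_mono[of 0 1] polys_const[of b]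
    by (auto simp: inner_vec_def intro!: polys_add polys_sum)
qed

lemma polys_power: "p \<in> polys 1 \<Longrightarrow> (\<lambda>x. p x ^ n) \<in> polys (int n)"
proof (induction n)
  case (Suc n)
  then show ?case using polys_mult[of p 1 "\<lambda>x. p x ^ n" "int n"] by simp
qed (simp add: polys_const)

lemma polys_prod:
  assumes "finite f" "\<And>i. i \<in> f \<Longrightarrow> g i \<in> polys 1"
  shows "(\<lambda>x. \<Prod>i\<in>f. g i x ^ \<alpha> i) \<in> polys (int (\<Sum>i\<in>f. \<alpha> i))"
  using assms
proof (induction f)
  case (insert i f)
  then show ?case
    using polys_mult[OF polys_power[of "g i" "\<alpha> i"], of "\<lambda>x. \<Prod>i\<in>f. g i x ^ \<alpha> i"] by simp
qed (simp add: polys_const)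

lemma continuous_on_polys: "p \<in> polys r \<Longrightarrow> continuous_on S p"
  unfolding polys_def
proof (induction rule: span_induct_alt)
  case base
  show ?case by (simp add: zero_fun_def)
next
  case (step c x y)
  then show ?case
    by (auto simp: plus_fun_def scaleR_fun_def intro!: continuous_intros)
qed

definition monomials :: "int \<Rightarrow> (real^'n \<Rightarrow> real) set"
  where "monomials r = {(\<lambda>x. \<Prod>i\<in>UNIV. x $ i ^ \<alpha> i) | \<alpha>. int (\<Sum>i\<in>UNIV. \<alpha> i) \<le> r}"

lemma finite_monomials: "finite (monomials r :: (real^'n \<Rightarrow> real) set)"
proof -
  have "{\<alpha> :: 'n \<Rightarrow> nat. int (\<Sum>i\<in>UNIV. \<alpha> i) \<le> r} \<subseteq> PiE UNIV (\<lambda>_. {..nat r})"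
  proof
    fix \<alpha> :: "'n \<Rightarrow> nat" assume "\<alpha> \<in> {\<alpha>. int (\<Sum>i\<in>UNIV. \<alpha> i) \<le> r}"
    then have "int (\<Sum>i\<in>UNIV. \<alpha> i) \<le> r" by blast
    from nat_mono[OF this, unfolded nat_int] have "(\<Sum>i\<in>UNIV. \<alpha> i) \<le> nat r" .
    moreover have "\<alpha> i \<le> (\<Sum>i\<in>UNIV. \<alpha> i)" for i by (rule member_le_sum) auto
    ultimately have "\<alpha> i \<le> nat r" for i by (rule order_trans[rotated])
    then show "\<alpha> \<in> PiE UNIV (\<lambda>_. {..nat r})" by auto
  qed
  then have "finite {\<alpha> :: 'n \<Rightarrow> nat. int (\<Sum>i\<in>UNIV. \<alpha> i) \<le> r}"
    by (rule finite_subset) (simp add: finite_PiE)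
  moreover have "monomials r = (\<lambda>\<alpha> x. \<Prod>i\<in>UNIV. x $ i ^ \<alpha> i) ` {\<alpha> :: 'n \<Rightarrow> nat. int (\<Sum>i\<in>UNIV. \<alpha> i) \<le> r}"
    by (auto simp: monomials_def)
  ultimately show ?thesis by simp
qed

lemma linear_restrict_zero: "linear (restrict_zero S :: ('a \<Rightarrow> 'b::real_vector) \<Rightarrow> _)"
  by (rule linearI) (auto simp: restrict_zero_def fun_eq_iff)

lemma face_polys_span: "face_polys v r f = span (restrict_zero (simplex_of v f) ` monomials r)"
  unfolding face_polys_def polys_def monomials_def[symmetric]
  by (rule linear_span_image[OF linear_restrict_zero, symmetric])

lemma subspace_face_polys: "subspace (face_polys v r f)"
  by (simp add: face_polys_span)

text \<open>Serves the finiteness of the test bases: fields whose components lie in a finitely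
  generated space form a finitely generated space.\<close>

lemma span_vector_valued:
  fixes q :: "'a \<Rightarrow> 'b::euclidean_space"
  assumes "\<And>b. b \<in> Basis \<Longrightarrow> (\<lambda>x. q x \<bullet> b) \<in> span G"
  shows "q \<in> span ((\<lambda>(g, b) x. g x *\<^sub>R b) ` (G \<times> Basis))" (is "_ \<in> ?S")
proof -
  have "(\<lambda>x. p x *\<^sub>R b) \<in> ?S" if "p \<in> span G" "b \<in> Basis" for p b
    using that(1)
  proof (induction rule: span_induct_alt)
    case base
    have "(\<lambda>x. (0 :: 'a \<Rightarrow> real) x *\<^sub>R b) = 0" by (simp add: fun_eq_iff)
    then show ?case using span_zero by metis
  next
    case (step c x y)
    have "(\<lambda>u. (c *\<^sub>R x + y) u *\<^sub>R b) = c *\<^sub>R (\<lambda>u. x u *\<^sub>R b) + (\<lambda>u. y u *\<^sub>R b)"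
      by (simp add: fun_eq_iff algebra_simps)
    moreover have "(\<lambda>u. x u *\<^sub>R b) \<in> ?S" by (rule span_base) (use step that in auto)
    ultimately show ?case using step by (metis span_add span_scale)
  qed
  then have "(\<Sum>b\<in>Basis. (\<lambda>x. (q x \<bullet> b) *\<^sub>R b)) \<in> ?S"
    using assms by (intro span_sum) auto
  moreover have "(\<Sum>b\<in>Basis. (\<lambda>x. (q x \<bullet> b) *\<^sub>R b)) = q"
    by (simp add: fun_eq_iff sum_fun_eval euclidean_representation)
  ultimately show ?thesis by simp
qed

text \<open>The test bases are given as independent generating sets; the induction behind the Gram
  systems runs over finite ones.\<close>

lemma finite_basis_of_subset_span:
  assumes "basis_of Q W" "W \<subseteq> span G" "finite G"
  shows "finite Q"
proof -
  have "Q \<subseteq> span G" using assms(1,2) span_superset[of Q] by (auto simp: basis_of_def)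
  then show ?thesis
    using independent_span_bound[OF assms(3), of Q] assms(1) by (auto simp: basis_of_def)
qed

lemma finite_basis_face_polys: "basis_of Q (face_polys v r f) \<Longrightarrow> finite Q"
  by (erule finite_basis_of_subset_span[where G = "restrict_zero (simplex_of v f) ` monomials r"])
    (simp_all add: face_polys_span finite_monomials)

lemma finite_basis_face_vec_polys:
  fixes v :: "nat \<Rightarrow> real^'n"
  assumes "basis_of Q (face_vec_polys v r f)"
  shows "finite Q"
proof (rule finite_basis_of_subset_span[OF assms])
  let ?G = "restrict_zero (simplex_of v f) ` monomials r"
  show "face_vec_polys v r f \<subseteq> span ((\<lambda>(g, b) x. g x *\<^sub>R b) ` (?G \<times> Basis))"
  proof
    fix q assume "q \<in> face_vec_polys v r f"
    then show "q \<in> span ((\<lambda>(g, b) x. g x *\<^sub>R b) ` (?G \<times> Basis))"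
      by (intro span_vector_valued) (auto simp: face_vec_polys_def face_polys_span Basis_vec_def inner_axis)
  qed
  show "finite ((\<lambda>(g, b) x. g x *\<^sub>R (b :: real^'n)) ` (?G \<times> Basis))" by (simp add: finite_monomials)
qed

lemma finite_basis_cell_sym_polys:
  fixes v :: "nat \<Rightarrow> real^'n"
  assumes "basis_of Q W" "W \<subseteq> cell_sym_polys v k m"
  shows "finite Q"
proof (rule finite_basis_of_subset_span[OF assms(1)])
  let ?G = "restrict_zero (simplex_of v (cell CARD('n) m)) ` monomials (int k)"
  show "W \<subseteq> span ((\<lambda>(g, b) x. g x *\<^sub>R b) ` (?G \<times> Basis))"
  proof
    fix q assume "q \<in> W"
    then show "q \<in> span ((\<lambda>(g, b) x. g x *\<^sub>R b) ` (?G \<times> Basis))"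
      using assms(2)
      by (intro span_vector_valued) (auto simp: cell_sym_polys_def face_polys_span Basis_vec_def inner_axis)
  qed
  show "finite ((\<lambda>(g, b) x. g x *\<^sub>R (b :: real^'n^'n)) ` (?G \<times> Basis))" by (simp add: finite_monomials)
qed

lemma continuous_on_face_polys:
  assumes "q \<in> face_polys v r f"
  shows "continuous_on (simplex_of v f) q"
proof -
  obtain p where p: "p \<in> polys r" "q = restrict_zero (simplex_of v f) p"
    using assms by (auto simp: face_polys_def)
  show ?thesis
    by (rule continuous_on_eq[OF continuous_on_polys[OF p(1)]]) (simp add: p restrict_zero_def)
qed

lemma face_polys_outside: "q \<in> face_polys v r f \<Longrightarrow> x \<notin> simplex_of v f \<Longrightarrow> q x = 0"
  by (auto simp: face_polys_def restrict_zero_def)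

lemma subspace_extended_polys: "subspace (extended_polys v r f)"
  by (simp add: extended_polys_def)

lemma extended_polys_mult:
  assumes "p \<in> extended_polys v r f" "q \<in> extended_polys v s f"
  shows "(\<lambda>x. p x * q x) \<in> extended_polys v (r + s) f"
  using assms unfolding extended_polys_def
proof (rule span_mult_closed)
  fix a b
  assume "a \<in> {(\<lambda>x. \<Prod>i\<in>f. hat v i x ^ \<alpha> i) | \<alpha>. int (\<Sum>i\<in>f. \<alpha> i) = r}"
    "b \<in> {(\<lambda>x. \<Prod>i\<in>f. hat v i x ^ \<alpha> i) | \<alpha>. int (\<Sum>i\<in>f. \<alpha> i) = s}"
  then obtain \<alpha> \<beta> where \<alpha>: "a = (\<lambda>x. \<Prod>i\<in>f. hat v i x ^ \<alpha> i)" "int (\<Sum>i\<in>f. \<alpha> i) = r"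
    and \<beta>: "b = (\<lambda>x. \<Prod>i\<in>f. hat v i x ^ \<beta> i)" "int (\<Sum>i\<in>f. \<beta> i) = s"
    by blast
  have "(\<lambda>x. a x * b x) = (\<lambda>x. \<Prod>i\<in>f. hat v i x ^ (\<alpha> i + \<beta> i))"
    by (simp add: \<alpha> \<beta> power_add prod.distrib)
  moreover have "int (\<Sum>i\<in>f. \<alpha> i + \<beta> i) = r + s" using \<alpha>(2) \<beta>(2) by (simp add: sum.distrib)
  ultimately show "(\<lambda>x. a x * b x) \<in> span {(\<lambda>x. \<Prod>i\<in>f. hat v i x ^ \<alpha> i) | \<alpha>. int (\<Sum>i\<in>f. \<alpha> i) = r + s}"
    by (intro span_base CollectI exI[of _ "\<lambda>i. \<alpha> i + \<beta> i"] conjI)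
qed

section \<open>Polynomials on a face and their homogeneous extensions\<close>

context simplex_split
begin

text \<open>On \<open>f\<close> every hat function is affine, so a monomial of degree
  \<open>r\<close> in the hat functions is a polynomial of degree at most \<open>r\<close>
  there.\<close>

lemma extended_polys_restrict:
  assumes "is_face f" "p \<in> extended_polys v r f"
  shows "\<exists>P\<in>polys r. \<forall>x\<in>simplex_of v f. p x = P x"
  using assms(2) unfolding extended_polys_def
proof (induction rule: span_induct_alt)
  case base
  show ?case using subspace_0[OF subspace_polys] by (intro bexI[of _ 0]) auto
next
  case (step c x y)
  then obtain \<alpha> P where \<alpha>: "x = (\<lambda>x. \<Prod>i\<in>f. hat v i x ^ \<alpha> i)" "int (\<Sum>i\<in>f. \<alpha> i) = r"
    and P: "P \<in> polys r" "\<forall>x\<in>simplex_of v f. y x = P x" by blast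
  have "\<forall>i\<in>f. \<exists>g b. \<forall>x\<in>simplex_of v f. hat v i x = g \<bullet> x + b"
    using hat_affine_on_face[OF assms(1)] is_face_le[OF assms(1)] by blast
  then obtain g b where gb: "\<forall>i\<in>f. \<forall>x\<in>simplex_of v f. hat v i x = g i \<bullet> x + b i" by metis
  let ?M = "\<lambda>x. \<Prod>i\<in>f. (g i \<bullet> x + b i) ^ \<alpha> i"
  have M: "?M \<in> polys r"
    using polys_prod[of f "\<lambda>i x. g i \<bullet> x + b i" \<alpha>, OF _ polys_affine] is_face_finite[OF assms(1)] \<alpha>(2) by simp
  have "c *\<^sub>R ?M + P \<in> polys r"
    by (rule subspace_add[OF subspace_polys subspace_scale[OF subspace_polys M] P(1)])
  moreover have "\<forall>x'\<in>simplex_of v f. (c *\<^sub>R x + y) x' = (c *\<^sub>R ?M + P) x'"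
    using P gb by (simp add: \<alpha>)
  ultimately show ?case by blast
qed

text \<open>On \<open>f\<close> the coordinates of a point are combinations of the hat functions
  with weights from the nodes, and the sum of the hat functions is 1. The first fact turns monomials
  in x into homogeneous ones, the second raises them to the exact degree \<open>r\<close>.\<close>

lemma extended_polys_extend:
  assumes "is_face f" "P \<in> polys r"
  shows "\<exists>p\<in>extended_polys v r f. \<forall>x\<in>simplex_of v f. p x = P x"
proof -
  let ?X = "\<lambda>r P. \<exists>p\<in>extended_polys v r f. \<forall>x\<in>simplex_of v f. p x = P x"
  have fin: "finite f" using is_face_finite[OF assms(1)] .
  have X_mult: "?X (r + s) (\<lambda>x. P x * Q x)" if PQ: "?X r P" "?X s Q" for r s P Q
  proof -
    obtain p q where "p\<in>extended_polys v r f" "\<forall>x\<in>simplex_of v f. p x = P x"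
      "q\<in>extended_polys v s f" "\<forall>x\<in>simplex_of v f. q x = Q x" using PQ by blast
    then show ?thesis
      using extended_polys_mult[of p v r f q s] by (intro bexI[of _ "\<lambda>x. p x * q x"]) auto
  qed
  have X_lin: "?X r (c *\<^sub>R P + Q)" if PQ: "?X r P" "?X r Q" for r c P Q
  proof -
    obtain p q where "p\<in>extended_polys v r f" "\<forall>x\<in>simplex_of v f. p x = P x"
      "q\<in>extended_polys v r f" "\<forall>x\<in>simplex_of v f. q x = Q x" using PQ by blast
    then show ?thesis
      using subspace_add[OF subspace_extended_polys subspace_scale[OF subspace_extended_polys], of p v r f q c]
      by (intro bexI[of _ "c *\<^sub>R p + q"]) auto
  qed
  have X_zero: "?X r 0" for r
    using subspace_0[OF subspace_extended_polys] by (intro bexI[of _ 0]) auto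
  have hat1: "hat v j \<in> extended_polys v 1 f" if "j \<in> f" for j
    unfolding extended_polys_def
  proof (rule span_base, rule CollectI, rule exI[of _ "\<lambda>i. if i = j then 1 else 0"])
    show "hat v j = (\<lambda>x. \<Prod>i\<in>f. hat v i x ^ (if i = j then 1 else 0)) \<and>
      int (\<Sum>i\<in>f. if i = j then 1 else 0) = 1"
      using that fin by (simp add: if_distrib[of "\<lambda>t. _ ^ t"] cong: if_cong)
  qed
  have X_lincomb: "?X 1 (\<lambda>x. \<Sum>i\<in>f. hat v i x * w i)" for w
  proof -
    have "(\<Sum>i\<in>f. w i *\<^sub>R hat v i) \<in> extended_polys v 1 f"
      by (intro subspace_sum[OF subspace_extended_polys] subspace_scale[OF subspace_extended_polys] hat1)
    moreover have "(\<Sum>i\<in>f. w i *\<^sub>R hat v i) x = (\<Sum>i\<in>f. hat v i x * w i)" for x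
      by (simp add: sum_fun_eval mult.commute)
    ultimately show ?thesis by blast
  qed
  have X_cong: "?X r Q" if P: "?X r P" and eq: "\<And>x. x \<in> simplex_of v f \<Longrightarrow> P x = Q x" for r P Q
    using P eq by fastforce
  have X1: "?X 1 (\<lambda>x. 1)"
    by (rule X_cong[OF X_lincomb[of "\<lambda>_. 1"]]) (simp add: hat_on_face(2)[OF assms(1)])
  have X_coord: "?X 1 (\<lambda>x. x $ j)" for j
  proof (rule X_cong[OF X_lincomb[of "\<lambda>i. node v i $ j"]])
    fix x assume "x \<in> simplex_of v f"
    from hat_on_face(3)[OF assms(1) this] have "x $ j = (\<Sum>i\<in>f. hat v i x *\<^sub>R node v i) $ j" by simp
    then show "(\<Sum>i\<in>f. hat v i x * node v i $ j) = x $ j" by simp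
  qed
  have X0: "?X 0 (\<lambda>x. 1)"
    unfolding extended_polys_def
    by (rule bexI[of _ "\<lambda>x. 1"]) (auto intro!: span_base exI[of _ "\<lambda>_. 0"])
  have X_pow: "?X (int n) (\<lambda>x. P x ^ n)" if P: "?X 1 P" for n P
  proof (induction n)
    case (Suc n)
    then show ?case using X_mult[OF P Suc] by simp
  qed (use X0 in simp)
  have X_mono: "?X (int (\<Sum>i\<in>A. \<alpha> i)) (\<lambda>x. \<Prod>i\<in>A. x $ i ^ \<alpha> i)" if "finite A" for A and \<alpha> :: "'n \<Rightarrow> nat"
    using that
  proof (induction A)
    case (insert i A)
    then show ?case using X_mult[OF X_pow[OF X_coord[of i], of "\<alpha> i"] insert.IH] by simp
  qed (use X0 in simp)
  show ?thesis
    using assms(2) unfolding polys_def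
  proof (induction rule: span_induct_alt)
    case base
    show ?case using X_zero .
  next
    case (step c x y)
    then obtain \<alpha> where \<alpha>: "x = (\<lambda>x. \<Prod>i\<in>UNIV. x $ i ^ \<alpha> i)" "int (\<Sum>i\<in>UNIV. \<alpha> i) \<le> r" by blast
    \<comment> \<open>The degree that is missing; it is filled by powers of the sum of the hat
      functions, which is 1 on \<open>f\<close>.\<close>
    define n where "n = nat (r - int (\<Sum>i\<in>UNIV. \<alpha> i))"
    have "?X (int (\<Sum>i\<in>UNIV. \<alpha> i) + int n) (\<lambda>u. x u * 1 ^ n)"
      unfolding \<alpha>(1) by (rule X_mult[OF X_mono[OF finite_class.finite_UNIV] X_pow[OF X1]])
    moreover have "int (\<Sum>i\<in>UNIV. \<alpha> i) + int n = r" using \<alpha>(2) by (simp add: n_def)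
    ultimately have "?X r x" by simp
    then show ?case using X_lin[OF _ step(2)] by simp
  qed
qed

text \<open>Each generator scales by the power \<open>r\<close> of \<open>s\<close>. For negative
  \<open>r\<close> there are no generators, so \<open>p\<close> is zero and the default
  \<open>nat r = 0\<close> is harmless.\<close>

lemma extended_polys_homogeneous:
  assumes "p \<in> extended_polys v r f" "0 \<le> s" "\<And>i. i \<in> f \<Longrightarrow> hat v i x = s * hat v i y"
  shows "p x = s ^ nat r * p y"
  using assms(1) unfolding extended_polys_def
proof (induction rule: span_induct_alt)
  case (step c p q)
  then obtain \<alpha> where \<alpha>: "p = (\<lambda>x. \<Prod>i\<in>f. hat v i x ^ \<alpha> i)" "int (\<Sum>i\<in>f. \<alpha> i) = r" by blast
  have "p x = (\<Prod>i\<in>f. s ^ \<alpha> i * hat v i y ^ \<alpha> i)"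
    unfolding \<alpha>(1) by (intro prod.cong) (simp_all add: assms(3) power_mult_distrib)
  also have "\<dots> = s ^ (\<Sum>i\<in>f. \<alpha> i) * p y" by (simp add: \<alpha>(1) prod.distrib power_sum)
  also have "(\<Sum>i\<in>f. \<alpha> i) = nat r" unfolding \<alpha>(2)[symmetric] by (rule nat_int[symmetric])
  finally show ?case using step by (simp add: algebra_simps)
qed simp

lemma extended_polys_continuous:
  assumes "is_face f" "p \<in> extended_polys v r f"
  shows "continuous_on (simplex_of v {..d}) p"
  using assms(2) unfolding extended_polys_def
proof (induction rule: span_induct_alt)
  case base
  show ?case by (simp add: zero_fun_def)
next
  case (step c x y)
  then show ?case using continuous_on_hat is_face_le[OF assms(1)]
    by (auto simp: plus_fun_def scaleR_fun_def intro!: continuous_intros)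
qed

lemma bubble_pos_iff:
  assumes "is_face f"
  shows "bubble v f x \<noteq> 0 \<longleftrightarrow> (\<forall>i\<in>f. 0 < hat v i x)"
  using is_face_finite[OF assms] is_face_le[OF assms] hat_nonneg[of _ x]
  by (auto simp: bubble_def prod_zero_iff order_less_le)

lemma bubble_nonneg: "is_face f \<Longrightarrow> 0 \<le> bubble v f x"
  unfolding bubble_def by (rule prod_nonneg) (auto intro: hat_nonneg is_face_le)

lemma bubble_continuous: "is_face f \<Longrightarrow> continuous_on (simplex_of v {..d}) (bubble v f)"
  unfolding bubble_def using continuous_on_hat is_face_le by (auto intro!: continuous_intros)

text \<open>The factor of the bubble at a node of \<open>g\<close> outside \<open>f\<close> vanishes
  on \<open>f\<close>. This is the source of the triangular structure.\<close>

lemma bubble_zero_on_face: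
  assumes "is_face f" "is_face g" "\<not> g \<subseteq> f" "x \<in> simplex_of v f"
  shows "bubble v g x = 0"
proof -
  obtain i where i: "i \<in> g" "i \<notin> f" using assms by blast
  then have "hat v i x = 0" using hat_on_face(1)[OF assms(1,4)] is_face_le[OF assms(2)] by blast
  then show ?thesis using i is_face_finite[OF assms(2)] by (auto simp: bubble_def)
qed

text \<open>Central projection onto \<open>f\<close> in the coordinates \<open>\<lambda>\<^sub>i\<^sup>R\<close>, by homogeneity.\<close>

lemma bubble_mult_eq_zero:
  assumes "is_face f" "p \<in> extended_polys v r f"
    and zero: "\<And>y. y \<in> simplex_of v f \<Longrightarrow> \<forall>i\<in>f. 0 < hat v i y \<Longrightarrow> p y = 0"
  shows "bubble v f x * p x = 0"
proof (cases "bubble v f x = 0")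
  case False
  then have pos: "\<forall>i\<in>f. 0 < hat v i x" using bubble_pos_iff[OF assms(1)] by simp
  define s where "s = (\<Sum>i\<in>f. hat v i x)"
  have s: "0 < s" unfolding s_def
    by (rule sum_pos) (use pos assms(1) is_face_finite is_face_def in auto)
  define y where "y = (\<Sum>i\<in>f. (hat v i x / s) *\<^sub>R node v i)"
  have a: "\<forall>i\<in>f. 0 \<le> hat v i x / s" "(\<Sum>i\<in>f. hat v i x / s) = 1"
    using pos s by (auto simp: s_def less_imp_le simp flip: sum_divide_distrib)
  note fp = face_point[OF assms(1) a y_def]
  have hy: "hat v i y = hat v i x / s" if "i \<in> f" for i
    using fp(2)[of i] is_face_le[OF assms(1) that] that by simp
  have "p y = 0" using zero[OF fp(1)] hy pos s by simp
  moreover have "p x = s ^ nat r * p y"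
    by (rule extended_polys_homogeneous[OF assms(2)]) (use s hy in auto)
  ultimately show ?thesis by simp
qed simp

end

section \<open>The integral over a face\<close>

lemma restrict_zero_cong: "(\<And>x. x \<in> S \<Longrightarrow> u x = w x) \<Longrightarrow> restrict_zero S u = restrict_zero S w"
  by (auto simp: restrict_zero_def)

lemma face_integral_cong: "(\<And>x. x \<in> simplex_of v f \<Longrightarrow> u x = w x) \<Longrightarrow> face_integral v f u = face_integral v f w"
  unfolding face_integral_def Let_def using restrict_zero_cong[of "simplex_of v f" u w] by simp

lemma orthonormal_expansion:
  fixes e :: "nat \<Rightarrow> 'a::real_inner"
  assumes "\<forall>i<l. \<forall>j<l. e i \<bullet> e j = (if i = j then 1 else 0)" "t \<in> span (e ` {..<l})"
  shows "t = (\<Sum>i<l. (t \<bullet> e i) *\<^sub>R e i)"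
  using assms(2)
proof (induction rule: span_induct_alt)
  case (step c x y)
  then obtain j where j: "j < l" "x = e j" by auto
  have "(\<Sum>i<l. ((c *\<^sub>R x + y) \<bullet> e i) *\<^sub>R e i) = c *\<^sub>R (\<Sum>i<l. (e j \<bullet> e i) *\<^sub>R e i) + (\<Sum>i<l. (y \<bullet> e i) *\<^sub>R e i)"
    by (simp add: j inner_add_left scaleR_left_distrib sum.distrib scaleR_sum_right)
  also have "(\<Sum>i<l. (e j \<bullet> e i) *\<^sub>R e i) = (\<Sum>i<l. if i = j then e i else 0)"
    by (rule sum.cong) (use assms(1) j in auto)
  also have "\<dots> = x" using j by simp
  finally show ?case using step by simp
qed simp

context simplex_split
begin

text \<open>The orthonormal frame selected inside \<open>face_integral\<close>, repeated literally
  so that the integral can be rewritten with it by unfolding.\<close>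

definition face_frame :: "nat set \<Rightarrow> nat \<Rightarrow> real^'n" where
  "face_frame f = (SOME e :: nat \<Rightarrow> real^'n.
     (\<forall>i<card f - 1. e i \<in> tangent v f) \<and>
     (\<forall>i<card f - 1. \<forall>j<card f - 1. e i \<bullet> e j = (if i = j then 1 else 0)))"

definition face_map :: "nat set \<Rightarrow> (nat \<Rightarrow> real) \<Rightarrow> real^'n" where
  "face_map f y = node v (Min f) + (\<Sum>i<card f - 1. y i *\<^sub>R face_frame f i)"

abbreviation face_measure :: "nat set \<Rightarrow> (nat \<Rightarrow> real) measure" where
  "face_measure f \<equiv> Pi\<^sub>M {..<card f - 1} (\<lambda>_. lborel)"

lemma face_integral_eq:
  "face_integral v f u = (LINT y|face_measure f. restrict_zero (simplex_of v f) u (face_map f y))"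
  unfolding face_integral_def face_map_def face_frame_def Let_def ..

lemma face_frame:
  assumes "is_face f"
  shows "i < card f - 1 \<Longrightarrow> face_frame f i \<in> tangent v f"
    and "\<forall>i<card f - 1. \<forall>j<card f - 1. face_frame f i \<bullet> face_frame f j = (if i = j then 1 else 0)"
    and "span (face_frame f ` {..<card f - 1}) = tangent v f"
proof -
  let ?l = "card f - 1"
  obtain m where m: "m \<le> d" "f \<subseteq> opp m" "f \<noteq> {}" using assms by (auto simp: is_face_def)
  have dimt: "Real_Vector_Spaces.dim (tangent v f) = ?l"
    using dim_tangent[of m f] m by simp
  obtain B where B: "B \<subseteq> tangent v f" "pairwise orthogonal B" "\<And>x. x \<in> B \<Longrightarrow> norm x = 1"
    "independent B" "card B = Real_Vector_Spaces.dim (tangent v f)"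
    using orthonormal_basis_subspace[OF subspace_tangent] by metis
  have "finite B" using B(4) independent_bound by blast
  then obtain h where h: "bij_betw h {0..<card B} B" using ex_bij_betw_nat_finite by blast
  have hB: "h i \<in> B" if "i < ?l" for i
    using h that B(5) dimt by (auto simp: bij_betw_def)
  have "h i \<bullet> h j = (if i = j then 1 else 0)" if "i < ?l" "j < ?l" for i j
  proof (cases "i = j")
    case True
    then show ?thesis using B(3)[OF hB[OF that(1)]] by (simp add: dot_square_norm)
  next
    case False
    then have "h i \<noteq> h j" using h that B(5) dimt by (auto simp: bij_betw_def inj_on_def)
    then show ?thesis using B(2) hB[OF that(1)] hB[OF that(2)] False by (auto simp: pairwise_def orthogonal_def)
  qed
  then have ex: "\<exists>e :: nat \<Rightarrow> real^'n. (\<forall>i<?l. e i \<in> tangent v f) \<and>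
     (\<forall>i<?l. \<forall>j<?l. e i \<bullet> e j = (if i = j then 1 else 0))"
    using hB B(1) by (intro exI[of _ h]) auto
  note fr = someI_ex[OF ex, folded face_frame_def]
  show t: "i < ?l \<Longrightarrow> face_frame f i \<in> tangent v f" for i using fr by blast
  show on: "\<forall>i<?l. \<forall>j<?l. face_frame f i \<bullet> face_frame f j = (if i = j then 1 else 0)" using fr by blast
  have inj: "inj_on (face_frame f) {..<?l}"
  proof (rule inj_onI)
    fix i j assume ij: "i \<in> {..<?l}" "j \<in> {..<?l}" "face_frame f i = face_frame f j"
    then have "face_frame f i \<bullet> face_frame f j = 1" using on by auto
    then show "i = j" using on ij by (metis lessThan_iff zero_neq_one)
  qed
  have "independent (face_frame f ` {..<?l})"
  proof (rule pairwise_orthogonal_independent)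
    show "pairwise orthogonal (face_frame f ` {..<?l})"
      using on by (auto simp: pairwise_def orthogonal_def)
    show "0 \<notin> face_frame f ` {..<?l}"
    proof
      assume "0 \<in> face_frame f ` {..<?l}"
      then obtain i where "i < ?l" "face_frame f i = 0" by auto
      then show False using on by (metis inner_zero_left zero_neq_one)
    qed
  qed
  then have "tangent v f \<subseteq> span (face_frame f ` {..<?l})"
    by (intro card_ge_dim_independent) (use t dimt card_image[OF inj] in auto)
  moreover have "span (face_frame f ` {..<?l}) \<subseteq> tangent v f"
    by (rule span_minimal[OF _ subspace_tangent]) (use t in auto)
  ultimately show "span (face_frame f ` {..<?l}) = tangent v f" by blast
qed

lemma face_map_measurable: "face_map f \<in> borel_measurable (face_measure f)"
proof -
  have "(\<lambda>y. y i) \<in> borel_measurable (face_measure f)" if "i < card f - 1" for i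
    using measurable_component_singleton[of i "{..<card f - 1}" "\<lambda>_. lborel"] that by simp
  then show ?thesis
    unfolding face_map_def[abs_def]
    by (intro borel_measurable_add borel_measurable_sum borel_measurable_scaleR borel_measurable_const) auto
qed

lemma emeasure_box:
  "emeasure (face_measure f) (PiE {..<card f - 1} (\<lambda>i. {a i..b i})) = (\<Prod>i<card f - 1. emeasure lborel {a i..b i})"
proof -
  interpret product_sigma_finite "\<lambda>_. lborel :: real measure" by standard
  show ?thesis by (rule emeasure_PiM) auto
qed

lemma restrict_zero_measurable:
  fixes u :: "real^'n \<Rightarrow> real"
  assumes "is_face f" "continuous_on (simplex_of v f) u"
  shows "(\<lambda>y. restrict_zero (simplex_of v f) u (face_map f y)) \<in> borel_measurable (face_measure f)"
proof -
  have "(\<lambda>x. indicator (simplex_of v f) x *\<^sub>R u x) \<in> borel_measurable borel"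
    using compact_simplex_of[OF is_face_finite[OF assms(1)]] assms(2)
    by (intro borel_measurable_continuous_on_indicator borel_compact)
  moreover have "(\<lambda>x. indicator (simplex_of v f) x *\<^sub>R u x) = restrict_zero (simplex_of v f) u"
    by (auto simp: restrict_zero_def indicator_def)
  ultimately have "restrict_zero (simplex_of v f) u \<in> borel_measurable borel" by simp
  from measurable_compose[OF face_map_measurable this] show ?thesis .
qed

text \<open>As the frame is orthonormal, each parameter of a point of the face is an inner product
  with a unit vector and hence bounded by \<open>M\<close>. So the parameter domain of the face lies
  in a box of finite measure, on which the integrand is bounded.\<close>

lemma face_integrable:
  fixes u :: "real^'n \<Rightarrow> real"
  assumes "is_face f" "continuous_on (simplex_of v f) u"
  shows "integrable (face_measure f) (\<lambda>y. restrict_zero (simplex_of v f) u (face_map f y))"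
proof -
  let ?l = "card f - 1" and ?S = "simplex_of v f" and ?x0 = "node v (Min f)"
  have comp: "compact ?S" using compact_simplex_of[OF is_face_finite[OF assms(1)]] .
  obtain K where K: "\<And>x. x \<in> ?S \<Longrightarrow> norm (u x) \<le> K"
    using compact_imp_bounded[OF compact_continuous_image[OF assms(2) comp]] by (auto simp: bounded_iff)
  obtain R where R: "\<And>x. x \<in> ?S \<Longrightarrow> norm x \<le> R"
    using compact_imp_bounded[OF comp] by (auto simp: bounded_iff)
  define M where "M = R + norm ?x0"
  let ?A = "PiE {..<?l} (\<lambda>_. {- M..M})"
  have A: "y \<in> ?A" if y: "y \<in> space (face_measure f)" "face_map f y \<in> ?S" for y
  proof -
    have "\<bar>y i\<bar> \<le> M" if "i < ?l" for i
    proof -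
      have "(face_map f y - ?x0) \<bullet> face_frame f i = (\<Sum>j<?l. y j * (face_frame f j \<bullet> face_frame f i))"
        by (simp add: face_map_def inner_sum_left)
      also have "\<dots> = (\<Sum>j<?l. if j = i then y j else 0)"
        by (rule sum.cong) (use face_frame(2)[OF assms(1)] that in auto)
      also have "\<dots> = y i" using that by simp
      finally have "y i = (face_map f y - ?x0) \<bullet> face_frame f i" ..
      then have "\<bar>y i\<bar> \<le> norm (face_map f y - ?x0) * norm (face_frame f i)"
        using Cauchy_Schwarz_ineq2 by simp
      also have "norm (face_frame f i) = 1"
        using face_frame(2)[OF assms(1)] that by (simp add: norm_eq_1)
      also have "norm (face_map f y - ?x0) * 1 \<le> M"
        using norm_triangle_ineq4[of "face_map f y" ?x0] R[OF y(2)] by (simp add: M_def)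
      finally show ?thesis .
    qed
    then show ?thesis using y(1) by (auto simp: space_PiM PiE_iff abs_le_iff minus_le_iff)
  qed
  show ?thesis
  proof (rule integrableI_bounded_set[where A = ?A and B = "\<bar>K\<bar>"])
    show "?A \<in> sets (face_measure f)" by (intro sets_PiM_I_finite) auto
    show "(\<lambda>y. restrict_zero ?S u (face_map f y)) \<in> borel_measurable (face_measure f)"
      by (rule restrict_zero_measurable[OF assms])
    show "emeasure (face_measure f) ?A < \<infinity>"
      unfolding emeasure_box by (simp add: power_less_top_ennreal emeasure_lborel_Icc_eq)
    show "AE y in face_measure f. y \<in> ?A \<longrightarrow> norm (restrict_zero ?S u (face_map f y)) \<le> \<bar>K\<bar>"
    proof (rule AE_I2, rule impI)
      show "norm (restrict_zero ?S u (face_map f y)) \<le> \<bar>K\<bar>" for y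
        using K[of "face_map f y"] by (auto simp: restrict_zero_def)
    qed
    show "AE y in face_measure f. y \<notin> ?A \<longrightarrow> restrict_zero ?S u (face_map f y) = 0"
      by (rule AE_I2) (use A in \<open>auto simp: restrict_zero_def\<close>)
  qed
qed

lemma face_integral_add:
  assumes "is_face f" "continuous_on (simplex_of v f) u" "continuous_on (simplex_of v f) w"
  shows "face_integral v f (\<lambda>x. u x + w x) = face_integral v f u + face_integral v f w"
proof -
  have "restrict_zero (simplex_of v f) (\<lambda>x. u x + w x) z =
      restrict_zero (simplex_of v f) u z + restrict_zero (simplex_of v f) w z" for z
    by (simp add: restrict_zero_def)
  then show ?thesis
    unfolding face_integral_eq using face_integrable[OF assms(1)] assms(2,3) by simp
qed

lemma face_integral_cmult: "face_integral v f (\<lambda>x. c * u x) = c * face_integral v f u"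
proof -
  have "restrict_zero (simplex_of v f) (\<lambda>x. c * u x) z = c * restrict_zero (simplex_of v f) u z" for z
    by (simp add: restrict_zero_def)
  then show ?thesis unfolding face_integral_eq by simp
qed

lemma bary_comb_face:
  assumes "m \<le> Suc d" "f \<subseteq> opp m" "sum a f = 1" "x = (\<Sum>i\<in>f. a i *\<^sub>R node v i)" "j \<in> f"
  shows "bary m j x = a j"
proof -
  let ?a = "\<lambda>i. if i \<in> f then a i else 0"
  have "(\<Sum>i\<in>opp m. ?a i) = sum a f"
    using assms(2) by (simp add: sum.inter_restrict[symmetric] Int_absorb1)
  moreover have "(\<Sum>i\<in>opp m. ?a i *\<^sub>R node v i) = x"
    using assms(2,4) by (simp add: if_distrib[of "\<lambda>t. t *\<^sub>R _"] sum.inter_restrict[symmetric] Int_absorb1 cong: if_cong)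
  ultimately have "bary m j x = ?a j"
    using assms by (intro bary_comb) auto
  then show ?thesis using assms(5) by simp
qed

text \<open>A tangential displacement stays in the affine hull of \<open>f\<close>, and the
  barycentric coordinates, being continuous, stay positive if it is small.\<close>

lemma relative_interior_nbhd:
  assumes "is_face f" "x \<in> simplex_of v f" "\<forall>i\<in>f. 0 < hat v i x"
  shows "\<exists>\<delta>>0. \<forall>h\<in>tangent v f. norm h < \<delta> \<longrightarrow> x + h \<in> simplex_of v f"
proof -
  obtain m where m: "m \<le> Suc d" "f \<subseteq> opp m" using assms by (force simp: is_face_def)
  have fin: "finite f" using is_face_finite[OF assms(1)] .
  define U where "U = (\<Inter>i\<in>f. {z. 0 < bary m i z})"
  have "open U" unfolding U_def
    using fin continuous_on_bary[OF m(1)] by (intro open_INT ballI open_Collect_less continuous_on_const) auto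
  moreover have "x \<in> U"
    using assms(3) bary_comb_face[OF m hat_on_face(2)[OF assms(1,2)] hat_on_face(3)[OF assms(1,2), symmetric]]
    by (auto simp: U_def)
  ultimately obtain \<delta> where \<delta>: "0 < \<delta>" "ball x \<delta> \<subseteq> U" using open_contains_ball by blast
  have "x + h \<in> simplex_of v f" if h: "h \<in> tangent v f" "norm h < \<delta>" for h
  proof -
    obtain a where a: "sum a f = 0" "h = (\<Sum>i\<in>f. a i *\<^sub>R node v i)" using tangent_comb[OF fin h(1)] by blast
    let ?b = "\<lambda>i. hat v i x + a i"
    have s: "sum ?b f = 1" using hat_on_face(2)[OF assms(1,2)] a(1) by (simp add: sum.distrib)
    have xh: "x + h = (\<Sum>i\<in>f. ?b i *\<^sub>R node v i)"
      using hat_on_face(3)[OF assms(1,2)] a(2) by (simp add: scaleR_left_distrib sum.distrib)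
    have "x + h \<in> U" using \<delta>(2) h(2) by (auto simp: dist_norm)
    then have b: "\<forall>i\<in>f. 0 \<le> ?b i"
      using bary_comb_face[OF m s xh] by (fastforce simp: U_def)
    show ?thesis
      unfolding simplex_of_iff[OF fin] by (rule exI[of _ ?b], intro conjI b s xh)
  qed
  then show ?thesis using \<delta>(1) by blast
qed

text \<open>Otherwise the integrand would be positive on a whole box of parameters around the point,
  and this box has positive measure.\<close>

lemma face_integral_eq_zero:
  assumes f: "is_face f" and u: "continuous_on (simplex_of v f) u"
    and nonneg: "\<And>x. x \<in> simplex_of v f \<Longrightarrow> 0 \<le> u x" and zero: "face_integral v f u = 0"
    and x: "x \<in> simplex_of v f" "\<forall>i\<in>f. 0 < hat v i x"
  shows "u x = 0"
proof (rule ccontr)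
  let ?l = "card f - 1" and ?S = "simplex_of v f" and ?x0 = "node v (Min f)"
  let ?F = "\<lambda>y. restrict_zero ?S u (face_map f y)"
  assume "u x \<noteq> 0"
  then have ux: "0 < u x" using nonneg[OF x(1)] by simp
  have fin: "finite f" "f \<noteq> {}" using is_face_finite[OF f] f by (auto simp: is_face_def)
  obtain \<delta>1 where \<delta>1: "0 < \<delta>1" "\<And>h. h\<in>tangent v f \<Longrightarrow> norm h < \<delta>1 \<Longrightarrow> x + h \<in> ?S"
    using relative_interior_nbhd[OF f x] by blast
  obtain \<delta>2 where \<delta>2: "0 < \<delta>2" "\<And>x'. x' \<in> ?S \<Longrightarrow> dist x' x < \<delta>2 \<Longrightarrow> dist (u x') (u x) < u x"
    using u x(1) ux unfolding continuous_on_iff by metis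
  \<comment> \<open>A box of this half-width moves the point by at most
    \<open>?l * \<epsilon>\<close>, which is below both radii. The \<open>+ 1\<close> keeps the
    denominator positive for a vertex, where \<open>?l\<close> is zero.\<close>
  define \<epsilon> where "\<epsilon> = min \<delta>1 \<delta>2 / (2 * real (?l + 1))"
  have \<epsilon>: "0 < \<epsilon>" using \<delta>1(1) \<delta>2(1) by (simp add: \<epsilon>_def)
  have l\<epsilon>: "real ?l * \<epsilon> < min \<delta>1 \<delta>2"
  proof -
    have "real ?l * \<epsilon> < 2 * real (?l + 1) * \<epsilon>" using \<epsilon> by simp
    also have "\<dots> = min \<delta>1 \<delta>2" by (simp add: \<epsilon>_def)
    finally show ?thesis .
  qed
  have "x - ?x0 \<in> tangent v f"
  proof -
    have "x - ?x0 = (\<Sum>i\<in>f. hat v i x *\<^sub>R (node v i - ?x0))"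
      using hat_on_face(2,3)[OF f x(1)]
      by (simp add: scaleR_diff_right sum_subtractf flip: scaleR_sum_left)
    also have "\<dots> \<in> tangent v f"
      using fin by (intro subspace_sum[OF subspace_tangent] subspace_scale[OF subspace_tangent] diff_node_in_tangent) auto
    finally show ?thesis .
  qed
  then have xe: "x - ?x0 = (\<Sum>i<?l. ((x - ?x0) \<bullet> face_frame f i) *\<^sub>R face_frame f i)"
    using orthonormal_expansion[OF face_frame(2)[OF f]] face_frame(3)[OF f] by simp
  define y0 where "y0 i = (x - ?x0) \<bullet> face_frame f i" for i
  let ?B = "PiE {..<?l} (\<lambda>i. {y0 i - \<epsilon>..y0 i + \<epsilon>})"
  have pos: "0 < ?F y" if y: "y \<in> ?B" for y
  proof -
    define h where "h = (\<Sum>i<?l. (y i - y0 i) *\<^sub>R face_frame f i)"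
    have "x = ?x0 + (\<Sum>i<?l. y0 i *\<^sub>R face_frame f i)"
      using xe unfolding y0_def[symmetric] by (metis add.commute diff_add_cancel)
    then have xh: "face_map f y = x + h"
      unfolding face_map_def h_def scaleR_left_diff_distrib sum_subtractf by simp
    have ht: "h \<in> tangent v f" unfolding h_def
      by (intro subspace_sum[OF subspace_tangent] subspace_scale[OF subspace_tangent]) (use face_frame(1)[OF f] in auto)
    have "norm h \<le> (\<Sum>i<?l. \<epsilon>)"
      unfolding h_def
    proof (rule sum_norm_le)
      fix i assume i: "i \<in> {..<?l}"
      have "norm (face_frame f i) = 1" using face_frame(2)[OF f] i by (simp add: norm_eq_1)
      moreover have "y i \<in> {y0 i - \<epsilon>..y0 i + \<epsilon>}" using y i by (rule PiE_mem)
      ultimately show "norm ((y i - y0 i) *\<^sub>R face_frame f i) \<le> \<epsilon>" by (auto simp: abs_le_iff)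
    qed
    then have nh: "norm h < \<delta>1" "norm h < \<delta>2" using l\<epsilon> by auto
    have "x + h \<in> ?S" using \<delta>1(2)[OF ht nh(1)] .
    moreover from \<delta>2(2)[OF this] have "0 < u (x + h)" using nh(2) by (auto simp: dist_norm abs_if split: if_splits)
    ultimately show ?thesis by (simp add: xh restrict_zero_def)
  qed
  have "AE y in face_measure f. ?F y = 0"
  proof (subst integral_nonneg_eq_0_iff_AE[symmetric])
    show "AE y in face_measure f. 0 \<le> ?F y" by (rule AE_I2) (simp add: restrict_zero_def nonneg)
    show "(LINT y|face_measure f. ?F y) = 0" using zero by (simp add: face_integral_eq)
  qed (rule face_integrable[OF f u])
  then have "AE y in face_measure f. y \<notin> ?B"
  proof eventually_elim
    case (elim y)
    then show "y \<notin> ?B" using pos[of y] by auto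
  qed
  moreover have BS: "?B \<in> sets (face_measure f)" by (intro sets_PiM_I_finite) auto
  moreover have "{y \<in> space (face_measure f). \<not> y \<notin> ?B} = ?B"
    using sets.sets_into_space[OF BS] by blast
  ultimately have "emeasure (face_measure f) ?B = 0"
    using AE_iff_measurable[of ?B "face_measure f" "\<lambda>y. y \<notin> ?B"] by blast
  \<comment> \<open>The box has a positive volume; for a vertex it is a single point of mass
    1.\<close>
  then show False using \<epsilon> unfolding emeasure_box by simp
qed

end

section \<open>Moments of bubble functions\<close>

context simplex_split
begin

text \<open>Relative interior points are dense in the face: approach \<open>x\<close> along the
  segment from the barycenter \<open>b\<close> of \<open>f\<close>.\<close>

lemma vanishing_on_face:
  fixes u :: "real^'n \<Rightarrow> 'b::real_normed_vector"
  assumes f: "is_face f" and u: "continuous_on (simplex_of v f) u"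
    and zero: "\<And>y. y \<in> simplex_of v f \<Longrightarrow> \<forall>i\<in>f. 0 < hat v i y \<Longrightarrow> u y = 0"
    and x: "x \<in> simplex_of v f"
  shows "u x = 0"
proof -
  have fin: "finite f" "f \<noteq> {}" using is_face_finite[OF f] f by (auto simp: is_face_def)
  define N where "N = real (card f)"
  have N: "0 < N" using fin by (simp add: N_def card_gt_0_iff)
  define t where "t n = inverse (real (Suc n))" for n
  have t: "0 < t n" "t n \<le> 1" for n by (simp_all add: t_def inverse_le_1_iff)
  define b where "b = (\<Sum>i\<in>f. (1 / N) *\<^sub>R node v i)"
  define y where "y n = (1 - t n) *\<^sub>R x + t n *\<^sub>R b" for n
  have y_interior: "y n \<in> simplex_of v f \<and> (\<forall>i\<in>f. 0 < hat v i (y n))" for n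
  proof -
    let ?a = "\<lambda>i. (1 - t n) * hat v i x + t n / N"
    have pos: "0 < ?a i" if "i \<in> f" for i
      using t[of n] N hat_nonneg[of i x] is_face_le[OF f that] by (intro add_nonneg_pos) auto
    have s: "sum ?a f = 1"
      using hat_on_face(2)[OF f x] N by (simp add: sum.distrib N_def flip: sum_distrib_left)
    have yn: "y n = (\<Sum>i\<in>f. ?a i *\<^sub>R node v i)"
    proof -
      have "(\<Sum>i\<in>f. ?a i *\<^sub>R node v i) = (1 - t n) *\<^sub>R (\<Sum>i\<in>f. hat v i x *\<^sub>R node v i) + t n *\<^sub>R b"
        by (simp add: b_def scaleR_left_distrib sum.distrib scaleR_sum_right)
      then show ?thesis using hat_on_face(3)[OF f x] by (simp add: y_def)
    qed
    have nn: "\<forall>i\<in>f. 0 \<le> ?a i" using pos less_imp_le by blast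
    show ?thesis
      using face_point[OF f nn s yn] pos is_face_le[OF f] by auto
  qed
  have "t \<longlonglongrightarrow> 0" unfolding t_def by (rule LIMSEQ_inverse_real_of_nat)
  then have "y \<longlonglongrightarrow> (1 - 0) *\<^sub>R x + 0 *\<^sub>R b"
    unfolding y_def[abs_def] by (intro tendsto_intros)
  then have "y \<longlonglongrightarrow> x" by simp
  then have "(\<lambda>n. u (y n)) \<longlonglongrightarrow> u x"
    by (rule continuous_on_tendsto_compose[OF u _ x]) (use y_interior in auto)
  moreover have "(\<lambda>n. u (y n)) = (\<lambda>_. 0)" using zero y_interior by auto
  ultimately show ?thesis using LIMSEQ_unique tendsto_const by metis
qed

lemma bubble_continuous_face:
  assumes "is_face f" "is_face g" shows "continuous_on (simplex_of v g) (bubble v f)"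
  by (rule continuous_on_subset[OF bubble_continuous[OF assms(1)] simplex_subset_T[OF assms(2)]])

text \<open>The bubble is a weight that is positive in the relative interior, so the weighted
  product is definite there, and by continuity on the closed face. Vanishing outside the face makes
  elements of \<open>W\<close> with zero values on it equal to the zero function.\<close>

lemma weighted_gram:
  fixes W :: "(real^'n \<Rightarrow> 'b::euclidean_space) set"
  assumes f: "is_face f" and Q: "basis_of Q W" "finite Q"
    and cont: "\<And>p. p \<in> W \<Longrightarrow> continuous_on (simplex_of v f) p"
    and out: "\<And>p x. p \<in> W \<Longrightarrow> x \<notin> simplex_of v f \<Longrightarrow> p x = 0"
  shows "\<exists>!p. p \<in> W \<and> (\<forall>q\<in>Q. face_integral v f (\<lambda>x. bubble v f x * (p x \<bullet> q x)) = a q)"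
proof (rule gram_solve[OF Q(2,1)])
  let ?b = "bubble v f"
  have c: "continuous_on (simplex_of v f) (\<lambda>x. ?b x * (p x \<bullet> q x))" if "p \<in> W" "q \<in> W" for p q
    using bubble_continuous_face[OF f f] cont[OF that(1)] cont[OF that(2)] by (intro continuous_intros)
  fix x y z assume xyz: "x \<in> W" "y \<in> W" "z \<in> W"
  show "face_integral v f (\<lambda>u. ?b u * ((x + y) u \<bullet> z u)) =
      face_integral v f (\<lambda>u. ?b u * (x u \<bullet> z u)) + face_integral v f (\<lambda>u. ?b u * (y u \<bullet> z u))"
    using face_integral_add[OF f c[OF xyz(1,3)] c[OF xyz(2,3)]] by (simp add: inner_add_left distrib_left)
next
  fix c x z
  show "face_integral v f (\<lambda>u. bubble v f u * ((c *\<^sub>R x) u \<bullet> z u)) = c * face_integral v f (\<lambda>u. bubble v f u * (x u \<bullet> z u))"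
    by (simp add: face_integral_cmult[symmetric] mult.left_commute)
next
  fix x y show "face_integral v f (\<lambda>u. bubble v f u * (x u \<bullet> y u)) = face_integral v f (\<lambda>u. bubble v f u * (y u \<bullet> x u))"
    by (simp only: inner_commute)
next
  fix p assume p: "p \<in> W" "face_integral v f (\<lambda>u. bubble v f u * (p u \<bullet> p u)) = 0"
  have "p y = 0" if y: "y \<in> simplex_of v f" "\<forall>i\<in>f. 0 < hat v i y" for y
  proof -
    have "bubble v f y * (p y \<bullet> p y) = 0"
      by (rule face_integral_eq_zero[OF f _ _ p(2) y])
        (use bubble_continuous_face[OF f f] cont[OF p(1)] bubble_nonneg[OF f] in \<open>auto intro!: continuous_intros\<close>)
    moreover have "bubble v f y \<noteq> 0" using bubble_pos_iff[OF f] y(2) by blast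
    ultimately show ?thesis by simp
  qed
  then have "p x = 0" for x
    using vanishing_on_face[OF f cont[OF p(1)]] out[OF p(1)] by blast
  then show "p = 0" by (simp add: fun_eq_iff)
qed

section \<open>Generators of the bubble spaces, their traces and their moments\<close>

definition bubble_field :: "nat set \<Rightarrow> (real^'n \<Rightarrow> real) \<Rightarrow> (nat \<Rightarrow> real^'n^'n) \<Rightarrow> 'n pw_field" where
  "bubble_field f p A m x =
    (if m \<le> d \<and> x \<in> simplex_of v (cell d m) then (bubble v f x * p x) *\<^sub>R A m else 0)"

lemma bubble_space_eq:
  "bubble_space v k f V =
    span {bubble_field f p A | p A. p \<in> extended_polys v (int k - int (card f)) f \<and> A \<in> V}"
  unfolding bubble_space_def bubble_field_def[abs_def] dim[symmetric] ..

lemma bubble_field_add_tensor: "bubble_field f p (A + B) = bubble_field f p A + bubble_field f p B"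
  by (simp add: bubble_field_def fun_eq_iff algebra_simps)

lemma bubble_field_scale_tensor: "bubble_field f p (c *\<^sub>R A) = c *\<^sub>R bubble_field f p A"
  by (simp add: bubble_field_def fun_eq_iff)

lemma bubble_field_lincomb: "bubble_field f (c *\<^sub>R p + q) A = c *\<^sub>R bubble_field f p A + bubble_field f q A"
  by (simp add: bubble_field_def fun_eq_iff algebra_simps)

lemma bubble_field_zero: "bubble_field f p 0 = 0" "bubble_field f 0 A = 0"
  by (simp_all add: bubble_field_def fun_eq_iff)

lemma bubble_field_in_space:
  assumes "p \<in> extended_polys v (int k - int (card f)) f" "A \<in> span V"
  shows "bubble_field f p A \<in> bubble_space v k f V"
  using assms(2)
proof (induction rule: span_induct_alt)
  case base
  show ?case unfolding bubble_field_zero bubble_space_eq by (rule span_zero)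
next
  case (step c A B)
  then have "bubble_field f p A \<in> bubble_space v k f V"
    unfolding bubble_space_eq using assms(1) by (intro span_base) blast
  then show ?case using step(2)
    unfolding bubble_field_add_tensor bubble_field_scale_tensor bubble_space_eq
    by (intro span_add span_scale)
qed

lemma subspace_bubble_space: "subspace (bubble_space v k f V)"
  unfolding bubble_space_eq by (rule subspace_span)

text \<open>A component of a bubble field, read from one cell, is the bubble times one polynomial on
  the face, because on \<open>f\<close> the homogeneous extensions are polynomials.\<close>

lemma bubble_space_trace:
  assumes f: "is_face f" and m: "m \<le> d" "f \<subseteq> opp m" and lin: "linear \<mu>"
    and \<tau>: "\<tau> \<in> bubble_space v k f V"
  shows "\<exists>P\<in>face_polys v (int k - int (card f)) f.
    \<forall>x\<in>simplex_of v f. \<mu> (\<tau> m x) = bubble v f x * P x"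
  using \<tau> unfolding bubble_space_eq
proof (induction rule: span_induct_alt)
  case base
  show ?case using linear_0[OF lin] subspace_0[OF subspace_face_polys] by (intro bexI[of _ 0]) auto
next
  case (step c x y)
  then obtain p A P where pA: "p \<in> extended_polys v (int k - int (card f)) f" "x = bubble_field f p A"
    and P: "P \<in> face_polys v (int k - int (card f)) f" "\<forall>x\<in>simplex_of v f. \<mu> (y m x) = bubble v f x * P x"
    by blast
  obtain P' where P': "P' \<in> polys (int k - int (card f))" "\<forall>x\<in>simplex_of v f. p x = P' x"
    using extended_polys_restrict[OF f pA(1)] by blast
  define R where "R = (c * \<mu> (A m)) *\<^sub>R restrict_zero (simplex_of v f) P' + P"
  have "R \<in> face_polys v (int k - int (card f)) f"
    unfolding R_def using P(1) P'(1)
    by (intro subspace_add[OF subspace_face_polys] subspace_scale[OF subspace_face_polys])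
      (auto simp: face_polys_def)
  moreover have "\<mu> ((c *\<^sub>R x + y) m z) = bubble v f z * R z" if z: "z \<in> simplex_of v f" for z
  proof -
    have zc: "z \<in> simplex_of v (cell d m)" using z simplex_subset_cell[OF m] by blast
    have "\<mu> ((c *\<^sub>R x + y) m z) = c * (bubble v f z * p z * \<mu> (A m)) + \<mu> (y m z)"
      using zc m(1) by (simp add: linear_add[OF lin] linear_scale[OF lin] pA(2) bubble_field_def)
    then show ?thesis using z P(2) P'(2) by (simp add: R_def restrict_zero_def algebra_simps)
  qed
  ultimately show ?case by blast
qed

text \<open>The components \<open>\<mu> s\<close>, each read on its own cell \<open>ms s\<close>,
  are coordinates on the tensor space. With tensors \<open>D s\<close> dual to them every field is a
  sum of terms \<open>p s\<close> times \<open>D s\<close>, its traces on \<open>f\<close> recover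
  the \<open>p s\<close> there, and homogeneity fixes these up to the bubble factor. Letting
  \<open>ms\<close> depend on \<open>s\<close> is what allows tensors that jump between
  cells.\<close>

lemma bubble_block:
  fixes \<mu> :: "'s \<Rightarrow> real^'n^'n \<Rightarrow> real" and ms :: "'s \<Rightarrow> nat"
  assumes f: "is_face f" and fin: "finite I"
    and ms: "\<And>s. s \<in> I \<Longrightarrow> ms s \<le> d \<and> f \<subseteq> opp (ms s)"
    and lin: "\<And>s. s \<in> I \<Longrightarrow> linear (\<mu> s)"
    and inj: "\<And>A. A \<in> span V \<Longrightarrow> \<forall>s\<in>I. \<mu> s (A (ms s)) = 0 \<Longrightarrow> \<forall>m\<le>d. A m = 0"
    and surj: "\<And>a. \<exists>A\<in>span V. \<forall>s\<in>I. \<mu> s (A (ms s)) = a s"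
    and P: "\<And>s. s \<in> I \<Longrightarrow> P s \<in> face_polys v (int k - int (card f)) f"
  shows "\<exists>!\<tau>. \<tau> \<in> bubble_space v k f V \<and>
    (\<forall>s\<in>I. \<forall>x\<in>simplex_of v f. \<mu> s (\<tau> (ms s) x) = bubble v f x * P s x)"
proof -
  let ?E = "extended_polys v (int k - int (card f)) f"
  have "\<forall>s. \<exists>A\<in>span V. \<forall>s'\<in>I. \<mu> s' (A (ms s')) = (if s' = s then 1 else 0)"
    by (rule allI, rule surj)
  then obtain D where D: "\<And>s. D s \<in> span V"
    "\<And>s s'. s' \<in> I \<Longrightarrow> \<mu> s' (D s (ms s')) = (if s' = s then 1 else 0)"
    by metis
  have trace: "\<mu> s ((\<Sum>s\<in>I. bubble_field f (p s) (D s)) (ms s) x) = bubble v f x * p s x"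
    if s: "s \<in> I" and x: "x \<in> simplex_of v f" for p s x
  proof -
    have "x \<in> simplex_of v (cell d (ms s))" using x simplex_subset_cell ms[OF s] by blast
    then have "\<mu> s ((\<Sum>s\<in>I. bubble_field f (p s) (D s)) (ms s) x) =
        \<mu> s (\<Sum>s'\<in>I. (bubble v f x * p s' x) *\<^sub>R D s' (ms s))"
      using ms[OF s] by (simp add: sum_fun_eval bubble_field_def)
    also have "\<dots> = (\<Sum>s'\<in>I. (bubble v f x * p s' x) * (if s = s' then 1 else 0))"
      using D(2)[OF s] by (simp add: linear_sum[OF lin[OF s]] linear_scale[OF lin[OF s]])
    also have "\<dots> = bubble v f x * p s x" using fin s by (simp add: if_distrib[of "\<lambda>t. _ * t"] cong: if_cong)
    finally show ?thesis .
  qed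
  have expand: "\<exists>p. (\<forall>s\<in>I. p s \<in> ?E) \<and> \<tau> = (\<Sum>s\<in>I. bubble_field f (p s) (D s))"
    if "\<tau> \<in> bubble_space v k f V" for \<tau>
    using that unfolding bubble_space_eq
  proof (induction rule: span_induct_alt)
    case base
    show ?case
    proof (intro exI conjI ballI)
      show "0 \<in> ?E" by (rule subspace_0[OF subspace_extended_polys])
      show "0 = (\<Sum>s\<in>I. bubble_field f 0 (D s))" by (simp only: bubble_field_zero sum.neutral_const)
    qed
  next
    case (step c x y)
    then obtain p0 A where pA: "p0 \<in> ?E" "x = bubble_field f p0 A" "A \<in> V" by blast
    obtain p where p: "\<forall>s\<in>I. p s \<in> ?E" "y = (\<Sum>s\<in>I. bubble_field f (p s) (D s))" using step by blast
    \<comment> \<open>What is left after removing the dual tensors has no components, so it vanishes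
      on every cell by \<open>inj\<close>.\<close>
    define A' where "A' = A - (\<Sum>s\<in>I. \<mu> s (A (ms s)) *\<^sub>R D s)"
    have "A' \<in> span V" unfolding A'_def
      by (intro span_diff span_sum span_scale D(1) span_base pA(3))
    moreover have "\<mu> s (A' (ms s)) = 0" if s: "s \<in> I" for s
    proof -
      have "\<mu> s (A' (ms s)) = \<mu> s (A (ms s)) - (\<Sum>s'\<in>I. \<mu> s' (A (ms s')) * (if s = s' then 1 else 0))"
        using D(2)[OF s]
        by (simp add: A'_def sum_fun_eval linear_diff[OF lin[OF s]] linear_sum[OF lin[OF s]] linear_scale[OF lin[OF s]])
      then show ?thesis using fin s by (simp add: if_distrib[of "\<lambda>t. _ * t"] cong: if_cong)
    qed
    ultimately have "\<forall>m\<le>d. A' m = 0" using inj by blast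
    then have "bubble_field f p0 A' = 0" by (simp add: bubble_field_def fun_eq_iff)
    then have "x = bubble_field f p0 (\<Sum>s\<in>I. \<mu> s (A (ms s)) *\<^sub>R D s)"
      using bubble_field_add_tensor[of f p0 A' "\<Sum>s\<in>I. \<mu> s (A (ms s)) *\<^sub>R D s"]
      by (simp add: pA(2) A'_def)
    also have "\<dots> = (\<Sum>s\<in>I. \<mu> s (A (ms s)) *\<^sub>R bubble_field f p0 (D s))"
      using fin by (induction I)
        (simp_all only: sum.empty sum.insert not_False_eq_True bubble_field_zero bubble_field_add_tensor bubble_field_scale_tensor)
    finally have x: "x = (\<Sum>s\<in>I. \<mu> s (A (ms s)) *\<^sub>R bubble_field f p0 (D s))" .
    have "c *\<^sub>R x + y = (\<Sum>s\<in>I. bubble_field f ((c * \<mu> s (A (ms s))) *\<^sub>R p0 + p s) (D s))"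
      by (simp only: x p(2) bubble_field_lincomb sum.distrib scaleR_sum_right scaleR_scaleR)
    moreover have "\<forall>s\<in>I. (c * \<mu> s (A (ms s))) *\<^sub>R p0 + p s \<in> ?E"
      using p(1) pA(1) by (auto intro!: subspace_add[OF subspace_extended_polys] subspace_scale[OF subspace_extended_polys])
    ultimately show ?case by (intro exI[of _ "\<lambda>s. (c * \<mu> s (A (ms s))) *\<^sub>R p0 + p s"]) blast
  qed
  have "\<forall>s\<in>I. \<exists>p\<in>?E. \<forall>x\<in>simplex_of v f. p x = P s x"
  proof
    fix s assume "s \<in> I"
    then obtain p where "p \<in> polys (int k - int (card f))" "P s = restrict_zero (simplex_of v f) p"
      using P by (auto simp: face_polys_def)
    then show "\<exists>p\<in>?E. \<forall>x\<in>simplex_of v f. p x = P s x"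
      using extended_polys_extend[OF f, of p] by (simp add: restrict_zero_def)
  qed
  then obtain p where p: "\<forall>s\<in>I. p s \<in> ?E" "\<forall>s\<in>I. \<forall>x\<in>simplex_of v f. p s x = P s x" by metis
  show ?thesis
  proof (rule ex1I[of _ "\<Sum>s\<in>I. bubble_field f (p s) (D s)"])
    have "(\<Sum>s\<in>I. bubble_field f (p s) (D s)) \<in> bubble_space v k f V"
      using p(1) D(1) by (intro subspace_sum[OF subspace_bubble_space] bubble_field_in_space) auto
    then show "(\<Sum>s\<in>I. bubble_field f (p s) (D s)) \<in> bubble_space v k f V \<and> (\<forall>s\<in>I. \<forall>x\<in>simplex_of v f.
        \<mu> s ((\<Sum>s\<in>I. bubble_field f (p s) (D s)) (ms s) x) = bubble v f x * P s x)"
      using trace p(2) by simp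
  next
    fix \<tau> assume \<tau>: "\<tau> \<in> bubble_space v k f V \<and>
      (\<forall>s\<in>I. \<forall>x\<in>simplex_of v f. \<mu> s (\<tau> (ms s) x) = bubble v f x * P s x)"
    then obtain q where q: "\<forall>s\<in>I. q s \<in> ?E" "\<tau> = (\<Sum>s\<in>I. bubble_field f (q s) (D s))"
      using expand by blast
    have "bubble_field f (q s) (D s) = bubble_field f (p s) (D s)" if s: "s \<in> I" for s
    proof -
      have diff: "q s - p s \<in> ?E"
        using q(1) p(1) s subspace_diff[OF subspace_extended_polys] by blast
      \<comment> \<open>Agreement in the relative interior of \<open>f\<close> spreads to all points
        by central projection onto \<open>f\<close>.\<close>
      have "bubble v f x * (q s - p s) x = 0" for x
      proof (rule bubble_mult_eq_zero[OF f diff])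
        fix y assume y: "y \<in> simplex_of v f" "\<forall>i\<in>f. 0 < hat v i y"
        have "bubble v f y * q s y = bubble v f y * P s y"
          using trace[OF s y(1), of q] \<tau> s y(1) unfolding q(2) by auto
        moreover have "bubble v f y \<noteq> 0" using bubble_pos_iff[OF f] y(2) by blast
        ultimately show "(q s - p s) y = 0" using p(2) s y(1) by simp
      qed
      then have "bubble v f x * q s x = bubble v f x * p s x" for x by (simp add: algebra_simps)
      then show ?thesis by (simp add: bubble_field_def fun_eq_iff)
    qed
    then show "\<tau> = (\<Sum>s\<in>I. bubble_field f (p s) (D s))" using q(2) by simp
  qed
qed

text \<open>The moments of a trace against the test basis determine its polynomial factor by the
  weighted Gram system, and the polynomial factors determine the field by \<open>block\<close>. So
  the moment conditions are equivalent to prescribed traces.\<close>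

lemma bubble_moments:
  fixes L :: "'s \<Rightarrow> 'n pw_field \<Rightarrow> real^'n \<Rightarrow> 'b::euclidean_space"
  assumes f: "is_face f" and Q: "basis_of Q W" "finite Q"
    and cont: "\<And>p. p \<in> W \<Longrightarrow> continuous_on (simplex_of v f) p"
    and out: "\<And>p x. p \<in> W \<Longrightarrow> x \<notin> simplex_of v f \<Longrightarrow> p x = 0"
    and trace: "\<And>\<tau> s. \<tau> \<in> S \<Longrightarrow> s \<in> I \<Longrightarrow> \<exists>P\<in>W. \<forall>x\<in>simplex_of v f. L s \<tau> x = bubble v f x *\<^sub>R P x"
    and block: "\<And>P. (\<And>s. s \<in> I \<Longrightarrow> P s \<in> W) \<Longrightarrow>
      \<exists>!\<tau>. \<tau> \<in> S \<and> (\<forall>s\<in>I. \<forall>x\<in>simplex_of v f. L s \<tau> x = bubble v f x *\<^sub>R P s x)"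
  shows "\<exists>!\<tau>. \<tau> \<in> S \<and> (\<forall>s\<in>I. \<forall>q\<in>Q. face_integral v f (\<lambda>x. L s \<tau> x \<bullet> q x) = a s q)"
proof -
  define G where "G a p \<longleftrightarrow> p \<in> W \<and> (\<forall>q\<in>Q. face_integral v f (\<lambda>x. bubble v f x * (p x \<bullet> q x)) = a q)" for a p
  have gram: "\<exists>!p. G a p" for a
    unfolding G_def by (rule weighted_gram) (fact f Q cont out)+
  define P where "P s = (THE p. G (a s) p)" for s
  have P: "G (a s) (P s)" for s unfolding P_def by (rule theI'[OF gram])
  have PW: "P s \<in> W" for s using P[of s] by (simp add: G_def)
  let ?T = "\<lambda>\<tau>. \<tau> \<in> S \<and> (\<forall>s\<in>I. \<forall>x\<in>simplex_of v f. L s \<tau> x = bubble v f x *\<^sub>R P s x)"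
  have ex1: "\<exists>!\<tau>. ?T \<tau>" by (rule block[OF PW])
  have dof: "face_integral v f (\<lambda>x. L s \<tau> x \<bullet> q x) = face_integral v f (\<lambda>x. bubble v f x * (R x \<bullet> q x))"
    if "\<forall>x\<in>simplex_of v f. L s \<tau> x = bubble v f x *\<^sub>R R x" for \<tau> R s q
    by (rule face_integral_cong) (simp add: that)
  have "?T \<tau> \<longleftrightarrow> \<tau> \<in> S \<and> (\<forall>s\<in>I. \<forall>q\<in>Q. face_integral v f (\<lambda>x. L s \<tau> x \<bullet> q x) = a s q)" for \<tau>
  proof (intro iffI conjI ballI; elim conjE)
    fix s q assume "s \<in> I" "q \<in> Q" "\<forall>s\<in>I. \<forall>x\<in>simplex_of v f. L s \<tau> x = bubble v f x *\<^sub>R P s x"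
    then show "face_integral v f (\<lambda>x. L s \<tau> x \<bullet> q x) = a s q"
      using dof[of s \<tau> "P s" q] P[of s] by (simp add: G_def)
  next
    fix s x assume s: "s \<in> I" and x: "x \<in> simplex_of v f" and \<tau>: "\<tau> \<in> S"
      "\<forall>s\<in>I. \<forall>q\<in>Q. face_integral v f (\<lambda>x. L s \<tau> x \<bullet> q x) = a s q"
    obtain R where R: "R \<in> W" "\<forall>x\<in>simplex_of v f. L s \<tau> x = bubble v f x *\<^sub>R R x"
      using trace[OF \<tau>(1) s] by blast
    have "G (a s) R" unfolding G_def using R(1) dof[OF R(2), symmetric] \<tau>(2) s by simp
    then have "R = P s" using gram[of "a s"] P[of s] by blast
    then show "L s \<tau> x = bubble v f x *\<^sub>R P s x" using R(2) x by simp
  qed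
  then show ?thesis using ex1 by simp
qed

lemma scalar_block:
  fixes \<mu> :: "'s \<Rightarrow> real^'n^'n \<Rightarrow> real" and ms :: "'s \<Rightarrow> nat"
  assumes f: "is_face f" and fin: "finite I"
    and ms: "\<And>s. s \<in> I \<Longrightarrow> ms s \<le> d \<and> f \<subseteq> opp (ms s)"
    and lin: "\<And>s. s \<in> I \<Longrightarrow> linear (\<mu> s)"
    and inj: "\<And>A. A \<in> span V \<Longrightarrow> \<forall>s\<in>I. \<mu> s (A (ms s)) = 0 \<Longrightarrow> \<forall>m\<le>d. A m = 0"
    and surj: "\<And>a. \<exists>A\<in>span V. \<forall>s\<in>I. \<mu> s (A (ms s)) = a s"
    and Q: "basis_of Q (face_polys v (int k - int (card f)) f)"
  shows "\<exists>!\<tau>. \<tau> \<in> bubble_space v k f V \<and>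
    (\<forall>s\<in>I. \<forall>q\<in>Q. face_integral v f (\<lambda>x. \<mu> s (\<tau> (ms s) x) * q x) = a s q)"
proof -
  let ?W = "face_polys v (int k - int (card f)) f"
  have "\<exists>!\<tau>. \<tau> \<in> bubble_space v k f V \<and>
    (\<forall>s\<in>I. \<forall>q\<in>Q. face_integral v f (\<lambda>x. \<mu> s (\<tau> (ms s) x) \<bullet> q x) = a s q)"
  proof (rule bubble_moments[where L = "\<lambda>s \<tau> x. \<mu> s (\<tau> (ms s) x)", OF f Q finite_basis_face_polys[OF Q]])
    show "\<exists>P\<in>?W. \<forall>x\<in>simplex_of v f. \<mu> s (\<tau> (ms s) x) = bubble v f x *\<^sub>R P x"
      if "\<tau> \<in> bubble_space v k f V" "s \<in> I" for \<tau> s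
      using bubble_space_trace[OF f conjunct1[OF ms] conjunct2[OF ms] lin, OF that(2,2,2,1)] by simp
    show "\<exists>!\<tau>. \<tau> \<in> bubble_space v k f V \<and>
        (\<forall>s\<in>I. \<forall>x\<in>simplex_of v f. \<mu> s (\<tau> (ms s) x) = bubble v f x *\<^sub>R P s x)"
      if "\<And>s. s \<in> I \<Longrightarrow> P s \<in> ?W" for P
      unfolding real_scaleR_def by (rule bubble_block[OF f fin ms lin inj surj that])
  qed (auto intro: continuous_on_face_polys face_polys_outside)
  then show ?thesis unfolding inner_real_def .
qed

text \<open>A basis of the vector-valued polynomials need not split into components, so the moments
  are taken in the vector-valued space. The tensors, however, are treated componentwise, with pairs
  of an index and a coordinate as component labels.\<close>

lemma vector_block:
  fixes ms :: "'s \<Rightarrow> nat" and nn :: "'s \<Rightarrow> real^'n"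
  assumes f: "is_face f" and fin: "finite I"
    and ms: "\<And>s. s \<in> I \<Longrightarrow> ms s \<le> d \<and> f \<subseteq> opp (ms s)"
    and inj: "\<And>A. A \<in> span V \<Longrightarrow> \<forall>s\<in>I. A (ms s) *v nn s = 0 \<Longrightarrow> \<forall>m\<le>d. A m = 0"
    and surj: "\<And>w. \<exists>A\<in>span V. \<forall>s\<in>I. A (ms s) *v nn s = w s"
    and Q: "basis_of Q (face_vec_polys v (int k - int (card f)) f)"
  shows "\<exists>!\<tau>. \<tau> \<in> bubble_space v k f V \<and>
    (\<forall>s\<in>I. \<forall>q\<in>Q. face_integral v f (\<lambda>x. (\<tau> (ms s) x *v nn s) \<bullet> q x) = a s q)"
proof -
  let ?W = "face_vec_polys v (int k - int (card f)) f" and ?w = "face_polys v (int k - int (card f)) f"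
  define \<mu> where "\<mu> = (\<lambda>(s :: 's, i :: 'n) (A :: real^'n^'n). (A *v nn s) $ i)"
  have lin: "linear (\<mu> s)" for s
    by (cases s) (auto simp: \<mu>_def matrix_vector_mult_add_rdistrib
        scaleR_matrix_vector_assoc[symmetric] intro!: linearI)
  show ?thesis
  proof (rule bubble_moments[where L = "\<lambda>s \<tau> x. \<tau> (ms s) x *v nn s", OF f Q finite_basis_face_vec_polys[OF Q]])
    fix p assume p: "p \<in> ?W"
    have "continuous_on (simplex_of v f) (\<lambda>x. \<chi> i. p x $ i)"
      by (rule continuous_on_vec_lambda) (use p in \<open>auto simp: face_vec_polys_def intro: continuous_on_face_polys\<close>)
    then show "continuous_on (simplex_of v f) p" by simp
    show "p x = 0" if "x \<notin> simplex_of v f" for x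
    proof -
      have "(\<lambda>x. p x $ i) \<in> ?w" for i using p by (simp add: face_vec_polys_def)
      from face_polys_outside[OF this that] have "p x $ i = 0" for i .
      then show ?thesis by (simp add: vec_eq_iff)
    qed
  next
    fix P assume P: "\<And>s. s \<in> I \<Longrightarrow> P s \<in> ?W"
    have "\<exists>!\<tau>. \<tau> \<in> bubble_space v k f V \<and> (\<forall>s\<in>I \<times> UNIV. \<forall>x\<in>simplex_of v f.
        \<mu> s (\<tau> (ms (fst s)) x) = bubble v f x * (\<lambda>x. P (fst s) x $ snd s) x)"
    proof (rule bubble_block[OF f])
      show "\<forall>m\<le>d. A m = 0" if "A \<in> span V" "\<forall>s\<in>I \<times> UNIV. \<mu> s (A (ms (fst s))) = 0" for A
        by (rule inj[OF that(1)]) (use that(2) in \<open>auto simp: \<mu>_def vec_eq_iff\<close>)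
      show "\<exists>A\<in>span V. \<forall>s\<in>I \<times> UNIV. \<mu> s (A (ms (fst s))) = a s" for a
      proof -
        obtain A where "A \<in> span V" "\<forall>s\<in>I. A (ms s) *v nn s = (\<chi> i. a (s, i))"
          using surj[of "\<lambda>s. \<chi> i. a (s, i)"] by blast
        then show ?thesis by (intro bexI[of _ A]) (auto simp: \<mu>_def)
      qed
      show "ms (fst s) \<le> d \<and> f \<subseteq> opp (ms (fst s))" if "s \<in> I \<times> UNIV" for s :: "'s \<times> 'n"
        using ms[of "fst s"] that by auto
    qed (use P lin fin in \<open>auto simp: face_vec_polys_def\<close>)
    then show "\<exists>!\<tau>. \<tau> \<in> bubble_space v k f V \<and>
        (\<forall>s\<in>I. \<forall>x\<in>simplex_of v f. \<tau> (ms s) x *v nn s = bubble v f x *\<^sub>R P s x)"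
    proof (rule back_subst[of Ex1], intro ext)
      fix \<tau>
      show "(\<tau> \<in> bubble_space v k f V \<and> (\<forall>s\<in>I \<times> UNIV. \<forall>x\<in>simplex_of v f.
          \<mu> s (\<tau> (ms (fst s)) x) = bubble v f x * (\<lambda>x. P (fst s) x $ snd s) x)) \<longleftrightarrow>
        \<tau> \<in> bubble_space v k f V \<and>
        (\<forall>s\<in>I. \<forall>x\<in>simplex_of v f. \<tau> (ms s) x *v nn s = bubble v f x *\<^sub>R P s x)"
        by (auto simp: \<mu>_def vec_eq_iff)
    qed
  next
    fix \<tau> s assume \<tau>: "\<tau> \<in> bubble_space v k f V" and s: "s \<in> I"
    have "\<exists>r\<in>?w. \<forall>x\<in>simplex_of v f. \<mu> (s, i) (\<tau> (ms s) x) = bubble v f x * r x" for i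
      using bubble_space_trace[OF f _ _ lin \<tau>] ms[OF s] by simp
    then obtain r where "\<And>i. r i \<in> ?w" "\<And>i. \<forall>x\<in>simplex_of v f. \<mu> (s, i) (\<tau> (ms s) x) = bubble v f x * r i x"
      by metis
    then show "\<exists>R\<in>?W. \<forall>x\<in>simplex_of v f. \<tau> (ms s) x *v nn s = bubble v f x *\<^sub>R R x"
      by (intro bexI[of _ "\<lambda>x. \<chi> i. r i x"]) (auto simp: face_vec_polys_def vec_eq_iff \<mu>_def)
  qed
qed

end

section \<open>Tensors and face normals\<close>

lemma sum_delta2:
  assumes "finite A" "k \<in> A" "l \<in> A"
  shows "(\<Sum>i\<in>A. \<Sum>j\<in>A. if i = k then if j = l then c i j else 0 else 0) = c k l"
proof -
  have "(\<Sum>j\<in>A. if i = k then if j = l then c i j else 0 else 0) = (if i = k then c i l else 0)" for i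
    using assms by simp
  then show ?thesis using assms by simp
qed

lemma outer_mult_vec: "outer a b *v x = (b \<bullet> x) *\<^sub>R a"
  by (simp add: outer_def matrix_vector_mult_def vec_eq_iff inner_vec_def sum_distrib_left mult_ac)

lemma transpose_outer: "transpose (outer a b) = outer b a"
  by (simp add: outer_def transpose_def vec_eq_iff mult.commute)

lemma symt_outer_mult_vec:
  "symt (outer a b) *v x = (1/2) *\<^sub>R ((b \<bullet> x) *\<^sub>R a + (a \<bullet> x) *\<^sub>R b)"
  by (simp add: symt_def transpose_outer matrix_vector_mult_add_rdistrib scaleR_matrix_vector_assoc[symmetric] outer_mult_vec)

lemma transpose_symt_outer: "transpose (symt (outer a b)) = symt (outer a b)"
  by (simp add: symt_def transpose_def outer_def vec_eq_iff)

lemma inner_outer: "A \<bullet> outer a b = a \<bullet> (A *v b)"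
  by (simp add: outer_def inner_vec_def matrix_vector_mult_def sum_distrib_left algebra_simps)

lemma inner_symt_outer: "A \<bullet> symt (outer a b) = (1/2) * (a \<bullet> (A *v b) + b \<bullet> (A *v a))"
  by (simp add: symt_def transpose_outer inner_add_right inner_outer)

lemma symmetric_form:
  fixes A :: "real^'n^'n"
  assumes "transpose A = A"
  shows "x \<bullet> (A *v y) = y \<bullet> (A *v x)"
proof -
  have "x \<bullet> (A *v y) = (transpose A *v x) \<bullet> y" by (simp only: transpose_matrix_vector dot_lmul_matrix)
  then show ?thesis using assms by (simp add: inner_commute)
qed

text \<open>The standard way below to show that a tensor vanishes: test it against the generators of
  the space that contains it.\<close>

lemma span_self_orthogonal:
  fixes A :: "'a::real_inner"
  assumes "A \<in> span G" "\<And>g. g \<in> G \<Longrightarrow> A \<bullet> g = 0"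
  shows "A = 0"
  using orthogonal_to_span[OF assms(1), of A] assms(2) by (simp add: orthogonal_def)

lemma linear_symt_outer_left: "linear (\<lambda>a. symt (outer a b))"
  by (rule linearI) (simp_all add: symt_def outer_def transpose_def vec_eq_iff algebra_simps)

lemma linear_symt_outer_right: "linear (\<lambda>b. symt (outer a b))"
  by (rule linearI) (simp_all add: symt_def outer_def transpose_def vec_eq_iff algebra_simps)

lemma transpose_of_span:
  assumes "A \<in> span G" "\<And>g. g \<in> G \<Longrightarrow> transpose g = g"
  shows "transpose A = (A :: real^'n^'n)"
  using assms(1)
proof (induction rule: span_induct_alt)
  case base
  show ?case by (simp add: transpose_def vec_eq_iff)
next
  case (step c x y)
  then have "transpose x = x" using assms(2) by blast
  then show ?case using step by (simp add: transpose_def vec_eq_iff)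
qed

lemma span_constant_tensors: "span (constant_tensors V) = constant_tensors (span V)"
  unfolding constant_tensors_def
  by (rule linear_span_image, rule linearI) (simp_all add: fun_eq_iff)

lemma indexed_basis_gram:
  fixes b :: "nat \<Rightarrow> real^'n"
  assumes "indexed_basis_of b I V" "finite I"
  shows "\<exists>w\<in>V. \<forall>i\<in>I. w \<bullet> b i = a i"
    and "u \<in> V \<Longrightarrow> \<forall>i\<in>I. u \<bullet> b i = 0 \<Longrightarrow> u = 0"
proof -
  have b: "inj_on b I" "independent (b ` I)" "span (b ` I) = V"
    using assms(1) by (auto simp: indexed_basis_of_def basis_of_def)
  have "\<exists>w\<in>span (b ` I). \<forall>q\<in>b ` I. w \<bullet> q = a (inv_into I b q)"
    by (rule gram_solve_exists[where B = inner, OF _ _ inner_add_left inner_scaleR_left inner_commute])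
      (use assms(2) b in auto)
  then show "\<exists>w\<in>V. \<forall>i\<in>I. w \<bullet> b i = a i" using b by (auto simp: inv_into_f_f)
  show "u \<in> V \<Longrightarrow> \<forall>i\<in>I. u \<bullet> b i = 0 \<Longrightarrow> u = 0"
    using span_self_orthogonal[of u "b ` I"] b(3) by auto
qed

text \<open>By bilinearity the form of \<open>A\<close> vanishes on all of \<open>V\<close>, so
  \<open>A\<close> is orthogonal to the symmetric products that span its own space.\<close>

lemma sym_tensor_normal_eq_zero:
  fixes A :: "real^'n^'n"
  assumes A: "A \<in> sym_tensor V V" and b: "span (b ` I) = V"
    and zero: "\<And>i j. i \<in> I \<Longrightarrow> j \<in> I \<Longrightarrow> b i \<bullet> (A *v b j) = 0"
  shows "A = 0"
proof (rule span_self_orthogonal)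
  show "A \<in> span {symt (outer a b) |a b. a \<in> V \<and> b \<in> V}" using A by (simp add: sym_tensor_def)
  have lin: "linear (\<lambda>x. x \<bullet> (A *v y))" "linear (\<lambda>y. x \<bullet> (A *v y))" for x y
    by (auto intro!: linearI simp: inner_add_left matrix_vector_right_distrib inner_add_right
        matrix_vector_mult_scaleR)
  have 1: "x \<bullet> (A *v b j) = 0" if "x \<in> V" "j \<in> I" for x j
    using linear_eq_0_on_span[OF lin(1), of "b ` I" "b j" x] zero that b by auto
  have 2: "x \<bullet> (A *v y) = 0" if "x \<in> V" "y \<in> V" for x y
    using linear_eq_0_on_span[OF lin(2), of "b ` I" x y] 1 that b by auto
  fix g assume "g \<in> {symt (outer a b) |a b. a \<in> V \<and> b \<in> V}"
  then show "A \<bullet> g = 0" using 2 by (auto simp: inner_symt_outer)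
qed

section \<open>Facet normals as bases of the normal spaces\<close>

locale split_normals = simplex_split v d for v :: "nat \<Rightarrow> real^'n" and d +
  fixes nrm :: "nat set \<Rightarrow> real^'n"
  assumes nrm: "\<And>F. F \<in> R_simplices d (d - 1) \<Longrightarrow> norm (nrm F) = 1 \<and> nrm F \<in> normal_vectors v F"
begin

text \<open>Normal of the facet opposite to node \<open>i\<close> in the simplex on
  \<open>opp m\<close>: a boundary facet F_i if \<open>m = Suc d\<close>, a facet of the cell T_m
  otherwise. The set \<open>opp m - {i}\<close> is symmetric in its two indices, so simplices
  sharing a facet share its normal.\<close>

abbreviation nv :: "nat \<Rightarrow> nat \<Rightarrow> real^'n" where
  "nv m i \<equiv> nrm (opp m - {i})"

lemma facet_in_R:
  assumes "m \<le> Suc d" "i \<in> opp m"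
  shows "opp m - {i} \<in> R_simplices d (d - 1)"
proof -
  have *: "opp m - {i} \<in> subsimplices (d - 1) (cell d m)" if "m \<le> d" "i \<in> opp m" for m i
    using that d_pos card_opp[of m] by (auto simp: subsimplices_def cell_eq_opp)
  show ?thesis
  proof (cases "m \<le> d")
    case True
    then show ?thesis using * assms by (auto simp: R_simplices_def)
  next
    case False
    then have "i \<le> d" "m \<in> opp i" "opp m - {i} = opp i - {m}" using assms by (auto simp: opp_def)
    then show ?thesis using *[of i m] by (auto simp: R_simplices_def)
  qed
qed

lemma nv_edge_zero:
  assumes "m \<le> Suc d" "i \<in> opp m" "j \<in> opp m" "z \<in> opp m" "j \<noteq> i" "z \<noteq> i"
  shows "nv m i \<bullet> (node v j - node v z) = 0"
  using nrm[OF facet_in_R[OF assms(1,2)]] normal_vectors_iff[of z "opp m - {i}" "nv m i" v] assms by auto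

lemma nv_edge_nonzero:
  assumes "m \<le> Suc d" "i \<in> opp m" "z \<in> opp m" "z \<noteq> i"
  shows "nv m i \<bullet> (node v i - node v z) \<noteq> 0"
proof
  assume 0: "nv m i \<bullet> (node v i - node v z) = 0"
  have "nv m i \<bullet> (node v j - node v z) = 0" if "j \<in> opp m" for j
    using 0 nv_edge_zero[OF assms(1,2) that assms(3) _ assms(4)] by (cases "j = i") auto
  then have "nv m i = 0" by (rule eq_zero_if_orth_edges[OF assms(1,3)])
  then show False using nrm[OF facet_in_R[OF assms(1,2)]] by simp
qed

lemma nv_normal:
  assumes "m \<le> Suc d" "f \<subseteq> opp m" "i \<in> opp m - f"
  shows "nv m i \<in> normal_vectors v f"
  using nrm[OF facet_in_R[of m i]] normal_vectors_mono[of f "opp m - {i}" v] assms by blast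

text \<open>The normal \<open>nv m i\<close> is orthogonal to all edges from \<open>z\<close> but
  the one to node \<open>i\<close>. Pairing with the edges therefore reads off the coefficients, and
  an equality can be checked on the edges.\<close>

lemma normal_expansion:
  assumes m: "m \<le> Suc d" and f: "f \<subseteq> opp m" "f \<noteq> {}" and u: "u \<in> normal_vectors v f"
  shows "\<exists>c. u = (\<Sum>i\<in>opp m - f. c i *\<^sub>R nv m i)"
proof -
  obtain z where z: "z \<in> f" using f by blast
  let ?e = "\<lambda>i. node v i - node v z"
  define c where "c i = (u \<bullet> ?e i) / (nv m i \<bullet> ?e i)" for i
  have "u - (\<Sum>i\<in>opp m - f. c i *\<^sub>R nv m i) = 0"
  proof (rule eq_zero_if_orth_edges[OF m, of z])
    show "z \<in> opp m" using z f by blast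
    fix j assume j: "j \<in> opp m"
    have "(\<Sum>i\<in>opp m - f. c i *\<^sub>R nv m i) \<bullet> ?e j = (\<Sum>i\<in>opp m - f. c i * (nv m i \<bullet> ?e j))"
      by (simp add: inner_sum_left)
    also have "\<dots> = (\<Sum>i\<in>opp m - f. if i = j then u \<bullet> ?e j else 0)"
    proof (rule sum.cong[OF refl])
      fix i assume i: "i \<in> opp m - f"
      then have iz: "z \<noteq> i" "z \<in> opp m" "i \<in> opp m" using z f by auto
      show "c i * (nv m i \<bullet> ?e j) = (if i = j then u \<bullet> ?e j else 0)"
        using nv_edge_zero[OF m iz(3) j iz(2) _ iz(1)] nv_edge_nonzero[OF m iz(3,2,1)]
        by (cases "i = j") (auto simp: c_def)
    qed
    also have "\<dots> = (if j \<in> f then 0 else u \<bullet> ?e j)" using j by auto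
    also have "\<dots> = u \<bullet> ?e j" using u normal_vectors_iff[OF z] by auto
    finally show "(u - (\<Sum>i\<in>opp m - f. c i *\<^sub>R nv m i)) \<bullet> ?e j = 0" by (simp add: inner_diff_left)
  qed
  then show ?thesis by (intro exI[of _ c]) simp
qed

lemma normal_eq_zero:
  assumes "m \<le> Suc d" "f \<subseteq> opp m" "f \<noteq> {}" "u \<in> normal_vectors v f"
    and "\<And>i. i \<in> opp m - f \<Longrightarrow> u \<bullet> nv m i = 0"
  shows "u = 0"
proof -
  obtain c where "u = (\<Sum>i\<in>opp m - f. c i *\<^sub>R nv m i)" using normal_expansion[OF assms(1-4)] by blast
  then have "u \<bullet> u = (\<Sum>i\<in>opp m - f. c i * (u \<bullet> nv m i))" by (metis (no_types, lifting) inner_scaleR_right inner_sum_right sum.cong)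
  then show ?thesis using assms(5) by simp
qed

text \<open>The edges from a node of \<open>f\<close> form, up to scaling, a dual system to the
  facet normals. These are therefore independent, and the Gram system prescribes all
  products.\<close>

lemma normal_dual:
  assumes m: "m \<le> Suc d" and f: "f \<subseteq> opp m" "f \<noteq> {}"
  shows "\<exists>w\<in>normal_vectors v f. \<forall>i\<in>opp m - f. w \<bullet> nv m i = a i"
proof -
  obtain z where z: "z \<in> f" using f by blast
  let ?e = "\<lambda>i. node v i - node v z" and ?J = "opp m - f"
  have dual: "nv m i \<bullet> ?e j = 0 \<longleftrightarrow> i \<noteq> j" if "i \<in> ?J" "j \<in> ?J" for i j
    using nv_edge_zero[OF m, of i j z] nv_edge_nonzero[OF m, of i z] that z f by auto
  have inj: "inj_on (nv m) ?J" by (rule inj_onI) (metis dual)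
  have "independent (nv m ` ?J)"
  proof (rule independent_if_scalars_zero)
    fix F x assume F: "(\<Sum>x\<in>nv m ` ?J. F x *\<^sub>R x) = 0" and "x \<in> nv m ` ?J"
    then obtain j where j: "j \<in> ?J" "x = nv m j" by blast
    have "0 = (\<Sum>i\<in>?J. F (nv m i) *\<^sub>R nv m i) \<bullet> ?e j" using F by (simp add: sum.reindex[OF inj])
    also have "\<dots> = (\<Sum>i\<in>?J. F (nv m i) * (nv m i \<bullet> ?e j))" by (simp add: inner_sum_left)
    also have "\<dots> = (\<Sum>i\<in>?J. if i = j then F x * (x \<bullet> ?e j) else 0)"
      by (rule sum.cong) (use dual j in auto)
    also have "\<dots> = F x * (x \<bullet> ?e j)" using j by simp
    finally show "F x = 0" using dual[OF j(1) j(1)] j(2) by simp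
  qed simp
  then have "indexed_basis_of (nv m) ?J (span (nv m ` ?J))"
    using inj by (simp add: indexed_basis_of_def basis_of_def)
  then obtain w where "w \<in> span (nv m ` ?J)" "\<forall>i\<in>?J. w \<bullet> nv m i = a i"
    using indexed_basis_gram(1)[of "nv m" ?J _ a] by auto
  moreover have "span (nv m ` ?J) \<subseteq> normal_vectors v f"
    by (rule span_minimal[OF _ subspace_normal_vectors]) (use nv_normal[OF m f(1)] in auto)
  ultimately show ?thesis by blast
qed

lemma subsimplices_facet_iff:
  assumes "m \<le> d"
  shows "G \<in> subsimplices (d - 1) (cell d m) \<longleftrightarrow> (\<exists>i\<in>opp m. G = opp m - {i})"
proof
  assume "G \<in> subsimplices (d - 1) (cell d m)"
  then have G: "G \<subseteq> opp m" "card G = d" using d_pos by (auto simp: subsimplices_def cell_eq_opp[OF assms])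
  have "card (opp m - G) = 1"
    using G card_opp[of m] assms by (simp add: card_Diff_subset finite_subset[OF G(1)])
  then obtain i where "opp m - G = {i}" using card_1_singletonE by blast
  then show "\<exists>i\<in>opp m. G = opp m - {i}" using G(1) by (intro bexI[of _ i]) auto
next
  assume "\<exists>i\<in>opp m. G = opp m - {i}"
  then show "G \<in> subsimplices (d - 1) (cell d m)"
    using assms d_pos card_opp[of m] by (auto simp: subsimplices_def cell_eq_opp)
qed

text \<open>The facets of T_m that contain \<open>f\<close> are those opposite to the nodes outside
  \<open>f\<close>. The description under \<open>THE\<close> thus asks for a member of the basis
  dual to the facet normals, which exists by \<open>normal_dual\<close> and is unique by
  \<open>normal_eq_zero\<close>.\<close>

lemma dual_normal:
  assumes m: "m \<le> d" and f: "f \<noteq> {}" "f \<subseteq> opp m" "j \<in> opp m - f"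
  shows "dual_normal v nrm (opp m - {j}) f m \<in> normal_vectors v f"
    and "i \<in> opp m - f \<Longrightarrow> dual_normal v nrm (opp m - {j}) f m \<bullet> nv m i = (if i = j then 1 else 0)"
proof -
  let ?F = "opp m - {j}"
  have m': "m \<le> Suc d" using m by simp
  define P where "P w \<longleftrightarrow> w \<in> normal_vectors v f \<and> w \<bullet> nrm ?F = 1 \<and>
    (\<forall>G \<in> subsimplices (CARD('n) - 1) (cell CARD('n) m). f \<subseteq> G \<and> G \<noteq> ?F \<longrightarrow> w \<bullet> nrm G = 0)" for w
  have P_iff: "P w \<longleftrightarrow> w \<in> normal_vectors v f \<and> (\<forall>i\<in>opp m - f. w \<bullet> nv m i = (if i = j then 1 else 0))" for w
  proof
    assume P: "P w"
    have "w \<bullet> nv m i = (if i = j then 1 else 0)" if i: "i \<in> opp m - f" for i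
    proof (cases "i = j")
      case False
      then have "opp m - {i} \<noteq> ?F" using i f by auto
      moreover have "opp m - {i} \<in> subsimplices (CARD('n) - 1) (cell CARD('n) m)"
        unfolding dim[symmetric] subsimplices_facet_iff[OF m] using i by blast
      moreover have "f \<subseteq> opp m - {i}" using i f by auto
      ultimately show ?thesis using P False unfolding P_def by simp
    qed (use P P_def in simp)
    then show "w \<in> normal_vectors v f \<and> (\<forall>i\<in>opp m - f. w \<bullet> nv m i = (if i = j then 1 else 0))"
      using P by (simp add: P_def)
  next
    assume w: "w \<in> normal_vectors v f \<and> (\<forall>i\<in>opp m - f. w \<bullet> nv m i = (if i = j then 1 else 0))"
    show "P w"
      unfolding P_def dim[symmetric]
    proof (intro conjI ballI impI)
      fix G assume "G \<in> subsimplices (d - 1) (cell d m)" and G: "f \<subseteq> G \<and> G \<noteq> ?F"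
      then obtain i where i: "i \<in> opp m" "G = opp m - {i}" unfolding subsimplices_facet_iff[OF m] by blast
      then have "i \<in> opp m - f" "i \<noteq> j" using G by auto
      then show "w \<bullet> nrm G = 0" using w i by simp
    qed (use w f in auto)
  qed
  have "\<exists>!w. P w"
  proof (rule ex_ex1I)
    show "\<exists>w. P w" using normal_dual[OF m' f(2,1), of "\<lambda>i. if i = j then 1 else 0"] unfolding P_iff by blast
  next
    fix w w' assume "P w" "P w'"
    then have ww: "w - w' \<in> normal_vectors v f" "\<And>i. i \<in> opp m - f \<Longrightarrow> (w - w') \<bullet> nv m i = 0"
      unfolding P_iff by (auto simp: inner_diff_left intro: subspace_diff[OF subspace_normal_vectors])
    show "w = w'" using normal_eq_zero[OF m' f(2,1) ww] by simp
  qed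
  then have "P (THE w. P w)" by (rule theI')
  moreover have "dual_normal v nrm ?F f m = (THE w. P w)" unfolding dual_normal_def P_def ..
  ultimately have D: "P (dual_normal v nrm ?F f m)" by simp
  show "dual_normal v nrm ?F f m \<in> normal_vectors v f" using D unfolding P_iff by blast
  show "i \<in> opp m - f \<Longrightarrow> dual_normal v nrm ?F f m \<bullet> nv m i = (if i = j then 1 else 0)"
    using D unfolding P_iff by blast
qed

text \<open>A symmetric form on the normal space is given by its values on pairs
  \<open>i \<le> j\<close> of basis vectors, and these values are free. The tensors are constant, so
  any cell containing \<open>f\<close> may be used for the trace.\<close>

lemma interior_normal_block:
  assumes f: "is_face f" and m: "m \<le> d" "f \<subseteq> opp m"
    and nb: "indexed_basis_of nb {1..N} (normal_vectors v f)"
    and Q: "basis_of Q (face_polys v (int k - int (card f)) f)"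
  shows "\<exists>!\<tau>. \<tau> \<in> bubble_space v k f (constant_tensors (sym_tensor (normal_vectors v f) (normal_vectors v f))) \<and>
    (\<forall>(i, j)\<in>{(i, j). 1 \<le> i \<and> i \<le> j \<and> j \<le> N}. \<forall>q\<in>Q.
      face_integral v f (\<lambda>x. (nb i \<bullet> (\<tau> m x *v nb j)) * q x) = a i j q)"
proof -
  let ?N = "normal_vectors v f" and ?I = "{(i, j). 1 \<le> i \<and> i \<le> j \<and> j \<le> N}"
  let ?V = "constant_tensors (sym_tensor ?N ?N)"
  define \<mu> where "\<mu> = (\<lambda>(i, j) (A :: real^'n^'n). nb i \<bullet> (A *v nb j))"
  have span: "span ?V = ?V" by (simp add: span_constant_tensors sym_tensor_def span_span)
  have "?I \<subseteq> {1..N} \<times> {1..N}" by auto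
  then have fin: "finite ?I" by (rule finite_subset) simp
  have nbN: "nb i \<in> ?N" if "i \<in> {1..N}" for i
    using nb that span_base[of "nb i" "nb ` {1..N}"] by (auto simp: indexed_basis_of_def basis_of_def)
  have "\<exists>!\<tau>. \<tau> \<in> bubble_space v k f ?V \<and>
    (\<forall>s\<in>?I. \<forall>q\<in>Q. face_integral v f (\<lambda>x. \<mu> s (\<tau> m x) * q x) = (case s of (i, j) \<Rightarrow> a i j) q)"
  proof (rule scalar_block[where ms = "\<lambda>_. m", OF f fin _ _ _ _ Q])
    show "linear (\<mu> s)" for s
      by (cases s) (simp add: \<mu>_def linear_form)
  next
    fix A assume A: "A \<in> span ?V" "\<forall>s\<in>?I. \<mu> s (A m) = 0"
    then obtain S where S: "A = (\<lambda>_. S)" "S \<in> sym_tensor ?N ?N"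
      unfolding span by (auto simp: constant_tensors_def)
    have tr: "transpose S = S"
      by (rule transpose_of_span[OF S(2)[unfolded sym_tensor_def]]) (auto simp: transpose_symt_outer)
    have "S = 0"
    proof (rule sym_tensor_normal_eq_zero[OF S(2)])
      show "span (nb ` {1..N}) = ?N" using nb by (simp add: indexed_basis_of_def basis_of_def)
      fix i j assume "i \<in> {1..N}" "j \<in> {1..N}"
      then have "(i, j) \<in> ?I \<or> (j, i) \<in> ?I" by auto
      then have "\<mu> (i, j) S = 0 \<or> \<mu> (j, i) S = 0" using A(2) S(1) by blast
      then show "nb i \<bullet> (S *v nb j) = 0" using symmetric_form[OF tr] by (auto simp: \<mu>_def)
    qed
    then show "\<forall>m\<le>d. A m = 0" using S by simp
  next
    fix a :: "nat \<times> nat \<Rightarrow> real"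
    have "\<forall>i. \<exists>w\<in>?N. \<forall>j\<in>{1..N}. w \<bullet> nb j = (if j = i then 1 else 0)"
      by (rule allI, rule indexed_basis_gram(1)[OF nb finite_atLeastAtMost])
    then obtain w where w: "\<And>i. w i \<in> ?N" "\<And>i j. j \<in> {1..N} \<Longrightarrow> w i \<bullet> nb j = (if j = i then 1 else 0)"
      by metis
    \<comment> \<open>With \<open>min\<close> and \<open>max\<close> the data are extended
      symmetrically to all ordered pairs. The pairs \<open>(k, l)\<close> and \<open>(l, k)\<close>
      then contribute one half each, also when they coincide.\<close>
    define S where "S = (\<Sum>i\<in>{1..N}. \<Sum>j\<in>{1..N}. a (min i j, max i j) *\<^sub>R symt (outer (w i) (w j)))"
    have "S \<in> sym_tensor ?N ?N"
      unfolding S_def sym_tensor_def by (intro span_sum span_scale span_base) (use w(1) in blast)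
    then have "(\<lambda>_. S) \<in> span ?V" unfolding span unfolding constant_tensors_def by blast
    moreover have "\<mu> s S = a s" if s: "s \<in> ?I" for s
    proof -
      obtain k l where kl: "s = (k, l)" "k \<in> {1..N}" "l \<in> {1..N}" "k \<le> l" using s by auto
      have "nb k \<bullet> (S *v nb l) = (\<Sum>i\<in>{1..N}. \<Sum>j\<in>{1..N}. a (min i j, max i j) *
          (1/2 * ((w j \<bullet> nb l) * (w i \<bullet> nb k) + (w i \<bullet> nb l) * (w j \<bullet> nb k))))"
      proof -
        show ?thesis
          by (simp add: S_def linear_sum[OF linear_form] linear_scale[OF linear_form]
              symt_outer_mult_vec inner_add_right inner_commute)
      qed
      also have "\<dots> = (\<Sum>i\<in>{1..N}. \<Sum>j\<in>{1..N}.
          (if i = k then (if j = l then a (min i j, max i j) / 2 else 0) else 0) +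
          (if i = l then (if j = k then a (min i j, max i j) / 2 else 0) else 0))"
        by (intro sum.cong refl) (use w(2) kl in auto)
      also have "\<dots> = a (k, l)"
        using kl sum_delta2[of "{1..N}" k l "\<lambda>i j. a (min i j, max i j) / 2"]
          sum_delta2[of "{1..N}" l k "\<lambda>i j. a (min i j, max i j) / 2"]
        by (simp add: sum.distrib)
      finally show ?thesis by (simp add: \<mu>_def kl(1))
    qed
    ultimately show "\<exists>A\<in>span ?V. \<forall>s\<in>?I. \<mu> s (A m) = a s"
      by (intro bexI[of _ "\<lambda>_. S"]) auto
  qed (use m in auto)
  then show ?thesis by (simp add: \<mu>_def case_prod_beta)
qed

section \<open>Tangential-normal tensors on an interior facet\<close>

definition tangential_tensor :: "nat set \<Rightarrow> nat set \<Rightarrow> real^'n \<Rightarrow> nat \<Rightarrow> real^'n^'n" where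
  "tangential_tensor F f t m =
    (if m \<le> d \<and> F \<subseteq> cell d m then symt (outer t (dual_normal v nrm F f m)) else 0)"

text \<open>Seen as piecewise constant tensors, with value zero on cells that do not contain
  \<open>F\<close>, these fields become an ordinary bubble space, so the general block argument
  applies to them.\<close>

lemma tangential_normal_space_eq:
  "tangential_normal_space v nrm k F f = bubble_space v k f (tangential_tensor F f ` tangent v f)"
proof -
  have "(\<lambda>m x. if m \<le> d \<and> F \<subseteq> cell d m \<and> x \<in> simplex_of v (cell d m)
      then (bubble v f x * p x) *\<^sub>R symt (outer t (dual_normal v nrm F f m)) else 0) =
    bubble_field f p (tangential_tensor F f t)" for p t
    by (auto simp: bubble_field_def tangential_tensor_def fun_eq_iff)
  then show ?thesis
    unfolding tangential_normal_space_def bubble_space_eq dim[symmetric]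
    by (auto intro!: arg_cong[where f = span])
qed

lemma linear_tangential_tensor: "linear (tangential_tensor F f)"
proof (rule linearI)
  show "tangential_tensor F f (s + t) = tangential_tensor F f s + tangential_tensor F f t" for s t
    by (auto simp: tangential_tensor_def fun_eq_iff linear_add[OF linear_symt_outer_left])
  show "tangential_tensor F f (c *\<^sub>R t) = c *\<^sub>R tangential_tensor F f t" for c t
    by (auto simp: tangential_tensor_def fun_eq_iff linear_scale[OF linear_symt_outer_left])
qed

text \<open>Of the two terms of the symmetric product only one survives: the tangential vector is
  orthogonal to the facet normal, and the dual normal has product 1 with it. What remains is the
  Gram system of the tangent basis.\<close>

lemma tangential_block:
  assumes f: "is_face f" "f \<subseteq> opp m - {j}" and m: "m \<le> d" and j: "j \<in> opp m"
    and tb: "indexed_basis_of tb {1..N} (tangent v f)"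
    and Q: "basis_of Q (face_polys v (int k - int (card f)) f)"
  shows "\<exists>!\<tau>. \<tau> \<in> tangential_normal_space v nrm k (opp m - {j}) f \<and>
    (\<forall>i\<in>{1..N}. \<forall>q\<in>Q. face_integral v f (\<lambda>x. (tb i \<bullet> (\<tau> m x *v nv m j)) * q x) = a i q)"
proof -
  let ?F = "opp m - {j}"
  let ?V = "tangential_tensor ?F f ` tangent v f"
  have fo: "f \<subseteq> opp m" "j \<in> opp m - f" "f \<noteq> {}" using f j by (auto simp: is_face_def)
  have span: "span ?V = ?V"
    using linear_span_image[OF linear_tangential_tensor, of ?F f "tangent v f"] by (simp add: tangent_def span_span)
  have tbt: "tb i \<in> tangent v f" if "i \<in> {1..N}" for i
    using tb that span_base[of "tb i" "tb ` {1..N}"] by (auto simp: indexed_basis_of_def basis_of_def)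
  note dn = dual_normal[OF m fo(3,1,2)]
  have key: "tb i \<bullet> (tangential_tensor ?F f t m *v nv m j) = (t \<bullet> tb i) / 2"
    if "i \<in> {1..N}" "t \<in> tangent v f" for i t
    using m dn(2)[OF fo(2)] normal_vectors_orth[OF dn(1) tbt[OF that(1)]]
      normal_vectors_orth[OF nv_normal[OF _ fo(1,2)] that(2)]
    by (simp add: tangential_tensor_def cell_eq_opp symt_outer_mult_vec inner_add_right inner_commute)
  show ?thesis
    unfolding tangential_normal_space_eq
  proof (rule scalar_block[where ms = "\<lambda>_. m" and \<mu> = "\<lambda>i A. tb i \<bullet> (A *v nv m j)", OF f(1) _ _ _ _ _ Q])
    show "linear (\<lambda>A :: real^'n^'n. tb i \<bullet> (A *v nv m j))" for i
      by (rule linear_form)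
  next
    fix A assume A: "A \<in> span ?V" "\<forall>i\<in>{1..N}. tb i \<bullet> (A m *v nv m j) = 0"
    then obtain t where t: "A = tangential_tensor ?F f t" "t \<in> tangent v f" unfolding span by blast
    have "t = 0" using indexed_basis_gram(2)[OF tb _ t(2)] A(2) key[OF _ t(2)] t(1) by simp
    then show "\<forall>m\<le>d. A m = 0" using t(1) linear_0[OF linear_tangential_tensor] by simp
  next
    fix a :: "nat \<Rightarrow> real"
    \<comment> \<open>The factor 2 undoes the half in \<open>key\<close>, which stems from the
      symmetrisation.\<close>
    obtain t where t: "t \<in> tangent v f" "\<forall>i\<in>{1..N}. t \<bullet> tb i = 2 * a i"
      using indexed_basis_gram(1)[OF tb, of "\<lambda>i. 2 * a i"] by auto
    show "\<exists>A\<in>span ?V. \<forall>i\<in>{1..N}. tb i \<bullet> (A m *v nv m j) = a i"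
      unfolding span using t key[OF _ t(1)] by (intro bexI[of _ "tangential_tensor ?F f t"]) auto
  qed (use m fo in auto)
qed

end

section \<open>The boundary blocks\<close>

lemma normal_sym_subset: "normal_sym v f \<subseteq> span {symt (outer a b) |a b. b \<in> normal_vectors v f}" (is "_ \<subseteq> span ?G")
proof
  fix S assume "S \<in> normal_sym v f"
  then obtain A B where "S = A + B" "A \<in> sym_tensor (normal_vectors v f) (normal_vectors v f)"
    "B \<in> sym_tensor (tangent v f) (normal_vectors v f)" by (auto simp: normal_sym_def)
  moreover have "sym_tensor V (normal_vectors v f) \<subseteq> span ?G" for V
    unfolding sym_tensor_def by (rule span_mono) blast
  ultimately show "S \<in> span ?G" by (auto intro!: span_add)
qed

lemma subspace_normal_sym: "subspace (normal_sym v f)"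
  unfolding normal_sym_def by (rule subspace_sums) (simp_all add: sym_tensor_def)

text \<open>Splitting \<open>a\<close> into its tangential and normal parts distributes the product
  over the two summands of \<open>normal_sym\<close>. With \<open>normal_sym_subset\<close> this
  identifies the space as all symmetric products with at least one normal factor.\<close>

lemma symt_outer_in_normal_sym:
  assumes "b \<in> normal_vectors v f"
  shows "symt (outer a b) \<in> normal_sym v f"
proof -
  obtain t n where tn: "t \<in> tangent v f" "n \<in> normal_vectors v f" "a = t + n"
    using tangent_normal_decomp[of v f a] by blast
  have "symt (outer a b) = symt (outer n b) + symt (outer t b)"
    using linear_add[OF linear_symt_outer_left, of t n b] tn(3) by simp
  moreover have "symt (outer n b) \<in> sym_tensor (normal_vectors v f) (normal_vectors v f)"
    "symt (outer t b) \<in> sym_tensor (tangent v f) (normal_vectors v f)"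
    unfolding sym_tensor_def using tn assms by (blast intro: span_base)+
  ultimately show ?thesis unfolding normal_sym_def by blast
qed

lemma normal_sym_transpose: "S \<in> normal_sym v f \<Longrightarrow> transpose S = S"
  by (rule transpose_of_span[OF subsetD[OF normal_sym_subset]]) (auto simp: transpose_symt_outer)

text \<open>Every generator has a normal factor, so a symmetric tensor that kills all normals is
  orthogonal to its own space.\<close>

lemma normal_sym_eq_zero:
  assumes "S \<in> normal_sym v f" "\<And>b. b \<in> normal_vectors v f \<Longrightarrow> S *v b = 0"
  shows "S = 0"
proof (rule span_self_orthogonal[OF subsetD[OF normal_sym_subset assms(1)]])
  fix g assume "g \<in> {symt (outer a b) |a b. b \<in> normal_vectors v f}"
  then show "S \<bullet> g = 0"
    using assms(2) symmetric_form[OF normal_sym_transpose[OF assms(1)]] by (auto simp: inner_symt_outer)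
qed

section \<open>Enrichment tensors and prescribed normal components on the boundary\<close>

context split_normals
begin

text \<open>For an antisymmetric matrix \<open>g\<close> and \<open>J\<close> the vertices outside
  \<open>f\<close>, this is the general element of the enrichment space with base vertex
  \<open>z\<close>; row \<open>m\<close> of \<open>g\<close> gives its value on T_m.\<close>

definition enr :: "nat \<Rightarrow> nat set \<Rightarrow> (nat \<Rightarrow> nat \<Rightarrow> real) \<Rightarrow> nat \<Rightarrow> real^'n^'n" where
  "enr z J g m = (if m \<in> J
     then symt (outer (node v (Suc d) - node v z) (\<Sum>j\<in>J. g m j *\<^sub>R (node v j - node v z))) else 0)"

lemma enr_lincomb: "enr z J (\<lambda>i j. c * g i j + h i j) = c *\<^sub>R enr z J g + enr z J h"
proof
  fix m
  have "(\<Sum>j\<in>J. (c * g m j + h m j) *\<^sub>R (node v j - node v z)) =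
      c *\<^sub>R (\<Sum>j\<in>J. g m j *\<^sub>R (node v j - node v z)) + (\<Sum>j\<in>J. h m j *\<^sub>R (node v j - node v z))"
    by (simp add: scaleR_left_distrib sum.distrib scaleR_sum_right)
  then show "enr z J (\<lambda>i j. c * g i j + h i j) m = (c *\<^sub>R enr z J g + enr z J h) m"
    by (simp add: enr_def linear_add[OF linear_symt_outer_right] linear_scale[OF linear_symt_outer_right])
qed

lemma enrichment_eq:
  "enrichment v z i j m = (if m = i then symt (outer (node v (Suc d) - node v z) (node v j - node v z)) else 0) -
    (if m = j then symt (outer (node v (Suc d) - node v z) (node v i - node v z)) else 0)"
  by (simp add: enrichment_def Let_def dim)

lemma enrichment_space_form:
  assumes "E \<in> enrichment_space v z f"
  shows "\<exists>g. (\<forall>i j. g i j = - g j i) \<and> E = enr z ({..d} - f) g"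
  using assms unfolding enrichment_space_def dim[symmetric]
proof (induction rule: span_induct_alt)
  case base
  have "enr z ({..d} - f) (\<lambda>_ _. 0) = 0"
    by (auto simp: enr_def fun_eq_iff linear_0[OF linear_symt_outer_right])
  then show ?case by (intro exI[of _ "\<lambda>_ _. 0"]) simp
next
  case (step c x y)
  let ?J = "{..d} - f"
  obtain i j where ij: "x = enrichment v z i j" "i \<in> ?J" "j \<in> ?J" "i < j" using step(1) by blast
  obtain g where g: "\<forall>i j. g i j = - g j i" "y = enr z ?J g" using step(2) by blast
  \<comment> \<open>The elementary antisymmetric matrix, with 1 at \<open>(i, j)\<close> and -1 at
    \<open>(j, i)\<close>.\<close>
  define h :: "nat \<Rightarrow> nat \<Rightarrow> real" where
    "h m l = of_bool (m = i) * of_bool (l = j) - of_bool (l = i) * of_bool (m = j)" for m l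
  have "x = enr z ?J h"
  proof
    fix m
    let ?t = "\<lambda>l. node v l - node v z"
    have "h m l *\<^sub>R ?t l = (if l = j then if m = i then ?t j else 0 else 0) - (if l = i then if m = j then ?t i else 0 else 0)" for l
      by (simp add: h_def)
    then have "(\<Sum>l\<in>?J. h m l *\<^sub>R ?t l) = (if m = i then ?t j else 0) - (if m = j then ?t i else 0)"
      using ij by (simp add: sum_subtractf)
    then show "x m = enr z ?J h m"
      using ij by (auto simp: enr_def ij(1) enrichment_eq linear_0[OF linear_symt_outer_right]
          linear_diff[OF linear_symt_outer_right] linear_neg[OF linear_symt_outer_right])
  qed
  then have "c *\<^sub>R x + y = enr z ?J (\<lambda>m l. c * h m l + g m l)" using g(2) by (simp only: enr_lincomb)
  moreover have "c * h m l + g m l = - (c * h l m + g l m)" for m l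
  proof -
    have hm: "h m l = - h l m" unfolding h_def minus_diff_eq ..
    have gm: "g m l = - g l m" by (rule g(1)[rule_format])
    show ?thesis unfolding hm gm by simp
  qed
  ultimately show ?case by (intro exI[of _ "\<lambda>m l. c * h m l + g m l"] conjI allI)
qed

lemma enr_in_space:
  assumes g: "\<And>i j. g i j = - g j i"
  shows "enr z ({..d} - f) g \<in> enrichment_space v z f"
proof -
  let ?J = "{..d} - f"
  let ?s = "\<lambda>j. symt (outer (node v (Suc d) - node v z) (node v j - node v z))"
  have base: "enrichment v z i j \<in> enrichment_space v z f" if "i \<in> ?J" "j \<in> ?J" "i < j" for i j
    unfolding enrichment_space_def dim[symmetric] by (rule span_base) (use that in blast)
  have sub: "subspace (enrichment_space v z f)" by (simp add: enrichment_space_def)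
  have all: "enrichment v z i j \<in> enrichment_space v z f" if ij: "i \<in> ?J" "j \<in> ?J" for i j
  proof (cases rule: linorder_cases[of i j])
    case less
    then show ?thesis using base ij by blast
  next
    case equal
    then have "enrichment v z i j = 0" by (simp add: fun_eq_iff enrichment_eq)
    then show ?thesis using subspace_0[OF sub] by simp
  next
    case greater
    have "enrichment v z i j = - enrichment v z j i" by (simp add: fun_eq_iff enrichment_eq)
    then show ?thesis using subspace_neg[OF sub base[OF ij(2,1) greater]] by simp
  qed
  \<comment> \<open>The sum over ordered pairs meets each pair twice, which the halves compensate:
    \<open>g\<close> and \<open>enrichment\<close> both change sign when the indices are
    exchanged.\<close>
  have "(\<Sum>i\<in>?J. \<Sum>j\<in>?J. (g i j / 2) *\<^sub>R enrichment v z i j) = enr z ?J g"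
  proof
    fix m
    have "(\<Sum>i\<in>?J. \<Sum>j\<in>?J. (g i j / 2) *\<^sub>R enrichment v z i j) m =
        (\<Sum>i\<in>?J. \<Sum>j\<in>?J. if m = i then (g i j / 2) *\<^sub>R ?s j else 0) -
        (\<Sum>i\<in>?J. \<Sum>j\<in>?J. if m = j then (g i j / 2) *\<^sub>R ?s i else 0)"
      by (simp add: sum_fun_eval enrichment_eq scaleR_diff_right sum_subtractf if_distrib[of "\<lambda>t. _ *\<^sub>R t"] cong: if_cong)
    also have "(\<Sum>i\<in>?J. \<Sum>j\<in>?J. if m = i then (g i j / 2) *\<^sub>R ?s j else 0) =
        (\<Sum>i\<in>?J. if m = i then (\<Sum>j\<in>?J. (g i j / 2) *\<^sub>R ?s j) else 0)"
      by (rule sum.cong) auto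
    also have "\<dots> = (if m \<in> ?J then (\<Sum>j\<in>?J. (g m j / 2) *\<^sub>R ?s j) else 0)" by simp
    also have "(\<Sum>i\<in>?J. \<Sum>j\<in>?J. if m = j then (g i j / 2) *\<^sub>R ?s i else 0) =
        (if m \<in> ?J then (\<Sum>i\<in>?J. (g i m / 2) *\<^sub>R ?s i) else 0)"
      by (cases "m \<le> d"; cases "m \<in> f") simp_all
    also have "(\<Sum>i\<in>?J. (g i m / 2) *\<^sub>R ?s i) = - (\<Sum>j\<in>?J. (g m j / 2) *\<^sub>R ?s j)"
      unfolding sum_negf[symmetric] by (rule sum.cong) (auto simp: g[of _ m])
    also have "(if m \<in> ?J then (\<Sum>j\<in>?J. (g m j / 2) *\<^sub>R ?s j) else 0) -
        (if m \<in> ?J then - (\<Sum>j\<in>?J. (g m j / 2) *\<^sub>R ?s j) else 0) =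
        (if m \<in> ?J then (\<Sum>j\<in>?J. g m j *\<^sub>R ?s j) else 0)"
      by (simp flip: sum.distrib scaleR_left_distrib)
    also have "\<dots> = enr z ?J g m"
      by (simp add: enr_def linear_sum[OF linear_symt_outer_right] linear_scale[OF linear_symt_outer_right])
    finally show "(\<Sum>i\<in>?J. \<Sum>j\<in>?J. (g i j / 2) *\<^sub>R enrichment v z i j) m = enr z ?J g m" .
  qed
  moreover have "(\<Sum>i\<in>?J. \<Sum>j\<in>?J. (g i j / 2) *\<^sub>R enrichment v z i j) \<in> enrichment_space v z f"
    by (intro subspace_sum[OF sub] subspace_scale[OF sub] all)
  ultimately show ?thesis by simp
qed

text \<open>The edge to the barycenter is the mean of the edges to all vertices, and only the edge
  to vertex \<open>i\<close> leaves the facet opposite to it.\<close>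

lemma center_height:
  assumes "i \<le> d" "z \<le> d" "z \<noteq> i"
  shows "(node v (Suc d) - node v z) \<bullet> nv (Suc d) i = ((node v i - node v z) \<bullet> nv (Suc d) i) / real (d + 1)"
proof -
  let ?n = "nv (Suc d) i"
  have "node v (Suc d) - node v z = (1 / real (d + 1)) *\<^sub>R (\<Sum>j\<le>d. node v j - node v z)"
  proof -
    have "(\<Sum>j\<le>d. node v j - node v z) = (\<Sum>j\<le>d. v j) - real (d + 1) *\<^sub>R node v z"
      by (simp add: sum_subtractf node_le sum_constant_scaleR del: sum_constant)
    moreover have "(1 / real (d + 1)) * real (d + 1) = 1" by simp
    ultimately show ?thesis
      by (simp only: node_center scaleR_diff_right scaleR_scaleR scaleR_one)
  qed
  then have "(node v (Suc d) - node v z) \<bullet> ?n = (1 / real (d + 1)) * (\<Sum>j\<le>d. (node v j - node v z) \<bullet> ?n)"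
    by (simp only: inner_scaleR_left inner_sum_left)
  also have "(\<Sum>j\<le>d. (node v j - node v z) \<bullet> ?n) = (\<Sum>j\<le>d. if j = i then (node v i - node v z) \<bullet> ?n else 0)"
  proof (rule sum.cong[OF refl])
    fix j assume "j \<in> {..d}"
    then show "(node v j - node v z) \<bullet> ?n = (if j = i then (node v i - node v z) \<bullet> ?n else 0)"
      using nv_edge_zero[of "Suc d" i j z] assms by (auto simp: opp_def inner_commute)
  qed
  finally show ?thesis using assms by simp
qed

text \<open>The condition \<open>sym\<close> is forced on the data by the symmetry of the tensor;
  the lemma says that it is also sufficient. The vectors \<open>u i\<close> are dual to the facet
  normals.\<close>

lemma normal_sym_prescribed:
  assumes m: "m \<le> Suc d" and f: "f \<subseteq> opp m" "f \<noteq> {}"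
    and sym: "\<And>i j. i \<in> opp m - f \<Longrightarrow> j \<in> opp m - f \<Longrightarrow> w i \<bullet> nv m j = w j \<bullet> nv m i"
  shows "\<exists>S\<in>normal_sym v f. \<forall>i\<in>opp m - f. S *v nv m i = w i"
proof -
  let ?J = "opp m - f"
  have "\<forall>j. \<exists>u\<in>normal_vectors v f. \<forall>i\<in>?J. u \<bullet> nv m i = (if i = j then 1 else 0)"
    by (rule allI, rule normal_dual[OF m f])
  then obtain u where u: "\<And>j. u j \<in> normal_vectors v f"
    "\<And>i j. i \<in> ?J \<Longrightarrow> u j \<bullet> nv m i = (if i = j then 1 else 0)" by metis
  have "\<forall>i. \<exists>a b. a \<in> tangent v f \<and> b \<in> normal_vectors v f \<and> w i = a + b"
    using tangent_normal_decomp[of v f] by fast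
  then obtain a b where ab: "\<And>i. a i \<in> tangent v f" "\<And>i. b i \<in> normal_vectors v f" "\<And>i. w i = a i + b i"
    by metis
  have nvn: "nv m i \<in> normal_vectors v f" if "i \<in> ?J" for i using nv_normal[OF m f(1) that] .
  have an: "a j \<bullet> nv m i = 0" if "i \<in> ?J" for i j using normal_vectors_orth[OF nvn[OF that] ab(1)] by simp
  have bsym: "b i \<bullet> nv m j = b j \<bullet> nv m i" if "i \<in> ?J" "j \<in> ?J" for i j
    using sym[OF that] an that by (simp add: ab(3) inner_add_left)
  have expand: "(\<Sum>i\<in>?J. (b j \<bullet> nv m i) *\<^sub>R u i) = b j" if "j \<in> ?J" for j
  proof -
    have "(\<Sum>i\<in>?J. (b j \<bullet> nv m i) *\<^sub>R u i) - b j = 0"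
    proof (rule normal_eq_zero[OF m f])
      show "(\<Sum>i\<in>?J. (b j \<bullet> nv m i) *\<^sub>R u i) - b j \<in> normal_vectors v f"
        by (intro subspace_diff[OF subspace_normal_vectors] subspace_sum[OF subspace_normal_vectors]
            subspace_scale[OF subspace_normal_vectors] u ab)
      fix l assume "l \<in> ?J"
      then show "((\<Sum>i\<in>?J. (b j \<bullet> nv m i) *\<^sub>R u i) - b j) \<bullet> nv m l = 0"
        using u(2)[of l] by (simp add: inner_diff_left inner_sum_left if_distrib[of "\<lambda>t. _ * t"] cong: if_cong)
    qed
    then show ?thesis by simp
  qed
  \<comment> \<open>The tangential part enters twice because its transposed term is orthogonal to
    all facet normals, so only half of it is seen. For the normal part both terms count one half
    each, by the symmetry \<open>bsym\<close>.\<close>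
  define S where "S = (\<Sum>i\<in>?J. symt (outer (2 *\<^sub>R a i + b i) (u i)))"
  have "S \<in> normal_sym v f" unfolding S_def
    by (intro subspace_sum[OF subspace_normal_sym] symt_outer_in_normal_sym u)
  moreover have "S *v nv m j = w j" if j: "j \<in> ?J" for j
  proof -
    have "S *v nv m j = (\<Sum>i\<in>?J. (if i = j then a i + (1/2) *\<^sub>R b i else 0) + (1/2) *\<^sub>R ((b j \<bullet> nv m i) *\<^sub>R u i))"
      unfolding S_def linear_sum[OF linear_mult_vec]
    proof (rule sum.cong[OF refl])
      fix i assume i: "i \<in> ?J"
      show "symt (outer (2 *\<^sub>R a i + b i) (u i)) *v nv m j =
          (if i = j then a i + (1/2) *\<^sub>R b i else 0) + (1/2) *\<^sub>R ((b j \<bullet> nv m i) *\<^sub>R u i)"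
        using u(2)[OF j, of i] an[OF j, of i] bsym[OF i j]
        by (simp add: symt_outer_mult_vec inner_add_left scaleR_add_right)
    qed
    also have "\<dots> = (a j + (1/2) *\<^sub>R b j) + (1/2) *\<^sub>R (\<Sum>i\<in>?J. (b j \<bullet> nv m i) *\<^sub>R u i)"
      using j by (simp add: sum.distrib scaleR_sum_right)
    also have "\<dots> = w j" using expand[OF j] by (simp add: ab(3) scaleR_half_double flip: scaleR_left_distrib)
    finally show ?thesis .
  qed
  ultimately show ?thesis by blast
qed

text \<open>With \<open>h\<^sub>i = t\<^sub>i \<cdot> n\<^sub>i\<close>, where \<open>t\<^sub>i\<close> is the edge from \<open>z\<close> to \<open>v\<^sub>i\<close>, the tensor \<open>S + enr z J g\<close> has on
  \<open>T\<^sub>i\<close> the normal component \<open>S n\<^sub>i + h\<^sub>i / (2 (d + 1)) \<Sum>\<^sub>j g\<^sub>i\<^sub>j t\<^sub>j\<close>. Testing with \<open>n\<^sub>j\<close> gives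
  \<open>n\<^sub>j \<cdot> S n\<^sub>i + h\<^sub>i h\<^sub>j g\<^sub>i\<^sub>j / (2 (d + 1))\<close>: the symmetric part comes from \<open>S\<close> and the antisymmetric part
  from the enrichment.\<close>

lemma boundary_block:
  assumes f: "f \<subseteq> {..d}" "z \<in> f" "card f \<le> d"
    and Q: "basis_of Q (face_vec_polys v (int k - int (card f)) f)"
  shows "\<exists>!\<tau>. \<tau> \<in> bubble_space v k f (constant_tensors (normal_sym v f) \<union> enrichment_space v z f) \<and>
    (\<forall>i\<in>{..d} - f. \<forall>q\<in>Q. face_integral v f (\<lambda>x. (\<tau> i x *v nv (Suc d) i) \<bullet> q x) = a i q)"
proof -
  let ?J = "{..d} - f" and ?V = "constant_tensors (normal_sym v f) \<union> enrichment_space v z f"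
  let ?n = "nv (Suc d)" and ?t = "\<lambda>j. node v j - node v z"
  have J: "?J = opp (Suc d) - f" by (simp add: vertices_eq_opp)
  have fo: "f \<subseteq> opp (Suc d)" "f \<noteq> {}" using f by (auto simp: vertices_eq_opp)
  have face: "is_face f"
  proof -
    have "f \<noteq> {..d}" using f(3) by auto
    then obtain i where "i \<le> d" "i \<notin> f" using f(1) by auto
    then show ?thesis unfolding is_face_def using f by (intro conjI exI[of _ i]) (auto simp: opp_def)
  qed
  define h where "h i = ?t i \<bullet> ?n i" for i
  have zi: "z \<le> d" "i \<in> ?J \<Longrightarrow> z \<noteq> i" for i using f by auto
  have h0: "h i \<noteq> 0" if "i \<in> ?J" for i
    using nv_edge_nonzero[of "Suc d" i z] that zi by (auto simp: h_def opp_def inner_commute)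
  have tn: "?t j \<bullet> ?n i = (if j = i then h i else 0)" if "i \<in> ?J" "j \<in> ?J" for i j
    using nv_edge_zero[of "Suc d" i j z] that zi by (auto simp: h_def opp_def inner_commute)
  have cn: "?t (Suc d) \<bullet> ?n i = h i / real (d + 1)" if "i \<in> ?J" for i
    using center_height[of i z] that zi by (auto simp: h_def)
  have gn: "(\<Sum>l\<in>?J. g l *\<^sub>R ?t l) \<bullet> ?n j = g j * h j" if "j \<in> ?J" for g j
  proof -
    have "(\<Sum>l\<in>?J. g l *\<^sub>R ?t l) \<bullet> ?n j = (\<Sum>l\<in>?J. if l = j then g l * h l else 0)"
      unfolding inner_sum_left by (rule sum.cong) (use tn that in auto)
    then show ?thesis using that by simp
  qed
  \<comment> \<open>The other term of the symmetric product carries the factor \<open>g i i\<close>,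
    which is zero for an antisymmetric matrix.\<close>
  have enr_n: "enr z ?J g i *v ?n i = (h i / (2 * real (d + 1))) *\<^sub>R (\<Sum>l\<in>?J. g i l *\<^sub>R ?t l)"
    if "i \<in> ?J" "g i i = 0" for g i
    using that cn[OF that(1)] gn[OF that(1), of "g i"]
    by (simp add: enr_def symt_outer_mult_vec)
  have antisym_diag: "g i i = 0" if "\<forall>i j. g i j = - g j i" for g :: "nat \<Rightarrow> nat \<Rightarrow> real" and i
    using that[rule_format, of i i] by simp
  have span: "span ?V = {x + y |x y. x \<in> constant_tensors (normal_sym v f) \<and> y \<in> enrichment_space v z f}"
    unfolding span_Un span_constant_tensors
    using subspace_normal_sym[of v f] by (simp add: span_eq_iff[THEN iffD2] enrichment_space_def)
  show ?thesis
  proof (rule vector_block[where ms = "\<lambda>i. i" and nn = ?n, OF face])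
    fix A assume A: "A \<in> span ?V" "\<forall>i\<in>?J. A i *v ?n i = 0"
    then obtain S E where SE: "S \<in> normal_sym v f" "E \<in> enrichment_space v z f" "A = (\<lambda>_. S) + E"
      unfolding span by (auto simp: constant_tensors_def)
    obtain g where g: "\<forall>i j. g i j = - g j i" "E = enr z ?J g" using enrichment_space_form[OF SE(2)] by blast
    note tr = normal_sym_transpose[OF SE(1)]
    have eq: "S *v ?n i + (h i / (2 * real (d + 1))) *\<^sub>R (\<Sum>l\<in>?J. g i l *\<^sub>R ?t l) = 0" if "i \<in> ?J" for i
      using A(2)[THEN bspec, OF that] enr_n[where g = g, OF that antisym_diag[of g, OF g(1)]]
      by (simp add: SE(3) g(2) matrix_vector_mult_add_rdistrib)
    have eq2: "?n j \<bullet> (S *v ?n i) + (h i / (2 * real (d + 1))) * (g i j * h j) = 0" if "i \<in> ?J" "j \<in> ?J" for i j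
      using arg_cong[OF eq[OF that(1)], of "\<lambda>x. x \<bullet> ?n j"] gn[OF that(2), of "g i"]
      by (simp add: inner_add_left inner_add_right inner_commute)
    \<comment> \<open>The term with \<open>S\<close> is symmetric in \<open>i\<close> and
      \<open>j\<close> and the term with \<open>g\<close> antisymmetric, while their sum vanishes
      for both orders.\<close>
    have g0: "g i j = 0" if "i \<in> ?J" "j \<in> ?J" for i j
    proof -
      have "(h i / (2 * real (d + 1))) * (g i j * h j) = (h j / (2 * real (d + 1))) * (g j i * h i)"
        using eq2[OF that] eq2[OF that(2,1)] symmetric_form[OF tr, of "?n j" "?n i"] by linarith
      also have "\<dots> = - ((h i / (2 * real (d + 1))) * (g i j * h j))"
        using g(1)[rule_format, of j i] by simp
      finally have "(h i / (2 * real (d + 1))) * (g i j * h j) = 0" by linarith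
      then show ?thesis using h0[OF that(1)] h0[OF that(2)] by simp
    qed
    have "E = 0" unfolding g(2) using g0
      by (auto simp: enr_def fun_eq_iff linear_0[OF linear_symt_outer_right])
    moreover have "S = 0"
    proof (rule normal_sym_eq_zero[OF SE(1)])
      fix b assume "b \<in> normal_vectors v f"
      then obtain c where c: "b = (\<Sum>i\<in>?J. c i *\<^sub>R ?n i)"
        using normal_expansion[OF order_refl fo] unfolding J by blast
      have "S *v ?n i = 0" if "i \<in> ?J" for i using eq[OF that] g0[OF that] by simp
      then show "S *v b = 0"
        unfolding c linear_sum[OF matrix_vector_mul_linear] by (simp add: matrix_vector_mult_scaleR)
    qed
    ultimately show "\<forall>m\<le>d. A m = 0" by (simp add: SE(3))
  next
    fix w :: "nat \<Rightarrow> real^'n"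
    \<comment> \<open>Chosen so that the contribution of the enrichment,
      \<open>h i * h j * g i j / (2 * (d + 1))\<close>, is the antisymmetric part of the matrix with
      entries \<open>w i \<bullet> ?n j\<close>.\<close>
    define g where "g i j = (if i \<in> ?J \<and> j \<in> ?J
      then real (d + 1) / (h i * h j) * (w i \<bullet> ?n j - w j \<bullet> ?n i) else 0)" for i j
    have swap: "D / (a * b) * (x - y) = - (D / (b * a) * (y - x))" for a b x y D :: real
      by (simp add: mult.commute[of b a] right_diff_distrib)
    have anti: "\<forall>i j. g i j = - g j i"
    proof (intro allI)
      fix i j
      show "g i j = - g j i"
      proof (cases "i \<in> ?J \<and> j \<in> ?J")
        case True
        then have gij: "g i j = real (d + 1) / (h i * h j) * (w i \<bullet> ?n j - w j \<bullet> ?n i)"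
          "g j i = real (d + 1) / (h j * h i) * (w j \<bullet> ?n i - w i \<bullet> ?n j)" by (simp_all add: g_def)
        show ?thesis unfolding gij by (rule swap)
      next
        case False
        then have "g i j = 0" "g j i = 0" unfolding g_def by (blast intro: if_not_P)+
        then show ?thesis by simp
      qed
    qed
    \<comment> \<open>The data left over for \<open>S\<close>; their products with the normals are
      now symmetric, as \<open>normal_sym_prescribed\<close> requires.\<close>
    define w' where "w' i = w i - (h i / (2 * real (d + 1))) *\<^sub>R (\<Sum>l\<in>?J. g i l *\<^sub>R ?t l)" for i
    have w'n: "w' i \<bullet> ?n j = (w i \<bullet> ?n j + w j \<bullet> ?n i) / 2" if "i \<in> ?J" "j \<in> ?J" for i j
    proof -
      have "(h i / (2 * real (d + 1))) * (g i j * h j) = (w i \<bullet> ?n j - w j \<bullet> ?n i) / 2"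
      proof -
        have cancel: "a / (2 * D) * (D / (a * b) * X * b) = X / 2" if "a \<noteq> 0" "b \<noteq> 0" "D \<noteq> 0" for a b D X :: real
          using that by (simp add: field_simps)
        have "g i j = real (d + 1) / (h i * h j) * (w i \<bullet> ?n j - w j \<bullet> ?n i)" using that by (simp add: g_def)
        then show ?thesis using cancel[OF h0[OF that(1)] h0[OF that(2)], of "real (d + 1)"] by simp
      qed
      then show ?thesis
        using gn[OF that(2), of "g i"] by (simp add: w'_def inner_diff_left field_simps)
    qed
    obtain S where S: "S \<in> normal_sym v f" "\<forall>i\<in>?J. S *v ?n i = w' i"
      using normal_sym_prescribed[OF order_refl fo, of w'] w'n unfolding J by (auto simp: add.commute)
    have const: "(\<lambda>_. S) \<in> constant_tensors (normal_sym v f)"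
      unfolding constant_tensors_def using S(1) by (rule imageI)
    have enr: "enr z ?J g \<in> enrichment_space v z f"
      by (rule enr_in_space) (rule anti[rule_format])
    have "(\<lambda>_. S) + enr z ?J g \<in> span ?V"
      unfolding span using const enr by blast
    moreover have "((\<lambda>_. S) + enr z ?J g) i *v ?n i = w i" if "i \<in> ?J" for i
      using S(2)[THEN bspec, OF that] enr_n[where g = g, OF that antisym_diag[of g, OF anti]]
      by (simp add: matrix_vector_mult_add_rdistrib w'_def)
    ultimately show "\<exists>A\<in>span ?V. \<forall>i\<in>?J. A i *v ?n i = w i" by blast
  next
    show "i \<le> d \<and> f \<subseteq> opp i" if "i \<in> ?J" for i using that f by (auto simp: opp_def)
  qed (use Q in auto)
qed

end

section \<open>Cell bubbles and traces\<close>

lemma integrable_on_compact: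
  fixes g :: "real^'n \<Rightarrow> real"
  assumes "compact S" "continuous_on S g"
  shows "integrable (lebesgue_on S) g"
proof -
  have "integrable lborel (\<lambda>x. indicator S x *\<^sub>R g x)" by (rule borel_integrable_compact[OF assms])
  then have "integrable lebesgue (\<lambda>x. indicator S x *\<^sub>R g x)"
    using integrable_completion[of "\<lambda>x. indicator S x *\<^sub>R g x" lborel] borel_measurable_integrable by blast
  moreover have "S \<in> sets lebesgue" using assms(1) by (simp add: borel_compact)
  ultimately show ?thesis using integrable_restrict_space[of S lebesgue g] by simp
qed

lemma linear_extend_from_cell: "linear (extend_from_cell m)"
  by (rule linearI) (auto simp: extend_from_cell_def fun_eq_iff)

context split_normals
begin

lemma is_face_opp: "m \<le> d \<Longrightarrow> is_face (opp m)"
  using opp_nonempty by (auto simp: is_face_def)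

lemma cell_polys_continuous:
  assumes "p \<in> cell_sym_polys v k m"
  shows "continuous_on (simplex_of v (cell d m)) p"
proof -
  have c: "continuous_on (simplex_of v (cell d m)) (\<lambda>x. p x $ i $ j)" for i j
  proof -
    have "(\<lambda>x. p x $ i $ j) \<in> face_polys v (int k) (cell d m)"
      using assms by (simp add: cell_sym_polys_def dim)
    then show ?thesis by (rule continuous_on_face_polys)
  qed
  have "continuous_on (simplex_of v (cell d m)) (\<lambda>x. \<chi> i j. p x $ i $ j)"
    by (intro continuous_on_vec_lambda c)
  then show ?thesis by simp
qed

lemma cell_polys_outside:
  assumes "p \<in> cell_sym_polys v k m" "x \<notin> simplex_of v (cell d m)"
  shows "p x = 0"
proof -
  have "p x $ i $ j = 0" for i j
  proof -
    have "(\<lambda>x. p x $ i $ j) \<in> face_polys v (int k) (cell d m)"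
      using assms by (simp add: cell_sym_polys_def dim)
    then show ?thesis using assms(2) by (rule face_polys_outside)
  qed
  then show ?thesis by (simp add: vec_eq_iff)
qed

text \<open>A zero integral of the square makes \<open>p\<close> vanish almost everywhere. If
  \<open>p\<close> were nonzero at an interior point it would be nonzero on a ball, which is not
  negligible; boundary points follow by continuity.\<close>

lemma cell_integral_eq_zero:
  fixes p :: "real^'n \<Rightarrow> 'b::euclidean_space"
  assumes m: "m \<le> d" and p: "continuous_on (simplex_of v (cell d m)) p"
    and zero: "(LINT x|lebesgue_on (simplex_of v (cell d m)). p x \<bullet> p x) = 0"
    and x: "x \<in> simplex_of v (cell d m)"
  shows "p x = 0"
proof -
  let ?S = "simplex_of v (cell d m)"
  have S: "?S = simplex_of v (opp m)" using cell_eq_opp[OF m] by simp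
  have comp: "compact ?S" unfolding S by (rule compact_simplex_of) simp
  have meas: "?S \<in> sets lebesgue" using comp by (simp add: borel_compact)
  have "AE y in lebesgue_on ?S. p y \<bullet> p y = 0"
  proof (subst integral_nonneg_eq_0_iff_AE[symmetric])
    show "integrable (lebesgue_on ?S) (\<lambda>y. p y \<bullet> p y)"
      by (rule integrable_on_compact[OF comp]) (intro continuous_intros p)
  qed (use zero in simp_all)
  then have "AE y in lebesgue. y \<in> ?S \<longrightarrow> p y = 0"
    using AE_restrict_space_iff[of ?S lebesgue] meas by simp
  then obtain N where N: "{y \<in> space lebesgue. \<not> (y \<in> ?S \<longrightarrow> p y = 0)} \<subseteq> N"
    "emeasure lebesgue N = 0" "N \<in> sets lebesgue"
    by (rule AE_E)
  have "negligible N" unfolding negligible_iff_null_sets using N(2,3) by (rule null_setsI)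
  then have negl: "negligible {y \<in> ?S. p y \<noteq> 0}"
    by (rule negligible_subset) (use N(1) in auto)
  have inner: "p y = 0" if y: "y \<in> simplex_of v (opp m)" "\<forall>i\<in>opp m. 0 < hat v i y" for y
  proof (rule ccontr)
    assume py: "p y \<noteq> 0"
    obtain \<delta>1 where \<delta>1: "0 < \<delta>1" "\<And>h. norm h < \<delta>1 \<Longrightarrow> y + h \<in> ?S"
      using relative_interior_nbhd[OF is_face_opp[OF m] y] tangent_opp[of m] m unfolding S by auto
    obtain \<delta>2 where \<delta>2: "0 < \<delta>2" "\<And>x'. x' \<in> ?S \<Longrightarrow> dist x' y < \<delta>2 \<Longrightarrow> dist (p x') (p y) < norm (p y)"
      using p y(1) py unfolding S continuous_on_iff by (metis zero_less_norm_iff)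
    have "ball y (min \<delta>1 \<delta>2) \<subseteq> {y \<in> ?S. p y \<noteq> 0}"
    proof
      fix u assume u: "u \<in> ball y (min \<delta>1 \<delta>2)"
      have "y + (u - y) \<in> ?S" by (rule \<delta>1(2)) (use u in \<open>simp add: dist_norm norm_minus_commute\<close>)
      then have uS: "u \<in> ?S" by simp
      have "p u \<noteq> 0" using \<delta>2(2)[OF uS] u by (auto simp: dist_commute)
      then show "u \<in> {y \<in> ?S. p y \<noteq> 0}" using uS by simp
    qed
    then have "negligible (ball y (min \<delta>1 \<delta>2))" using negligible_subset[OF negl] by blast
    then show False using open_not_negligible[of "ball y (min \<delta>1 \<delta>2)"] \<delta>1(1) \<delta>2(1) by simp
  qed
  show ?thesis by (rule vanishing_on_face[OF is_face_opp[OF m]]) (use p x inner S in auto)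
qed

text \<open>Test functions and bubbles form the same space, so the moments are a Gram system for the
  L2 product on the cell.\<close>

lemma cell_block:
  assumes m: "m \<le> d" and Q: "basis_of Q (cell_bubbles v nrm k m)"
  shows "\<exists>!\<tau>. \<tau> \<in> extend_from_cell m ` cell_bubbles v nrm k m \<and>
    (\<forall>q\<in>Q. (LINT x|lebesgue_on (simplex_of v (cell d m)). \<tau> m x \<bullet> q x) = a q)"
proof -
  let ?W = "cell_bubbles v nrm k m" and ?S = "simplex_of v (cell d m)"
  have sub: "?W \<subseteq> cell_sym_polys v k m" by (auto simp: cell_bubbles_def)
  have fin: "finite Q" using finite_basis_cell_sym_polys[OF Q sub] .
  have cont: "continuous_on ?S p" if "p \<in> ?W" for p using that sub cell_polys_continuous by blast
  have comp: "compact ?S" unfolding cell_eq_opp[OF m] by (rule compact_simplex_of) simp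
  have int: "integrable (lebesgue_on ?S) (\<lambda>x. p x \<bullet> q x)" if "p \<in> ?W" "q \<in> ?W" for p q
    by (rule integrable_on_compact[OF comp]) (intro continuous_intros cont that)
  have "\<exists>!p. p \<in> ?W \<and> (\<forall>q\<in>Q. (LINT x|lebesgue_on ?S. p x \<bullet> q x) = a q)"
  proof (rule gram_solve[OF fin Q])
    show "(LINT u|lebesgue_on ?S. (x + y) u \<bullet> z u) = (LINT u|lebesgue_on ?S. x u \<bullet> z u) + (LINT u|lebesgue_on ?S. y u \<bullet> z u)"
      if "x \<in> ?W" "y \<in> ?W" "z \<in> ?W" for x y z
      using int that by (simp add: inner_add_left)
    show "(LINT u|lebesgue_on ?S. (c *\<^sub>R x) u \<bullet> z u) = c * (LINT u|lebesgue_on ?S. x u \<bullet> z u)" for c x z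
      by simp
    show "(LINT u|lebesgue_on ?S. x u \<bullet> y u) = (LINT u|lebesgue_on ?S. y u \<bullet> x u)" for x y
      by (simp only: inner_commute)
    show "p = 0" if "p \<in> ?W" "(LINT u|lebesgue_on ?S. p u \<bullet> p u) = 0" for p
    proof
      fix x
      show "p x = 0 x"
        using cell_integral_eq_zero[OF m cont[OF that(1)] that(2)] cell_polys_outside that(1) sub
        by (cases "x \<in> ?S") auto
    qed
  qed
  then obtain p where p: "p \<in> ?W" "\<forall>q\<in>Q. (LINT x|lebesgue_on ?S. p x \<bullet> q x) = a q"
    "\<And>p'. p' \<in> ?W \<Longrightarrow> \<forall>q\<in>Q. (LINT x|lebesgue_on ?S. p' x \<bullet> q x) = a q \<Longrightarrow> p' = p" by blast
  show ?thesis
  proof (rule ex1I[of _ "extend_from_cell m p"])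
    show "extend_from_cell m p \<in> extend_from_cell m ` ?W \<and>
        (\<forall>q\<in>Q. (LINT x|lebesgue_on ?S. extend_from_cell m p m x \<bullet> q x) = a q)"
      using p(1,2) by (simp add: extend_from_cell_def)
  next
    fix \<tau> assume \<tau>: "\<tau> \<in> extend_from_cell m ` ?W \<and>
        (\<forall>q\<in>Q. (LINT x|lebesgue_on ?S. \<tau> m x \<bullet> q x) = a q)"
    then obtain p' where p': "p' \<in> ?W" "\<tau> = extend_from_cell m p'" by blast
    have "\<tau> m = p'" by (simp add: p'(2) extend_from_cell_def)
    then have "p' = p" using p(3)[OF p'(1)] \<tau> by simp
    then show "\<tau> = extend_from_cell m p" using p'(2) by simp
  qed
qed

end

section \<open>Components and traces in which a block vanishes\<close>

lemma subspace_vanish_induct: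
  assumes "s \<in> span G" "\<And>g. g \<in> G \<Longrightarrow> F g = (0::'b::real_vector)"
    and "\<And>x y. F (x + y) = F x + F y" "\<And>c x. F (c *\<^sub>R x) = c *\<^sub>R F x"
  shows "F s = 0"
proof -
  have "linear F" by (rule linearI) (fact assms(3,4))+
  then show ?thesis by (rule linear_eq_0_on_span[OF _ assms(2,1)])
qed

context split_normals
begin

lemma bubble_space_vanish:
  assumes "is_face f" "is_face g" "\<not> g \<subseteq> f" "s \<in> bubble_space v k g V" "x \<in> simplex_of v f"
  shows "s m x = 0"
  using assms(4) unfolding bubble_space_eq
  by (rule subspace_vanish_induct[where F = "\<lambda>s. s m x"])
    (auto simp: bubble_field_def bubble_zero_on_face[OF assms(1-3,5)])

lemma bubble_space_functional:
  assumes "linear \<mu>" "\<And>A. A \<in> V \<Longrightarrow> \<mu> (A m) = (0::'b::real_vector)" "s \<in> bubble_space v k g V"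
  shows "\<mu> (s m x) = 0"
  using assms(3) unfolding bubble_space_eq
  by (rule subspace_vanish_induct[where F = "\<lambda>s. \<mu> (s m x)"])
    (auto simp: bubble_field_def assms(2) linear_add[OF assms(1)] linear_scale[OF assms(1)] linear_0[OF assms(1)])

text \<open>On a cell containing \<open>F\<close> the dual normal of \<open>F\<close> is orthogonal
  to the normals of the other facets around \<open>f\<close>, and the tangential factor is
  orthogonal to all of them; on the other cells the field is zero.\<close>

lemma tangential_space_other_face:
  assumes m: "m \<le> d" and f: "f \<noteq> {}" "f \<subseteq> opp m" "i \<in> opp m - f"
    and F: "F \<in> interior_simplices d (d - 1)" "f \<subseteq> F" "F \<noteq> opp m - {i}"
    and s: "s \<in> tangential_normal_space v nrm k F f"
  shows "s m x *v nv m i = 0"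
  using linear_mult_vec _ s[unfolded tangential_normal_space_eq]
proof (rule bubble_space_functional)
  fix A assume "A \<in> tangential_tensor F f ` tangent v f"
  then obtain t where t: "t \<in> tangent v f" "A = tangential_tensor F f t" by blast
  show "A m *v nv m i = 0"
  proof (cases "F \<subseteq> cell d m")
    case True
    have "card F = d" using F(1) d_pos by (auto simp: interior_simplices_def R_simplices_def subsimplices_def)
    then have "F \<in> subsimplices (d - 1) (cell d m)" using True d_pos by (simp add: subsimplices_def)
    then obtain j where j: "j \<in> opp m" "F = opp m - {j}" using subsimplices_facet_iff[OF m] by blast
    then have jf: "j \<in> opp m - f" "j \<noteq> i" using F by auto
    have "dual_normal v nrm F f m \<bullet> nv m i = 0"
      using dual_normal(2)[OF m f(1,2) jf(1) f(3)] jf(2) j(2) by simp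
    moreover have "t \<bullet> nv m i = 0"
      using normal_vectors_orth[OF nv_normal[OF _ f(2,3)] t(1)] m by simp
    ultimately show ?thesis by (simp add: t(2) tangential_tensor_def symt_outer_mult_vec)
  qed (simp add: t(2) tangential_tensor_def)
qed

text \<open>Each term of the symmetric product has the tangential factor paired with a normal
  vector.\<close>

lemma tangential_space_normal_form:
  assumes "u \<in> normal_vectors v f" "w \<in> normal_vectors v f" "s \<in> tangential_normal_space v nrm k F f"
  shows "u \<bullet> (s m x *v w) = 0"
  using linear_form _ assms(3)[unfolded tangential_normal_space_eq]
proof (rule bubble_space_functional)
  fix A assume "A \<in> tangential_tensor F f ` tangent v f"
  then obtain t where t: "t \<in> tangent v f" "A = tangential_tensor F f t" by blast
  show "u \<bullet> (A m *v w) = 0"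
    using normal_vectors_orth[OF assms(1) t(1)] normal_vectors_orth[OF assms(2) t(1)]
    by (simp add: t(2) tangential_tensor_def symt_outer_mult_vec inner_add_right)
qed

lemma cell_bubble_facet:
  assumes m: "m \<le> d" and p: "p \<in> cell_bubbles v nrm k m" and f: "f \<subseteq> opp m" "i \<in> opp m - f"
    and x: "x \<in> simplex_of v f"
  shows "p x *v nv m i = 0"
proof -
  have "opp m - {i} \<in> subsimplices (d - 1) (cell d m)" using f subsimplices_facet_iff[OF m] by blast
  moreover have "x \<in> simplex_of v (opp m - {i})"
    using x simplex_of_mono[of f "opp m - {i}" v] f by blast
  ultimately show ?thesis using p by (simp add: cell_bubbles_def dim)
qed

text \<open>On \<open>f\<close> the bubble kills the normals of all facets containing
  \<open>f\<close>, and these span the normal space of \<open>f\<close>.\<close>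

lemma cell_bubble_normal:
  assumes m: "m \<le> d" and p: "p \<in> cell_bubbles v nrm k m" and f: "f \<subseteq> opp m" "f \<noteq> {}"
    and x: "x \<in> simplex_of v f" and w: "w \<in> normal_vectors v f"
  shows "p x *v w = 0"
proof -
  obtain c where c: "w = (\<Sum>i\<in>opp m - f. c i *\<^sub>R nv m i)"
    using normal_expansion[OF _ f w] m by auto
  show ?thesis
    unfolding c linear_sum[OF matrix_vector_mul_linear]
    using cell_bubble_facet[OF m p f(1) _ x] by (simp add: matrix_vector_mult_scaleR)
qed

text \<open>A space that contains all blocks and on which every functional is additive, because the
  integrals exist there.\<close>

definition piecewise_continuous :: "'n pw_field set" where
  "piecewise_continuous = {\<tau>. \<forall>m\<le>d. continuous_on (simplex_of v (cell d m)) (\<tau> m)}"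

lemma subspace_piecewise_continuous: "subspace piecewise_continuous"
  unfolding subspace_def piecewise_continuous_def
  by (auto simp: plus_fun_def scaleR_fun_def zero_fun_def intro!: continuous_intros)

lemma bubble_space_continuous:
  assumes "is_face f"
  shows "bubble_space v k f V \<subseteq> piecewise_continuous"
  unfolding bubble_space_eq
proof (rule span_minimal[OF _ subspace_piecewise_continuous], safe)
  fix p A assume p: "p \<in> extended_polys v (int k - int (card f)) f"
  have "continuous_on (simplex_of v (cell d m)) (bubble_field f p A m)" if m: "m \<le> d" for m
  proof (rule continuous_on_eq)
    show "continuous_on (simplex_of v (cell d m)) (\<lambda>x. (bubble v f x * p x) *\<^sub>R A m)"
      using continuous_on_subset[OF bubble_continuous[OF assms] simplex_cell_subset_T[OF m]]
        continuous_on_subset[OF extended_polys_continuous[OF assms p] simplex_cell_subset_T[OF m]]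
      by (intro continuous_intros)
  qed (simp add: bubble_field_def m)
  then show "bubble_field f p A \<in> piecewise_continuous" by (simp add: piecewise_continuous_def)
qed

lemma cell_fields_continuous:
  "extend_from_cell m ` cell_bubbles v nrm k m \<subseteq> piecewise_continuous"
proof
  fix s assume "s \<in> extend_from_cell m ` cell_bubbles v nrm k m"
  then obtain p where p: "p \<in> cell_sym_polys v k m" "s = extend_from_cell m p"
    by (auto simp: cell_bubbles_def)
  then show "s \<in> piecewise_continuous"
    using cell_polys_continuous[OF p(1)]
    by (auto simp: piecewise_continuous_def extend_from_cell_def zero_fun_def)
qed

end

section \<open>Block triangular structure\<close>

datatype block = Face_Block "nat set" | Tangential_Block "nat set" "nat set" | Cell_Block nat

text \<open>Names of the functionals, so that one function on names can carry the prescribed values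
  of all four families.\<close>

datatype ('n::finite) dof =
    Boundary_Dof "nat set" "nat set" "real^'n \<Rightarrow> real^'n"
  | Normal_Dof "nat set" nat nat "real^'n \<Rightarrow> real"
  | Tangential_Dof "nat set" "nat set" nat "real^'n \<Rightarrow> real"
  | Cell_Dof nat "real^'n \<Rightarrow> real^'n^'n"

text \<open>The map \<open>adj\<close> is an arbitrary choice of an adjacent cell from which traces
  are taken. All results hold for every choice, in accordance with traces that may be evaluated from
  any adjacent cell.\<close>

locale unisolvence_data = split_normals v d nrm
  for v :: "nat \<Rightarrow> real^'n" and d :: nat and nrm :: "nat set \<Rightarrow> real^'n" +
  fixes k :: nat
    and base adj :: "nat set \<Rightarrow> nat"
    and nb tb :: "nat set \<Rightarrow> nat \<Rightarrow> real^'n"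
    and Qvec :: "nat set \<Rightarrow> (real^'n \<Rightarrow> real^'n) set"
    and Q :: "nat set \<Rightarrow> (real^'n \<Rightarrow> real) set"
    and Qcell :: "nat \<Rightarrow> (real^'n \<Rightarrow> real^'n^'n) set"
  assumes base_vertex: "\<And>l f. l < d \<Longrightarrow> f \<in> T_simplices d l \<Longrightarrow> base f \<in> f"
    and adjacent_cell: "\<And>l f. l < d \<Longrightarrow> f \<in> R_simplices d l \<Longrightarrow> adj f \<le> d \<and> f \<subseteq> cell d (adj f)"
    and normal_bases: "\<And>l f. l < d \<Longrightarrow> f \<in> interior_simplices d l \<Longrightarrow>
          indexed_basis_of (nb f) {1..d - l} (normal_vectors v f)"
    and tangent_bases: "\<And>l f F. 1 \<le> l \<Longrightarrow> F \<in> interior_simplices d (d - 1) \<Longrightarrow>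
          f \<in> subsimplices l F \<Longrightarrow> indexed_basis_of (tb f) {1..l} (tangent v f)"
    and vec_test_bases: "\<And>l f. l < d \<Longrightarrow> f \<in> T_simplices d l \<Longrightarrow>
          basis_of (Qvec f) (face_vec_polys v (int k - int (l + 1)) f)"
    and test_bases: "\<And>l f. l < d \<Longrightarrow> f \<in> R_simplices d l \<Longrightarrow>
          basis_of (Q f) (face_polys v (int k - int (l + 1)) f)"
    and cell_test_bases: "\<And>m. m \<le> d \<Longrightarrow> basis_of (Qcell m) (cell_bubbles v nrm k m)"
begin

text \<open>Faces of dimension below \<open>d\<close>; in contrast to \<open>is_face\<close>, the
  cells are excluded.\<close>

definition faces :: "nat set set" where
  "faces = {f. \<exists>l<d. f \<in> R_simplices d l}"

definition interior_facets :: "nat set set" where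
  "interior_facets = interior_simplices d (d - 1)"

lemma faces_iff: "f \<in> faces \<longleftrightarrow> is_face f \<and> card f \<le> d"
proof
  assume "f \<in> faces"
  then obtain l m where "l < d" "m \<le> d" "f \<subseteq> cell d m" "card f = l + 1"
    by (auto simp: faces_def R_simplices_def subsimplices_def)
  then show "is_face f \<and> card f \<le> d" unfolding is_face_def using cell_eq_opp by auto
next
  assume f: "is_face f \<and> card f \<le> d"
  then obtain m where m: "m \<le> d" "f \<subseteq> opp m" "f \<noteq> {}" by (auto simp: is_face_def)
  have "0 < card f" using m is_face_finite f by (simp add: card_gt_0_iff)
  then show "f \<in> faces"
    using m f unfolding faces_def R_simplices_def subsimplices_def
    by (intro CollectI exI[of _ "card f - 1"]) (auto simp: cell_eq_opp)
qed

lemma R_simplices_iff: "l < d \<Longrightarrow> f \<in> R_simplices d l \<longleftrightarrow> f \<in> faces \<and> card f = l + 1"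
  by (auto simp: faces_def R_simplices_def subsimplices_def)

lemma T_simplices_iff: "l < d \<Longrightarrow> f \<in> T_simplices d l \<longleftrightarrow> f \<in> faces \<and> Suc d \<notin> f \<and> card f = l + 1"
proof
  assume l: "l < d" "f \<in> T_simplices d l"
  then have f: "f \<subseteq> {..d}" "card f = l + 1" by (auto simp: T_simplices_def subsimplices_def)
  then have "f \<noteq> {..d}" using l(1) by auto
  then obtain i where "i \<le> d" "i \<notin> f" using f(1) by auto
  then have "is_face f" unfolding is_face_def using f by (intro conjI exI[of _ i]) (auto simp: opp_def)
  then show "f \<in> faces \<and> Suc d \<notin> f \<and> card f = l + 1" using f l faces_iff by auto
next
  assume "l < d" and f: "f \<in> faces \<and> Suc d \<notin> f \<and> card f = l + 1"
  then have "f \<subseteq> {..d}" using is_face_le[of f] faces_iff by (fastforce simp: le_Suc_eq)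
  then show "f \<in> T_simplices d l" using f by (simp add: T_simplices_def subsimplices_def)
qed

lemma interior_simplices_iff:
  "l < d \<Longrightarrow> f \<in> interior_simplices d l \<longleftrightarrow> f \<in> faces \<and> Suc d \<in> f \<and> card f = l + 1"
  unfolding interior_simplices_def using R_simplices_iff T_simplices_iff by auto

lemma d1: "d - 1 < d" "d - 1 + 1 = d"
  using d_pos by auto

lemma face_facts:
  assumes "f \<in> faces"
  shows "is_face f" "f \<noteq> {}" "finite f" "card f \<le> d" "card f - 1 < d" "card f - 1 + 1 = card f"
    "adj f \<le> d" "f \<subseteq> opp (adj f)"
proof -
  show f: "is_face f" "card f \<le> d" using assms faces_iff by auto
  then show "f \<noteq> {}" "finite f" using is_face_finite by (auto simp: is_face_def)
  then have "0 < card f" by (simp add: card_gt_0_iff)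
  then show c: "card f - 1 < d" "card f - 1 + 1 = card f" using f(2) by auto
  have "f \<in> R_simplices d (card f - 1)" using R_simplices_iff[OF c(1)] assms c(2) by simp
  from adjacent_cell[OF c(1) this] show "adj f \<le> d" "f \<subseteq> opp (adj f)" using cell_eq_opp by auto
qed

lemma facet_facts:
  assumes "F \<in> interior_facets"
  obtains j where "adj F \<le> d" "j \<in> opp (adj F)" "opp (adj F) - {j} = F"
proof -
  have F: "F \<in> faces" "Suc d \<in> F" "card F = d"
    using assms interior_simplices_iff[OF d1(1)] d1(2) by (auto simp: interior_facets_def)
  have "F \<in> subsimplices (d - 1) (cell d (adj F))"
    using face_facts(7,8)[OF F(1)] F(3) d_pos by (simp add: subsimplices_def cell_eq_opp)
  then obtain j where "j \<in> opp (adj F)" "F = opp (adj F) - {j}"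
    using subsimplices_facet_iff[OF face_facts(7)[OF F(1)]] by blast
  then show ?thesis using that face_facts(7)[OF F(1)] by simp
qed

lemma boundary_facet:
  "F \<in> T_simplices d (d - 1) \<longleftrightarrow> (\<exists>i\<le>d. F = opp (Suc d) - {i})"
proof
  assume "F \<in> T_simplices d (d - 1)"
  then have F: "F \<subseteq> {..d}" "card F = d" using d1(2) by (auto simp: T_simplices_def subsimplices_def)
  have "card ({..d} - F) = 1" using F by (simp add: card_Diff_subset finite_subset[OF F(1)])
  then obtain i where "{..d} - F = {i}" using card_1_singletonE by blast
  then have "i \<le> d" "F = {..d} - {i}" using F(1) by auto
  then show "\<exists>i\<le>d. F = opp (Suc d) - {i}" unfolding vertices_eq_opp by blast
next
  assume "\<exists>i\<le>d. F = opp (Suc d) - {i}"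
  then obtain i where "i \<le> d" "F = {..d} - {i}" unfolding vertices_eq_opp by blast
  then show "F \<in> T_simplices d (d - 1)" using d1(2) by (simp add: T_simplices_def subsimplices_def)
qed

text \<open>The facet F_i lies in T_i only, so the choice of \<open>adj\<close> is forced there. As
  a facet of T_i it is the one opposite to the barycenter.\<close>

lemma boundary_facet_adj:
  assumes "i \<le> d"
  shows "adj (opp (Suc d) - {i}) = i" "opp (Suc d) - {i} = opp i - {Suc d}"
proof -
  let ?F = "opp (Suc d) - {i}"
  have "?F \<in> R_simplices d (d - 1)"
    using boundary_facet[of ?F] assms T_simplices_iff[OF d1(1)] R_simplices_iff[OF d1(1)] by blast
  from adjacent_cell[OF d1(1) this] have a: "adj ?F \<le> d" "?F \<subseteq> opp (adj ?F)" using cell_eq_opp by auto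
  show "adj ?F = i"
  proof (rule ccontr)
    assume "adj ?F \<noteq> i"
    then have "adj ?F \<in> ?F" using a(1) by (auto simp: opp_def)
    then show False using a(2) by (auto simp: opp_def)
  qed
  show "?F = opp i - {Suc d}" using assms by (auto simp: opp_def)
qed

text \<open>Tangential blocks are also formed for the vertices of \<open>F\<close>: their tangent
  space is zero, so such a block has the zero space and no functionals.\<close>

definition blocks :: "block set" where
  "blocks = Face_Block ` faces \<union> (\<lambda>(F, f). Tangential_Block F f) ` (SIGMA F:interior_facets. Pow F - {{}}) \<union>
     Cell_Block ` {..d}"

text \<open>On a boundary face the constant tensors and the enrichment share one tensor space,
  because the functionals there determine both together and neither one separately.\<close>

fun block_space :: "block \<Rightarrow> 'n pw_field set" where
  "block_space (Face_Block f) = (if Suc d \<in> f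
     then bubble_space v k f (constant_tensors (sym_tensor (normal_vectors v f) (normal_vectors v f)))
     else bubble_space v k f (constant_tensors (normal_sym v f) \<union> enrichment_space v (base f) f))"
| "block_space (Tangential_Block F f) = tangential_normal_space v nrm k F f"
| "block_space (Cell_Block m) = extend_from_cell m ` cell_bubbles v nrm k m"

text \<open>Doubling leaves room for the tangential blocks between the cardinalities. As
  \<open>card f \<le> d\<close>, the rank of the cells exceeds all others.\<close>

fun block_rank :: "block \<Rightarrow> nat" where
  "block_rank (Face_Block f) = 2 * card f"
| "block_rank (Tangential_Block F f) = 2 * card f + 1"
| "block_rank (Cell_Block m) = 2 * d + 2"

text \<open>With \<open>card f = l + 1\<close> the bound \<open>d + 1 - card f\<close> is
  \<open>d - l\<close>, the dimension of the normal space.\<close>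

fun block_dofs :: "block \<Rightarrow> 'n dof set" where
  "block_dofs (Face_Block f) = (if Suc d \<in> f
     then {Normal_Dof f i j q | i j q. 1 \<le> i \<and> i \<le> j \<and> j \<le> d + 1 - card f \<and> q \<in> Q f}
     else {Boundary_Dof f F q | F q. F \<in> T_simplices d (d - 1) \<and> f \<subseteq> F \<and> q \<in> Qvec f})"
| "block_dofs (Tangential_Block F f) = {Tangential_Dof F f i q | i q. i \<in> {1..card f - 1} \<and> q \<in> Q f}"
| "block_dofs (Cell_Block m) = Cell_Dof m ` Qcell m"

fun dof_value :: "'n dof \<Rightarrow> 'n pw_field \<Rightarrow> real" where
  "dof_value (Boundary_Dof f F q) \<tau> = face_integral v f (\<lambda>x. (\<tau> (adj F) x *v nrm F) \<bullet> q x)"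
| "dof_value (Normal_Dof f i j q) \<tau> = face_integral v f (\<lambda>x. (nb f i \<bullet> (\<tau> (adj f) x *v nb f j)) * q x)"
| "dof_value (Tangential_Dof F f i q) \<tau> = face_integral v f (\<lambda>x. (tb f i \<bullet> (\<tau> (adj F) x *v nrm F)) * q x)"
| "dof_value (Cell_Dof m q) \<tau> = (LINT x|lebesgue_on (simplex_of v (cell d m)). \<tau> m x \<bullet> q x)"

lemma tangential_blockD:
  assumes "Tangential_Block F f \<in> blocks"
  shows "F \<in> interior_facets" "f \<subseteq> F" "f \<in> faces"
proof -
  show F: "F \<in> interior_facets" "f \<subseteq> F" using assms by (auto simp: blocks_def)
  have "f \<noteq> {}" using assms by (auto simp: blocks_def)
  obtain j where j: "adj F \<le> d" "j \<in> opp (adj F)" "opp (adj F) - {j} = F"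
    using facet_facts[OF F(1)] .
  have "card (opp (adj F) - {j}) = d" using j(1,2) card_opp[of "adj F"] by simp
  then have "card F = d" unfolding j(3) .
  then have "card f \<le> d" using card_mono[OF _ F(2)] d_pos card_ge_0_finite[of F] by simp
  moreover have "f \<subseteq> opp (adj F)" using F(2) j(3) by blast
  ultimately show "f \<in> faces" unfolding faces_iff is_face_def using \<open>f \<noteq> {}\<close> j(1) by blast
qed

lemma block_cases:
  assumes "i \<in> blocks"
  obtains (face) f where "i = Face_Block f" "f \<in> faces"
  | (tangential) F f where "i = Tangential_Block F f" "F \<in> interior_facets" "f \<subseteq> F" "f \<in> faces"
  | (cell) m where "i = Cell_Block m" "m \<le> d"
proof (cases i)
  case (Face_Block f)
  then show ?thesis using assms face by (auto simp: blocks_def)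
next
  case (Tangential_Block F f)
  then have "Tangential_Block F f \<in> blocks" using assms by simp
  from tangential[OF Tangential_Block tangential_blockD[OF this]] show ?thesis .
next
  case (Cell_Block m)
  then show ?thesis using assms cell by (auto simp: blocks_def)
qed

lemma subspace_block_space: "i \<in> blocks \<Longrightarrow> subspace (block_space i)"
proof (erule block_cases)
  fix m assume "i = Cell_Block m" "m \<le> d"
  moreover have "subspace (cell_bubbles v nrm k m)"
    using cell_test_bases[OF \<open>m \<le> d\<close>] subspace_span[of "Qcell m"] by (simp add: basis_of_def)
  ultimately show "subspace (block_space i)"
    using linear_subspace_image[OF linear_extend_from_cell] by simp
qed (simp_all add: subspace_bubble_space tangential_normal_space_eq)

lemma block_space_continuous: "i \<in> blocks \<Longrightarrow> block_space i \<subseteq> piecewise_continuous"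
  by (erule block_cases)
    (simp_all add: bubble_space_continuous tangential_normal_space_eq cell_fields_continuous face_facts)

lemma span_blocks_continuous: "span (\<Union>(block_space ` blocks)) \<subseteq> piecewise_continuous"
  by (rule span_minimal[OF _ subspace_piecewise_continuous]) (use block_space_continuous in blast)

lemma finite_blocks: "finite blocks"
proof -
  have "faces \<subseteq> Pow {..Suc d}" using faces_iff is_face_le by blast
  then have f: "finite faces" by (rule finite_subset) simp
  have "interior_facets \<subseteq> faces" using interior_simplices_iff[OF d1(1)] by (auto simp: interior_facets_def)
  then have "finite interior_facets" using f by (rule finite_subset)
  moreover have "finite F" if "F \<in> interior_facets" for F
    using that \<open>interior_facets \<subseteq> faces\<close> face_facts(3) by blast
  ultimately show ?thesis using f unfolding blocks_def by (intro finite_UnI finite_imageI finite_SigmaI) auto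
qed

lemma Q_basis: "f \<in> faces \<Longrightarrow> basis_of (Q f) (face_polys v (int k - int (card f)) f)"
  using test_bases[OF face_facts(5), of f f] R_simplices_iff[OF face_facts(5), of f f] face_facts(6)[of f] by simp

lemma Qvec_basis:
  "f \<in> faces \<Longrightarrow> Suc d \<notin> f \<Longrightarrow> basis_of (Qvec f) (face_vec_polys v (int k - int (card f)) f)"
  using vec_test_bases[OF face_facts(5), of f f] T_simplices_iff[OF face_facts(5), of f f] face_facts(6)[of f] by simp

lemma basis_mem: "basis_of B W \<Longrightarrow> q \<in> B \<Longrightarrow> q \<in> W"
  by (auto simp: basis_of_def intro: span_base)

lemma normal_basis:
  assumes "f \<in> faces" "Suc d \<in> f"
  shows "indexed_basis_of (nb f) {1..d + 1 - card f} (normal_vectors v f)"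
proof -
  have "f \<in> interior_simplices d (card f - 1)"
    using interior_simplices_iff[OF face_facts(5)[OF assms(1)]] assms face_facts(6)[OF assms(1)] by simp
  moreover have "d - (card f - 1) = d + 1 - card f" using face_facts(4,6)[OF assms(1)] by linarith
  ultimately show ?thesis using normal_bases[OF face_facts(5)[OF assms(1)], of f] by simp
qed

lemma normal_basis_mem:
  assumes "f \<in> faces" "Suc d \<in> f" "i \<in> {1..d + 1 - card f}"
  shows "nb f i \<in> normal_vectors v f"
  using basis_mem[of "nb f ` {1..d + 1 - card f}" "normal_vectors v f"] normal_basis[OF assms(1,2)] assms(3)
  by (simp add: indexed_basis_of_def)

lemma Q_continuous: "f \<in> faces \<Longrightarrow> q \<in> Q f \<Longrightarrow> continuous_on (simplex_of v f) q"
  by (rule continuous_on_face_polys[OF basis_mem[OF Q_basis]])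

lemma Qvec_continuous:
  assumes "f \<in> faces" "Suc d \<notin> f" "q \<in> Qvec f"
  shows "continuous_on (simplex_of v f) q"
proof -
  have "q \<in> face_vec_polys v (int k - int (card f)) f" using basis_mem[OF Qvec_basis] assms by blast
  then have "continuous_on (simplex_of v f) (\<lambda>x. q x $ i)" for i
    by (intro continuous_on_face_polys[where r = "int k - int (card f)"]) (simp add: face_vec_polys_def)
  then have "continuous_on (simplex_of v f) (\<lambda>x. \<chi> i. q x $ i)" by (rule continuous_on_vec_lambda)
  then show ?thesis by simp
qed

lemma trace_continuous:
  assumes "\<tau> \<in> piecewise_continuous" "m \<le> d" "f \<subseteq> opp m"
  shows "continuous_on (simplex_of v f) (\<tau> m)"
  using assms(1,2) continuous_on_subset[OF _ simplex_subset_cell[OF assms(2,3)]]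
  by (auto simp: piecewise_continuous_def)

lemma facet_adj:
  assumes "F \<in> interior_facets" "f \<subseteq> F"
  shows "adj F \<le> d" "f \<subseteq> opp (adj F)"
proof -
  obtain j where j: "adj F \<le> d" "j \<in> opp (adj F)" "opp (adj F) - {j} = F" using facet_facts[OF assms(1)] .
  then show "adj F \<le> d" "f \<subseteq> opp (adj F)" using assms(2) by blast+
qed

text \<open>For piecewise continuous fields all integrands are continuous on a compact face or cell,
  so the integrals may be split.\<close>

lemma dof_value_add:
  assumes i: "i \<in> blocks" and b: "b \<in> block_dofs i"
    and xy: "x \<in> piecewise_continuous" "y \<in> piecewise_continuous"
  shows "dof_value b (x + y) = dof_value b x + dof_value b y"
  using i
proof (cases rule: block_cases)
  case (face f)
  note ff = face_facts[OF face(2)]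
  show ?thesis
  proof (cases "Suc d \<in> f")
    case True
    then obtain i j q where q: "b = Normal_Dof f i j q" "q \<in> Q f" using b face by auto
    have c: "continuous_on (simplex_of v f) (\<lambda>u. (nb f i \<bullet> (\<tau> (adj f) u *v nb f j)) * q u)"
      if "\<tau> \<in> piecewise_continuous" for \<tau>
      by (intro continuous_intros Q_continuous[OF face(2) q(2)]
          continuous_on_compose2[OF linear_continuous_on[OF linear_linear[THEN iffD2, OF linear_mult_vec], of UNIV]]
          trace_continuous[OF that ff(7,8)]) auto
    show ?thesis
      using face_integral_add[OF ff(1) c[OF xy(1)] c[OF xy(2)]]
      by (simp add: q(1) matrix_vector_mult_add_rdistrib inner_add_right distrib_right)
  next
    case False
    then obtain F q where q: "b = Boundary_Dof f F q" "q \<in> Qvec f" "F \<in> T_simplices d (d - 1)" "f \<subseteq> F"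
      using b face by auto
    obtain l where l: "l \<le> d" "F = opp (Suc d) - {l}" using q(3) boundary_facet by blast
    have m: "adj F \<le> d" "f \<subseteq> opp (adj F)" using boundary_facet_adj[OF l(1)] q(4) l by auto
    have c: "continuous_on (simplex_of v f) (\<lambda>u. (\<tau> (adj F) u *v nrm F) \<bullet> q u)"
      if "\<tau> \<in> piecewise_continuous" for \<tau>
      by (intro continuous_intros Qvec_continuous[OF face(2) False q(2)]
          continuous_on_compose2[OF linear_continuous_on[OF linear_linear[THEN iffD2, OF linear_mult_vec], of UNIV]]
          trace_continuous[OF that m]) auto
    show ?thesis
      using face_integral_add[OF ff(1) c[OF xy(1)] c[OF xy(2)]]
      by (simp add: q(1) matrix_vector_mult_add_rdistrib inner_add_left)
  qed
next
  case (tangential F f)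
  then obtain i q where q: "b = Tangential_Dof F f i q" "q \<in> Q f" using b by auto
  have c: "continuous_on (simplex_of v f) (\<lambda>u. (tb f i \<bullet> (\<tau> (adj F) u *v nrm F)) * q u)"
    if "\<tau> \<in> piecewise_continuous" for \<tau>
    by (intro continuous_intros Q_continuous[OF tangential(4) q(2)]
        continuous_on_compose2[OF linear_continuous_on[OF linear_linear[THEN iffD2, OF linear_mult_vec], of UNIV]]
        trace_continuous[OF that facet_adj[OF tangential(2,3)]]) auto
  show ?thesis
    using face_integral_add[OF face_facts(1)[OF tangential(4)] c[OF xy(1)] c[OF xy(2)]]
    by (simp add: q(1) matrix_vector_mult_add_rdistrib inner_add_right distrib_right)
next
  case (cell m)
  then obtain q where q: "b = Cell_Dof m q" "q \<in> Qcell m" using b by auto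
  have comp: "compact (simplex_of v (cell d m))"
    unfolding cell_eq_opp[OF cell(2)] by (rule compact_simplex_of) simp
  have "q \<in> cell_sym_polys v k m" using basis_mem[OF cell_test_bases[OF cell(2)] q(2)] by (auto simp: cell_bubbles_def)
  then have "integrable (lebesgue_on (simplex_of v (cell d m))) (\<lambda>u. \<tau> m u \<bullet> q u)"
    if "\<tau> \<in> piecewise_continuous" for \<tau>
    using that cell(2)
    by (intro integrable_on_compact[OF comp] continuous_on_inner)
      (auto simp: piecewise_continuous_def cell_polys_continuous)
  then show ?thesis using xy by (simp add: q(1) inner_add_left)
qed

section \<open>Functionals that do not see a block of equal or higher rank\<close>

lemma face_integral_zero: "(\<And>x. x \<in> simplex_of v f \<Longrightarrow> u x = 0) \<Longrightarrow> face_integral v f u = 0"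
  using face_integral_cong[of v f u "\<lambda>x. 0 * 0"] face_integral_cmult[of f 0 "\<lambda>_. 0"] by simp

text \<open>The trace is assumed to vanish from every cell around \<open>f\<close>, so it does not
  matter from which of them a functional reads.\<close>

lemma dof_zero_of_trace:
  assumes f: "f \<in> faces"
    and zero: "\<And>m x. m \<le> d \<Longrightarrow> f \<subseteq> opp m \<Longrightarrow> x \<in> simplex_of v f \<Longrightarrow> s m x = 0"
    and b: "b \<in> block_dofs (Face_Block f) \<or> (\<exists>F\<in>interior_facets. f \<subseteq> F \<and> b \<in> block_dofs (Tangential_Block F f))"
  shows "dof_value b s = 0"
proof (cases b)
  case (Boundary_Dof f' F q)
  then have F: "f' = f" "F \<in> T_simplices d (d - 1)" "f \<subseteq> F" using b by (auto split: if_splits)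
  obtain l where l: "l \<le> d" "F = opp (Suc d) - {l}" using F(2) boundary_facet by blast
  have m: "adj F \<le> d" "f \<subseteq> opp (adj F)" using boundary_facet_adj[OF l(1)] F(3) l by auto
  show ?thesis unfolding Boundary_Dof F(1) dof_value.simps
    by (rule face_integral_zero) (simp add: zero[OF m])
next
  case (Normal_Dof f' i j q)
  then have "f' = f" using b by (auto split: if_splits)
  then show ?thesis unfolding Normal_Dof dof_value.simps
    using zero[OF face_facts(7,8)[OF f]] by (intro face_integral_zero) simp
next
  case (Tangential_Dof F f' i q)
  then have F: "f' = f" "F \<in> interior_facets" "f \<subseteq> F" using b by (auto split: if_splits)
  show ?thesis unfolding Tangential_Dof F(1) dof_value.simps
    by (rule face_integral_zero) (simp add: zero[OF facet_adj[OF F(2,3)]])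
next
  case (Cell_Dof m q)
  then show ?thesis using b by (auto split: if_splits)
qed

text \<open>If \<open>f\<close> contains the barycenter, the functional tests a normal-normal
  component. Otherwise it tests a boundary facet, and this differs from \<open>F\<close>, which
  contains the barycenter.\<close>

lemma tangential_space_boundary_dof:
  assumes F: "F \<in> interior_facets" "f \<subseteq> F" and f: "f \<in> faces"
    and s: "s \<in> tangential_normal_space v nrm k F f" and b: "b \<in> block_dofs (Face_Block f)"
  shows "dof_value b s = 0"
proof (cases "Suc d \<in> f")
  case True
  then obtain i j q where q: "b = Normal_Dof f i j q" "i \<in> {1..d + 1 - card f}" "j \<in> {1..d + 1 - card f}"
    using b by auto
  show ?thesis
    using tangential_space_normal_form[OF normal_basis_mem[OF f True q(2)] normal_basis_mem[OF f True q(3)] s] q(1)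
    by (simp add: face_integral_zero)
next
  case False
  then obtain G q where q: "b = Boundary_Dof f G q" "G \<in> T_simplices d (d - 1)" "f \<subseteq> G"
    using b by auto
  obtain l where l: "l \<le> d" "G = opp (Suc d) - {l}" using q(2) boundary_facet by blast
  note adj = boundary_facet_adj[OF l(1)]
  have "s l x *v nv l (Suc d) = 0" for x
  proof (rule tangential_space_other_face[OF l(1) face_facts(2)[OF f] _ _ _ F(2) _ s])
    show "f \<subseteq> opp l" "Suc d \<in> opp l - f" using q(3) l adj(2) False by (auto simp: opp_def)
    show "F \<in> interior_simplices d (d - 1)" using F(1) by (simp add: interior_facets_def)
    then show "F \<noteq> opp l - {Suc d}" using interior_simplices_iff[OF d1(1)] by blast
  qed
  then show ?thesis using q(1) l adj by (simp add: face_integral_zero)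
qed

lemma tangential_space_other_dof:
  assumes F: "F \<in> interior_facets" "f \<subseteq> F" and G: "G \<in> interior_facets" "f \<subseteq> G" "F \<noteq> G" and f: "f \<in> faces"
    and s: "s \<in> tangential_normal_space v nrm k F f" and b: "b \<in> block_dofs (Tangential_Block G f)"
  shows "dof_value b s = 0"
proof -
  obtain j where j: "adj G \<le> d" "j \<in> opp (adj G)" "opp (adj G) - {j} = G" using facet_facts[OF G(1)] .
  have "s (adj G) x *v nv (adj G) j = 0" for x
  proof (rule tangential_space_other_face[OF j(1) face_facts(2)[OF f] _ _ _ F(2) _ s])
    show "f \<subseteq> opp (adj G)" "j \<in> opp (adj G) - f" using j G(2) by auto
    show "F \<in> interior_simplices d (d - 1)" using F(1) by (simp add: interior_facets_def)
    show "F \<noteq> opp (adj G) - {j}" using G(3) j(3) by simp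
  qed
  then have "s (adj G) x *v nrm G = 0" for x using j(3) by simp
  then show ?thesis using b by (auto simp: face_integral_zero)
qed

text \<open>Each functional on a face multiplies the field by at least one vector normal to the
  face. A cell bubble kills these vectors on its own cell and is zero on all others.\<close>

lemma cell_space_face_dof:
  assumes m: "m \<le> d" and p: "p \<in> cell_bubbles v nrm k m" and f: "f \<in> faces"
    and b: "b \<in> block_dofs (Face_Block f) \<or> (\<exists>F\<in>interior_facets. f \<subseteq> F \<and> b \<in> block_dofs (Tangential_Block F f))"
  shows "dof_value b (extend_from_cell m p) = 0"
proof -
  have facet: "extend_from_cell m p m' x *v nv m' i = 0"
    if "m' \<le> d" "f \<subseteq> opp m' - {i}" "i \<in> opp m'" "x \<in> simplex_of v f" for m' i x
    using cell_bubble_facet[OF m p _ _ that(4), of i] that by (auto simp: extend_from_cell_def)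
  show ?thesis
  proof (cases b)
    case (Boundary_Dof f' F q)
    then have F: "f' = f" "F \<in> T_simplices d (d - 1)" "f \<subseteq> F" using b by (auto split: if_splits)
    obtain l where l: "l \<le> d" "F = opp (Suc d) - {l}" using F(2) boundary_facet by blast
    note adj = boundary_facet_adj[OF l(1)]
    have "extend_from_cell m p l x *v nv l (Suc d) = 0" if "x \<in> simplex_of v f" for x
      by (rule facet[OF l(1) _ _ that]) (use F(3) l adj(2) in \<open>auto simp: opp_def\<close>)
    then show ?thesis unfolding Boundary_Dof F(1) dof_value.simps using l adj
      by (intro face_integral_zero) simp
  next
    case (Normal_Dof f' i j q)
    then have ij: "f' = f" "Suc d \<in> f" "j \<in> {1..d + 1 - card f}" using b by (auto split: if_splits)
    note nj = normal_basis_mem[OF f ij(2,3)]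
    have "extend_from_cell m p (adj f) x *v nb f j = 0" if "x \<in> simplex_of v f" for x
      using cell_bubble_normal[OF m p _ face_facts(2)[OF f] that nj] face_facts(8)[OF f]
      by (auto simp: extend_from_cell_def)
    then show ?thesis unfolding Normal_Dof ij(1) dof_value.simps by (intro face_integral_zero) simp
  next
    case (Tangential_Dof F f' i q)
    then have F: "f' = f" "F \<in> interior_facets" "f \<subseteq> F" using b by (auto split: if_splits)
    obtain j where j: "adj F \<le> d" "j \<in> opp (adj F)" "opp (adj F) - {j} = F" using facet_facts[OF F(2)] .
    have "extend_from_cell m p (adj F) x *v nv (adj F) j = 0" if "x \<in> simplex_of v f" for x
      by (rule facet[OF j(1) _ j(2) that]) (use F(3) j in auto)
    then have "extend_from_cell m p (adj F) x *v nrm F = 0" if "x \<in> simplex_of v f" for x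
      using j(3) that by simp
    then show ?thesis unfolding Tangential_Dof F(1) dof_value.simps by (intro face_integral_zero) simp
  next
    case (Cell_Dof m q)
    then show ?thesis using b by (auto split: if_splits)
  qed
qed

text \<open>A bubble on \<open>g\<close> is seen on \<open>f\<close> only if
  \<open>g \<subseteq> f\<close>. As the rank order gives \<open>card f \<le> card g\<close>, only
  \<open>g = f\<close> remains, and there the tensor components decide.\<close>

lemma dof_triangular:
  assumes i: "i \<in> blocks" and j: "j \<in> blocks" and ij: "i \<noteq> j" "block_rank j \<le> block_rank i"
    and s: "s \<in> block_space i" and b: "b \<in> block_dofs j"
  shows "dof_value b s = 0"
proof -
  have bubble: "dof_value b s = 0"
    if f: "f \<in> faces" and g: "g \<in> faces" "\<not> g \<subseteq> f" and s: "s \<in> bubble_space v k g V"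
      and b: "b \<in> block_dofs (Face_Block f) \<or> (\<exists>F\<in>interior_facets. f \<subseteq> F \<and> b \<in> block_dofs (Tangential_Block F f))"
    for f g V
    by (rule dof_zero_of_trace[OF f _ b])
      (rule bubble_space_vanish[OF face_facts(1)[OF f] face_facts(1)[OF g(1)] g(2) s])
  have card: "\<not> g \<subseteq> f" if "f \<in> faces" "card f \<le> card g" "g \<noteq> f" for f g
    using that card_seteq[of f g] face_facts(3) by blast
  show ?thesis
    using i
  proof (cases rule: block_cases)
    case (face g)
    obtain V where V: "s \<in> bubble_space v k g V" using s face(1) by (auto split: if_splits)
    show ?thesis
      using j
    proof (cases rule: block_cases)
      case (face f)
      then show ?thesis using bubble[OF _ \<open>g \<in> faces\<close> card V] b ij \<open>i = Face_Block g\<close> by auto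
    next
      case (tangential F f)
      \<comment> \<open>The rank of a tangential block is odd and that of a face block even, so the
        inequality of the ranks makes that of the cardinalities strict.\<close>
      then have "card f < card g" using ij \<open>i = Face_Block g\<close> by simp
      then have "\<not> g \<subseteq> f" using card[OF tangential(4), of g] by auto
      then show ?thesis using bubble[OF tangential(4) \<open>g \<in> faces\<close> _ V] b tangential by blast
    next
      case (cell m)
      then show ?thesis using ij \<open>i = Face_Block g\<close> face_facts(4)[OF \<open>g \<in> faces\<close>] by simp
    qed
  next
    case (tangential G g)
    have V: "s \<in> bubble_space v k g (tangential_tensor G g ` tangent v g)"
      using s tangential(1) by (simp add: tangential_normal_space_eq)
    have s': "s \<in> tangential_normal_space v nrm k G g" using s tangential(1) by simp
    note G = tangential
    show ?thesis
      using j
    proof (cases rule: block_cases)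
      case (face f)
      have "card f \<le> card g" using ij face(1) G(1) by simp
      then show ?thesis
        using bubble[OF face(2) G(4) card[OF face(2)] V] tangential_space_boundary_dof[OF G(2,3,4) s'] b face(1)
        by (cases "g = f") auto
    next
      case (tangential F f)
      have c: "card f \<le> card g" using ij tangential(1) G(1) by simp
      show ?thesis
      proof (cases "g = f")
        case True
        then show ?thesis
          using tangential_space_other_dof[OF G(2,3) tangential(2) _ _ G(4) s'] b ij tangential G(1) by auto
      next
        case False
        then show ?thesis using bubble[OF tangential(4) G(4) card[OF tangential(4) c] V] b tangential by blast
      qed
    next
      case (cell m)
      then show ?thesis using ij G(1) face_facts(4)[OF G(4)] by simp
    qed
  next
    case (cell m)
    then obtain p where p: "p \<in> cell_bubbles v nrm k m" "s = extend_from_cell m p" using s by auto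
    note C = cell
    show ?thesis
      using j
    proof (cases rule: block_cases)
      case (face f)
      then show ?thesis using cell_space_face_dof[OF C(2) p(1) face(2)] b p(2) by blast
    next
      case (tangential F f)
      then show ?thesis using cell_space_face_dof[OF C(2) p(1) tangential(4)] b p(2) by blast
    next
      case (cell m')
      then have "m' \<noteq> m" using ij C(1) by simp
      then show ?thesis using b cell(1) p(2) by (auto simp: extend_from_cell_def)
    qed
  qed
qed

end

section \<open>Unisolvence\<close>

context unisolvence_data
begin

text \<open>Bases are supplied for positive dimension only; at a vertex the tangent space is zero
  and the empty family is a basis.\<close>

lemma tangent_basis:
  assumes "F \<in> interior_facets" "f \<subseteq> F" "f \<in> faces"
  shows "indexed_basis_of (tb f) {1..card f - 1} (tangent v f)"
proof (cases "card f - 1 = 0")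
  case True
  then have "card f = 1" using face_facts(6)[OF assms(3)] by simp
  then obtain i where "f = {i}" using card_1_singletonE by blast
  moreover have "span {0 :: real^'n} = {0}" using span_insert_0[of "{}"] by simp
  ultimately have "tangent v f = {0}" by (simp add: tangent_def)
  then show ?thesis using True by (simp add: indexed_basis_of_def basis_of_def independent_empty)
next
  case False
  have "f \<in> subsimplices (card f - 1) F" using assms face_facts(6)[OF assms(3)] by (simp add: subsimplices_def)
  then show ?thesis using tangent_bases[of "card f - 1" F f] False assms(1) by (simp add: interior_facets_def)
qed

lemma block_unisolvent:
  assumes "i \<in> blocks"
  shows "\<exists>!s. s \<in> block_space i \<and> (\<forall>b\<in>block_dofs i. dof_value b s = a b)"
  using assms
proof (cases rule: block_cases)
  case (face f)
  note ff = face_facts[OF face(2)]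
  show ?thesis
  proof (cases "Suc d \<in> f")
    case True
    have "(\<forall>b\<in>block_dofs i. dof_value b s = a b) \<longleftrightarrow>
      (\<forall>(i, j)\<in>{(i, j). 1 \<le> i \<and> i \<le> j \<and> j \<le> d + 1 - card f}. \<forall>q\<in>Q f.
        face_integral v f (\<lambda>x. (nb f i \<bullet> (s (adj f) x *v nb f j)) * q x) = a (Normal_Dof f i j q))" (is "?A \<longleftrightarrow> ?B") for s
    proof
      assume A: ?A
      have "dof_value (Normal_Dof f i' j q) s = a (Normal_Dof f i' j q)"
        if "1 \<le> i' \<and> i' \<le> j \<and> j \<le> d + 1 - card f" "q \<in> Q f" for i' j q
      proof -
        have "Normal_Dof f i' j q \<in> block_dofs i" using that True by (simp add: face(1))
        then show ?thesis using A by blast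
      qed
      then show ?B by auto
    next
      assume ?B
      then show ?A using True by (auto simp: face(1))
    qed
    then show ?thesis
      using interior_normal_block[OF ff(1,7,8) normal_basis[OF face(2) True] Q_basis[OF face(2)],
          of "\<lambda>i j q. a (Normal_Dof f i j q)"] True
      by (simp only: face(1) block_space.simps if_True)
  next
    case False
    \<comment> \<open>The facets of T containing \<open>f\<close> are the F_i with \<open>i\<close>
      outside \<open>f\<close>, and the trace on F_i comes from T_i; so facets are replaced by
      vertex numbers.\<close>
    have "(\<forall>b\<in>block_dofs i. dof_value b s = a b) \<longleftrightarrow>
      (\<forall>i\<in>{..d} - f. \<forall>q\<in>Qvec f. face_integral v f (\<lambda>x. (s i x *v nv (Suc d) i) \<bullet> q x) =
        a (Boundary_Dof f (opp (Suc d) - {i}) q))" (is "?A \<longleftrightarrow> ?B") for s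
    proof
      assume A: ?A
      show ?B
      proof (intro ballI)
        fix i' q assume i': "i' \<in> {..d} - f" and q: "q \<in> Qvec f"
        let ?F = "opp (Suc d) - {i'}"
        have "f \<subseteq> {..d}" using is_face_le[OF ff(1)] False by (fastforce simp: le_Suc_eq)
        then have "f \<subseteq> ?F" using i' unfolding vertices_eq_opp by blast
        moreover have "?F \<in> T_simplices d (d - 1)" using i' boundary_facet by blast
        ultimately have "Boundary_Dof f ?F q \<in> block_dofs i" using q False by (simp add: face(1))
        then have "dof_value (Boundary_Dof f ?F q) s = a (Boundary_Dof f ?F q)" using A by blast
        then show "face_integral v f (\<lambda>x. (s i' x *v nv (Suc d) i') \<bullet> q x) = a (Boundary_Dof f ?F q)"
          using boundary_facet_adj(1)[of i'] i' by simp
      qed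
    next
      assume B: ?B
      show ?A
      proof
        fix b assume "b \<in> block_dofs i"
        then obtain F q where b: "b = Boundary_Dof f F q" "F \<in> T_simplices d (d - 1)" "f \<subseteq> F" "q \<in> Qvec f"
          using False by (auto simp: face(1))
        obtain l where l: "l \<le> d" "F = opp (Suc d) - {l}" using b(2) boundary_facet by blast
        then have "l \<in> {..d} - f" using b(3) by auto
        then show "dof_value b s = a b"
          using B b(4) boundary_facet_adj(1)[OF l(1)] by (simp add: b(1) l(2))
      qed
    qed
    moreover have "f \<in> T_simplices d (card f - 1)" using T_simplices_iff[OF ff(5)] face(2) False ff(6) by simp
    then have "base f \<in> f" "f \<subseteq> {..d}"
      using base_vertex[OF ff(5)] by (auto simp: T_simplices_def subsimplices_def)
    ultimately show ?thesis
      using boundary_block[OF _ _ ff(4) Qvec_basis[OF face(2) False],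
          of "base f" "\<lambda>i q. a (Boundary_Dof f (opp (Suc d) - {i}) q)"] False
      by (simp only: face(1) block_space.simps if_False)
  qed
next
  case (tangential F f)
  obtain j where j: "adj F \<le> d" "j \<in> opp (adj F)" "opp (adj F) - {j} = F" using facet_facts[OF tangential(2)] .
  have "(\<forall>b\<in>block_dofs i. dof_value b s = a b) \<longleftrightarrow>
    (\<forall>i\<in>{1..card f - 1}. \<forall>q\<in>Q f.
      face_integral v f (\<lambda>x. (tb f i \<bullet> (s (adj F) x *v nrm F)) * q x) = a (Tangential_Dof F f i q))" for s
  proof -
    have "(\<forall>b\<in>block_dofs i. dof_value b s = a b) \<longleftrightarrow> (\<forall>i\<in>{1..card f - 1}. \<forall>q\<in>Q f.
        dof_value (Tangential_Dof F f i q) s = a (Tangential_Dof F f i q))"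
      unfolding tangential(1) block_dofs.simps by blast
    then show ?thesis by (simp only: dof_value.simps)
  qed
  then show ?thesis
    using tangential_block[OF face_facts(1)[OF tangential(4)] _ j(1,2) tangent_basis[OF tangential(2-4)]
        Q_basis[OF tangential(4)], of "\<lambda>i q. a (Tangential_Dof F f i q)"] tangential(3)
    by (simp only: tangential(1) block_space.simps j(3))
next
  case (cell m)
  have "(\<forall>b\<in>block_dofs i. dof_value b s = a b) \<longleftrightarrow>
    (\<forall>q\<in>Qcell m. (LINT x|lebesgue_on (simplex_of v (cell d m)). s m x \<bullet> q x) = a (Cell_Dof m q))" for s
    by (auto simp: cell(1))
  then show ?thesis
    using cell_block[OF cell(2) cell_test_bases[OF cell(2)], of "\<lambda>q. a (Cell_Dof m q)"]
    by (simp only: cell(1) block_space.simps)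
qed

text \<open>A regrouping of the generators by blocks. Merging the two tensor spaces of a boundary
  face is harmless, since a generator uses a tensor from one of them.\<close>

lemma Sigma_div_eq: "Sigma_div v nrm base k = span (\<Union>(block_space ` blocks))" (is "_ = ?B")
proof -
  have space: "block_space i \<subseteq> ?B" if "i \<in> blocks" for i
    using that span_superset[of "\<Union>(block_space ` blocks)"] by blast
  have faceb: "block_space (Face_Block f) \<subseteq> ?B" if "f \<in> faces" for f
    by (rule space) (use that in \<open>simp add: blocks_def\<close>)
  have sub: "bubble_space v k f V \<subseteq> ?B" if "bubble_space v k f (V \<union> W) \<subseteq> ?B \<or> bubble_space v k f (W \<union> V) \<subseteq> ?B" for f V W
  proof -
    have "bubble_space v k f V \<subseteq> bubble_space v k f (V \<union> W)" "bubble_space v k f V \<subseteq> bubble_space v k f (W \<union> V)"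
      unfolding bubble_space_eq by (intro span_mono; blast)+
    then show ?thesis using that by blast
  qed
  let ?X1 = "\<Union>l<d. (\<Union>f \<in> T_simplices d l.
          bubble_space v k f (constant_tensors (normal_sym v f)) \<union>
          bubble_space v k f (enrichment_space v (base f) f)) \<union>
        (\<Union>f \<in> interior_simplices d l.
          bubble_space v k f
            (constant_tensors (sym_tensor (normal_vectors v f) (normal_vectors v f))))"
  let ?X2 = "\<Union>F \<in> interior_simplices d (d - 1). \<Union>l<d. \<Union>f \<in> subsimplices l F. tangential_normal_space v nrm k F f"
  let ?X3 = "\<Union>m\<le>d. extend_from_cell m ` cell_bubbles v nrm k m"
  have Sig: "Sigma_div v nrm base k = span (?X1 \<union> ?X2 \<union> ?X3)"
    by (simp only: Sigma_div_def Let_def dim)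
  have X1: "?X1 \<subseteq> ?B"
  proof (intro UN_least Un_least)
    fix l f assume l: "l \<in> {..<d}" and f: "f \<in> T_simplices d l"
    then have "f \<in> faces" "Suc d \<notin> f" using T_simplices_iff[of l f] by auto
    then have "bubble_space v k f (constant_tensors (normal_sym v f) \<union> enrichment_space v (base f) f) \<subseteq> ?B"
      using faceb[of f] by simp
    then show "bubble_space v k f (constant_tensors (normal_sym v f)) \<subseteq> ?B"
      "bubble_space v k f (enrichment_space v (base f) f) \<subseteq> ?B" using sub by blast+
  next
    fix l f assume l: "l \<in> {..<d}" and f: "f \<in> interior_simplices d l"
    then have "f \<in> faces" "Suc d \<in> f" using interior_simplices_iff[of l f] by auto
    then show "bubble_space v k f (constant_tensors (sym_tensor (normal_vectors v f) (normal_vectors v f))) \<subseteq> ?B"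
      using faceb[of f] by simp
  qed
  have X2: "?X2 \<subseteq> ?B"
  proof (intro UN_least)
    fix F l f assume "F \<in> interior_simplices d (d - 1)" "f \<in> subsimplices l F"
    then have "Tangential_Block F f \<in> blocks" by (auto simp: blocks_def interior_facets_def subsimplices_def)
    from space[OF this] show "tangential_normal_space v nrm k F f \<subseteq> ?B" by simp
  qed
  have X3: "?X3 \<subseteq> ?B"
  proof (intro UN_least)
    fix m assume "m \<in> {..d}"
    then have "Cell_Block m \<in> blocks" by (simp add: blocks_def)
    from space[OF this] show "extend_from_cell m ` cell_bubbles v nrm k m \<subseteq> ?B" by simp
  qed
  have "Sigma_div v nrm base k \<subseteq> ?B"
    unfolding Sig by (rule span_minimal[OF Un_least[OF Un_least[OF X1 X2] X3] subspace_span])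
  moreover have "?B \<subseteq> Sigma_div v nrm base k"
  proof (rule span_minimal)
    show "subspace (Sigma_div v nrm base k)" unfolding Sig by (rule subspace_span)
    have "?X1 \<union> ?X2 \<union> ?X3 \<subseteq> Sigma_div v nrm base k" unfolding Sig by (rule span_superset)
    then have S1: "?X1 \<subseteq> Sigma_div v nrm base k" and S2: "?X2 \<subseteq> Sigma_div v nrm base k"
      and S3: "?X3 \<subseteq> Sigma_div v nrm base k" by (simp_all only: Un_subset_iff)
    show "\<Union>(block_space ` blocks) \<subseteq> Sigma_div v nrm base k"
    proof (rule UN_least)
      fix i assume "i \<in> blocks"
      then show "block_space i \<subseteq> Sigma_div v nrm base k"
      proof (cases rule: block_cases)
        case (face f)
        note ff = face_facts[OF face(2)]
        show ?thesis
        proof (cases "Suc d \<in> f")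
          case True
          then have "f \<in> interior_simplices d (card f - 1)"
            using interior_simplices_iff[OF ff(5)] face(2) ff(6) by simp
          then have "block_space i \<subseteq> ?X1" using ff(5) True by (simp only: face(1) block_space.simps if_True) blast
          then show ?thesis using S1 by (rule subset_trans)
        next
          case False
          then have f: "f \<in> T_simplices d (card f - 1)" using T_simplices_iff[OF ff(5)] face(2) ff(6) by simp
          let ?C = "constant_tensors (normal_sym v f)" and ?E = "enrichment_space v (base f) f"
          have "bubble_space v k f ?C \<subseteq> ?X1" "bubble_space v k f ?E \<subseteq> ?X1" using ff(5) f by blast+
          from this[THEN subset_trans, OF S1]
          have CE: "bubble_space v k f ?C \<subseteq> Sigma_div v nrm base k" "bubble_space v k f ?E \<subseteq> Sigma_div v nrm base k" .
          have "bubble_space v k f (?C \<union> ?E) \<subseteq> Sigma_div v nrm base k"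
            unfolding bubble_space_eq
          proof (rule span_minimal)
            show "subspace (Sigma_div v nrm base k)" unfolding Sig by (rule subspace_span)
            have gen: "bubble_field f p A \<in> bubble_space v k f V"
              if "p \<in> extended_polys v (int k - int (card f)) f" "A \<in> V" for p A V
              by (rule bubble_field_in_space[OF that(1) span_base[OF that(2)]])
            show "{bubble_field f p A |p A. p \<in> extended_polys v (int k - int (card f)) f \<and> A \<in> ?C \<union> ?E}
                \<subseteq> Sigma_div v nrm base k"
              using gen CE by blast
          qed
          then show ?thesis using False by (simp only: face(1) block_space.simps if_False)
        qed
      next
        case (tangential F f)
        note ff = face_facts[OF tangential(4)]
        have "F \<in> interior_simplices d (d - 1)" "f \<in> subsimplices (card f - 1) F"
          using tangential(2,3) ff(6) by (auto simp: interior_facets_def subsimplices_def)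
        then have "block_space i \<subseteq> ?X2" using ff(5) by (simp only: tangential(1) block_space.simps) blast
        then show ?thesis using S2 by (rule subset_trans)
      next
        case (cell m)
        then have "block_space i \<subseteq> ?X3" by auto
        then show ?thesis using S3 by (rule subset_trans)
      qed
    qed
  qed
  ultimately show ?thesis by blast
qed

lemma unisolvent:
  "\<exists>!\<tau>. \<tau> \<in> Sigma_div v nrm base k \<and> (\<forall>i\<in>blocks. \<forall>b\<in>block_dofs i. dof_value b \<tau> = a b)"
  unfolding Sigma_div_eq
proof (rule triangular_unisolvence[where r = block_rank, OF finite_blocks subspace_block_space])
  show "dof_value b (x + y) = dof_value b x + dof_value b y"
    if "i \<in> blocks" "b \<in> block_dofs i" "x \<in> span (\<Union>(block_space ` blocks))" "y \<in> span (\<Union>(block_space ` blocks))" for i b x y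
    using dof_value_add[OF that(1,2)] that(3,4) span_blocks_continuous by blast
qed (use dof_triangular block_unisolvent in blast)+

text \<open>Passes between the enumeration by blocks and the four families. The predicate is
  arbitrary, so that it can be instantiated with the equations for the prescribed values.\<close>

lemma dofs_iff:
  "(\<forall>i\<in>blocks. \<forall>b\<in>block_dofs i. P b) \<longleftrightarrow>
    (\<forall>l<d. \<forall>f \<in> T_simplices d l. \<forall>F \<in> T_simplices d (d - 1). f \<subseteq> F \<longrightarrow> (\<forall>q \<in> Qvec f. P (Boundary_Dof f F q))) \<and>
    (\<forall>l<d. \<forall>f \<in> interior_simplices d l. \<forall>i j. 1 \<le> i \<and> i \<le> j \<and> j \<le> d - l \<longrightarrow>
      (\<forall>q \<in> Q f. P (Normal_Dof f i j q))) \<and>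
    (\<forall>F \<in> interior_simplices d (d - 1). \<forall>l\<in>{1..d - 1}. \<forall>f \<in> subsimplices l F. \<forall>i\<in>{1..l}.
      \<forall>q \<in> Q f. P (Tangential_Dof F f i q)) \<and>
    (\<forall>m\<le>d. \<forall>q \<in> Qcell m. P (Cell_Dof m q))" (is "?L \<longleftrightarrow> ?A \<and> ?B \<and> ?C \<and> ?D")
proof (intro iffI conjI)
  assume L: ?L
  show ?A
  proof (intro allI ballI impI)
    fix l f F q assume l: "l < d" "f \<in> T_simplices d l" "F \<in> T_simplices d (d - 1)" "f \<subseteq> F" "q \<in> Qvec f"
    then have "f \<in> faces" "Suc d \<notin> f" using T_simplices_iff by auto
    then have "Face_Block f \<in> blocks" "Boundary_Dof f F q \<in> block_dofs (Face_Block f)"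
      using l by (auto simp: blocks_def)
    then show "P (Boundary_Dof f F q)" using L by blast
  qed
  show ?B
  proof (intro allI ballI impI)
    fix l f i j q assume l: "l < d" "f \<in> interior_simplices d l" "1 \<le> i \<and> i \<le> j \<and> j \<le> d - l" "q \<in> Q f"
    then have "f \<in> faces" "Suc d \<in> f" "card f = l + 1" using interior_simplices_iff by auto
    then have "Face_Block f \<in> blocks" "Normal_Dof f i j q \<in> block_dofs (Face_Block f)"
      using l by (auto simp: blocks_def)
    then show "P (Normal_Dof f i j q)" using L by blast
  qed
  show ?C
  proof (intro ballI)
    fix F l f i q assume l: "F \<in> interior_simplices d (d - 1)" "f \<in> subsimplices l F" "i \<in> {1..l}" "q \<in> Q f"
    then have "f \<subseteq> F" "f \<noteq> {}" "card f = l + 1" by (auto simp: subsimplices_def)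
    then have "Tangential_Block F f \<in> blocks" "Tangential_Dof F f i q \<in> block_dofs (Tangential_Block F f)"
      using l by (auto simp: blocks_def interior_facets_def)
    then show "P (Tangential_Dof F f i q)" using L by blast
  qed
  show ?D
  proof (intro allI impI ballI)
    fix m q assume "m \<le> d" "q \<in> Qcell m"
    then have "Cell_Block m \<in> blocks" "Cell_Dof m q \<in> block_dofs (Cell_Block m)" by (auto simp: blocks_def)
    then show "P (Cell_Dof m q)" using L by blast
  qed
next
  assume R: "?A \<and> ?B \<and> ?C \<and> ?D"
  note RA = R[THEN conjunct1, rule_format]
    and RB = R[THEN conjunct2, THEN conjunct1, rule_format]
    and RC = R[THEN conjunct2, THEN conjunct2, THEN conjunct1, rule_format]
    and RD = R[THEN conjunct2, THEN conjunct2, THEN conjunct2, rule_format]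
  show ?L
  proof (intro ballI)
    fix i b assume "i \<in> blocks" and b: "b \<in> block_dofs i"
    then show "P b"
    proof (cases rule: block_cases)
      case (face f)
      note ff = face_facts[OF face(2)]
      show ?thesis
      proof (cases "Suc d \<in> f")
        case True
        then obtain i j q where q: "b = Normal_Dof f i j q" "1 \<le> i \<and> i \<le> j \<and> j \<le> d + 1 - card f" "q \<in> Q f"
          using b face(1) by auto
        have f: "f \<in> interior_simplices d (card f - 1)"
          using interior_simplices_iff[OF ff(5)] face(2) True ff(6) by simp
        have "j \<le> d - (card f - 1)" using q(2) ff(4,6) by linarith
        then show ?thesis unfolding q(1) using q(2) by (intro RB[OF ff(5) f _ q(3)]) simp
      next
        case False
        then obtain F q where q: "b = Boundary_Dof f F q" "F \<in> T_simplices d (d - 1)" "f \<subseteq> F" "q \<in> Qvec f"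
          using b face(1) by auto
        have f: "f \<in> T_simplices d (card f - 1)"
          using T_simplices_iff[OF ff(5)] face(2) False ff(6) by simp
        show ?thesis unfolding q(1) by (rule RA[OF ff(5) f q(2-4)])
      qed
    next
      case (tangential F f)
      then obtain i q where q: "b = Tangential_Dof F f i q" "i \<in> {1..card f - 1}" "q \<in> Q f" using b by auto
      have F: "f \<in> subsimplices (card f - 1) F" "card f - 1 \<in> {1..d - 1}" "F \<in> interior_simplices d (d - 1)"
        using tangential(2,3) face_facts(4,6)[OF tangential(4)] q(2) by (auto simp: subsimplices_def interior_facets_def)
      show ?thesis unfolding q(1) by (rule RC[OF F(3,2,1) q(2,3)])
    next
      case (cell m)
      then obtain q where "b = Cell_Dof m q" "q \<in> Qcell m" using b by auto
      then show ?thesis using RD[OF cell(2)] by simp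
    qed
  qed
qed

end

theorem theorem4p7:
  fixes v :: "nat \<Rightarrow> real^'n"
    and d k :: nat
    and nrm :: "nat set \<Rightarrow> real^'n"
    and base adj :: "nat set \<Rightarrow> nat"
    and nb tb :: "nat set \<Rightarrow> nat \<Rightarrow> real^'n"
    and Qvec :: "nat set \<Rightarrow> (real^'n \<Rightarrow> real^'n) set"
    and Q :: "nat set \<Rightarrow> (real^'n \<Rightarrow> real) set"
    and Qcell :: "nat \<Rightarrow> (real^'n \<Rightarrow> real^'n^'n) set"
  assumes "d = CARD('n)" and "d \<ge> 2" and "k \<ge> 1"
    and "inj_on v {..d}" and "\<not> affine_dependent (v ` {..d})"
    and normals: "\<And>F. F \<in> R_simplices d (d - 1) \<Longrightarrow> norm (nrm F) = 1 \<and> nrm F \<in> normal_vectors v F"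
    and base_vertex: "\<And>l f. l < d \<Longrightarrow> f \<in> T_simplices d l \<Longrightarrow> base f \<in> f"
    and adjacent_cell: "\<And>l f. l < d \<Longrightarrow> f \<in> R_simplices d l \<Longrightarrow> adj f \<le> d \<and> f \<subseteq> cell d (adj f)"
    and normal_bases: "\<And>l f. l < d \<Longrightarrow> f \<in> interior_simplices d l \<Longrightarrow>
          indexed_basis_of (nb f) {1..d - l} (normal_vectors v f)"
    and tangent_bases: "\<And>l f F. 1 \<le> l \<Longrightarrow> F \<in> interior_simplices d (d - 1) \<Longrightarrow>
          f \<in> subsimplices l F \<Longrightarrow> indexed_basis_of (tb f) {1..l} (tangent v f)"
    and vec_test_bases: "\<And>l f. l < d \<Longrightarrow> f \<in> T_simplices d l \<Longrightarrow>
          basis_of (Qvec f) (face_vec_polys v (int k - int (l + 1)) f)"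
    and test_bases: "\<And>l f. l < d \<Longrightarrow> f \<in> R_simplices d l \<Longrightarrow>
          basis_of (Q f) (face_polys v (int k - int (l + 1)) f)"
    and cell_test_bases: "\<And>m. m \<le> d \<Longrightarrow> basis_of (Qcell m) (cell_bubbles v nrm k m)"
  shows "\<forall>(A :: nat set \<Rightarrow> nat set \<Rightarrow> (real^'n \<Rightarrow> real^'n) \<Rightarrow> real)
          (B :: nat set \<Rightarrow> nat \<Rightarrow> nat \<Rightarrow> (real^'n \<Rightarrow> real) \<Rightarrow> real)
          (C :: nat set \<Rightarrow> nat set \<Rightarrow> nat \<Rightarrow> (real^'n \<Rightarrow> real) \<Rightarrow> real)
          (D :: nat \<Rightarrow> (real^'n \<Rightarrow> real^'n^'n) \<Rightarrow> real).
    \<exists>!\<tau>. \<tau> \<in> Sigma_div v nrm base k \<and>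
      (\<forall>l<d. \<forall>f \<in> T_simplices d l. \<forall>F \<in> T_simplices d (d - 1). f \<subseteq> F \<longrightarrow> (\<forall>q \<in> Qvec f.
        face_integral v f (\<lambda>x. (\<tau> (adj F) x *v nrm F) \<bullet> q x) = A f F q)) \<and>
      (\<forall>l<d. \<forall>f \<in> interior_simplices d l. \<forall>i j. 1 \<le> i \<and> i \<le> j \<and> j \<le> d - l \<longrightarrow> (\<forall>q \<in> Q f.
        face_integral v f (\<lambda>x. (nb f i \<bullet> (\<tau> (adj f) x *v nb f j)) * q x) = B f i j q)) \<and>
      (\<forall>F \<in> interior_simplices d (d - 1). \<forall>l\<in>{1..d - 1}. \<forall>f \<in> subsimplices l F.
        \<forall>i\<in>{1..l}. \<forall>q \<in> Q f.
        face_integral v f (\<lambda>x. (tb f i \<bullet> (\<tau> (adj F) x *v nrm F)) * q x) = C F f i q) \<and>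
      (\<forall>m\<le>d. \<forall>q \<in> Qcell m.
        (LINT x|lebesgue_on (simplex_of v (cell d m)). \<tau> m x \<bullet> q x) = D m q)"
proof (intro allI)
  fix A :: "nat set \<Rightarrow> nat set \<Rightarrow> (real^'n \<Rightarrow> real^'n) \<Rightarrow> real"
    and B :: "nat set \<Rightarrow> nat \<Rightarrow> nat \<Rightarrow> (real^'n \<Rightarrow> real) \<Rightarrow> real"
    and C :: "nat set \<Rightarrow> nat set \<Rightarrow> nat \<Rightarrow> (real^'n \<Rightarrow> real) \<Rightarrow> real"
    and D :: "nat \<Rightarrow> (real^'n \<Rightarrow> real^'n^'n) \<Rightarrow> real"
  interpret unisolvence_data v d nrm k base adj nb tb Qvec Q Qcell
    by unfold_locales (fact assms)+
  \<comment> \<open>The four families of data become one function on the names of the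
    functionals.\<close>
  define a :: "'n dof \<Rightarrow> real" where "a b = (case b of Boundary_Dof f F q \<Rightarrow> A f F q
    | Normal_Dof f i j q \<Rightarrow> B f i j q | Tangential_Dof F f i q \<Rightarrow> C F f i q | Cell_Dof m q \<Rightarrow> D m q)" for b
  show "\<exists>!\<tau>. \<tau> \<in> Sigma_div v nrm base k \<and>
      (\<forall>l<d. \<forall>f \<in> T_simplices d l. \<forall>F \<in> T_simplices d (d - 1). f \<subseteq> F \<longrightarrow> (\<forall>q \<in> Qvec f.
        face_integral v f (\<lambda>x. (\<tau> (adj F) x *v nrm F) \<bullet> q x) = A f F q)) \<and>
      (\<forall>l<d. \<forall>f \<in> interior_simplices d l. \<forall>i j. 1 \<le> i \<and> i \<le> j \<and> j \<le> d - l \<longrightarrow> (\<forall>q \<in> Q f.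
        face_integral v f (\<lambda>x. (nb f i \<bullet> (\<tau> (adj f) x *v nb f j)) * q x) = B f i j q)) \<and>
      (\<forall>F \<in> interior_simplices d (d - 1). \<forall>l\<in>{1..d - 1}. \<forall>f \<in> subsimplices l F.
        \<forall>i\<in>{1..l}. \<forall>q \<in> Q f.
        face_integral v f (\<lambda>x. (tb f i \<bullet> (\<tau> (adj F) x *v nrm F)) * q x) = C F f i q) \<and>
      (\<forall>m\<le>d. \<forall>q \<in> Qcell m.
        (LINT x|lebesgue_on (simplex_of v (cell d m)). \<tau> m x \<bullet> q x) = D m q)"
    using unisolvent[of a] unfolding dofs_iff dof_value.simps a_def dof.case .
qed

end
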